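(* Let $\mathbb{K}$ be a field, let $G$ be a graph with vertex set $\{v_1,\dots,v_n\}$, and let $I=I(G)\subseteq S=\mathbb{K}[x_1,\dots,x_n]$ be its edge ideal. Then $I^k/I^{k+1}$ satisfies Stanley's inequality for every integer $k\gg 0$; that is, there exists an integer $k_0$ such that $\mathrm{depth}(I^k/I^{k+1})\leq \mathrm{sdepth}(I^k/I^{k+1})$ for every integer $k\geq k_0$.
   Context: Graphs are finite and simple. The edge ideal $I(G)$ is the ideal of $S=\mathbb{K}[x_1,\dots,x_n]$ generated by the squarefree monomials $x_ix_j$ with $\{v_i,v_j\}$ an edge of $G$. Depth is taken with respect to the maximal ideal $\mathfrak{m}=(x_1,\dots,x_n)$, for $S$-modules. Stanley depth: let $M$ be a finitely generated $\mathbb{Z}^n$-graded $S$-module, $u\in M$ a homogeneous element and $Z\subseteq\{x_1,\dots,x_n\}$. The $\mathbb{K}$-subspace $u\mathbb{K}[Z]$ generated by all $uv$ with $v\in\mathbb{K}[Z]$ is called a Stanley space of dimension $|Z|$ if it is a free $\mathbb{K}[Z]$-module. A Stanley decomposition $\mathcal{D}$ of $M$ is a decomposition of $M$ (as a $\mathbb{K}$-vector space) as a finite direct sum of Stanley spaces; $\mathrm{sdepth}(\mathcal{D})$ is the minimum dimension of a Stanley space in $\mathcal{D}$, and $\mathrm{sdepth}(M)$ is the maximum of $\mathrm{sdepth}(\mathcal{D})$ over all Stanley decompositions $\mathcal{D}$ of $M$. Convention: $\mathrm{depth}(0)=\mathrm{sdepth}(0)=+\infty$ (the zero module occurs here, for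 $k\ge1$, only when $G$ has no edges). *)

theory Defs
  imports "HOL-Algebra.Algebra" "HOL-Library.Poly_Mapping" "HOL-Library.Extended_Nat"
begin

section \<open>Polynomial rings\<close>

text \<open>Exponent vectors are finitely supported maps from the variables to \<open>nat\<close>; the sum of
  two exponent vectors is the exponent vector of the product of the two monomials.\<close>

type_synonym ('v, 'k) mpoly = "('v \<Rightarrow>\<^sub>0 nat) \<Rightarrow>\<^sub>0 'k"

definition mpoly_ring :: "'v set \<Rightarrow> ('v, 'k::field) mpoly ring" where
  "mpoly_ring V =
    \<lparr>carrier = {f. \<forall>t\<in>Poly_Mapping.keys f. Poly_Mapping.keys t \<subseteq> V},
     monoid.mult = (*), one = 1, ring.zero = 0, add = (+)\<rparr>"

definition var :: "'v \<Rightarrow> ('v, 'k::field) mpoly" where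
  "var v = Poly_Mapping.single (Poly_Mapping.single v 1) 1"

definition irrelevant_ideal :: "'v set \<Rightarrow> ('v, 'k::field) mpoly set" where
  "irrelevant_ideal V = Idl\<^bsub>mpoly_ring V\<^esub> (var ` V)"

text \<open>The polynomials all of whose monomials have multidegree \<open>a\<close>. This is zero unless \<open>a\<close>
  is nonnegative; inside \<^term>\<open>mpoly_ring V\<close> it is zero unless \<open>a\<close> also vanishes outside \<open>V\<close>,
  so there the grading is by the integer vectors indexed by \<open>V\<close>.\<close>

definition multidegree_part :: "('v \<Rightarrow> int) \<Rightarrow> ('v, 'k::field) mpoly set" where
  "multidegree_part a =
    {f. \<forall>t\<in>Poly_Mapping.keys f. \<forall>v. int (Poly_Mapping.lookup t v) = a v}"


section \<open>Graphs and edge ideals\<close>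

definition simple_graph :: "'v set \<Rightarrow> 'v set set \<Rightarrow> bool" where
  "simple_graph V E \<longleftrightarrow> finite V \<and> (\<forall>e\<in>E. e \<subseteq> V \<and> card e = 2)"

definition edge_ideal :: "'v set \<Rightarrow> 'v set set \<Rightarrow> ('v, 'k::field) mpoly set" where
  "edge_ideal V E = Idl\<^bsub>mpoly_ring V\<^esub> {var i * var j | i j. {i, j} \<in> E}"

definition ideal_power :: "('r, 'x) ring_scheme \<Rightarrow> 'r set \<Rightarrow> nat \<Rightarrow> 'r set" where
  "ideal_power R I k = I [^]\<^bsub>ideals_set R\<^esub> k"


section \<open>Quotients of ideals as modules\<close>

definition ideal_module :: "('r, 'x) ring_scheme \<Rightarrow> 'r set \<Rightarrow> ('r, 'r) module" where
  "ideal_module R J =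
    \<lparr>carrier = J, monoid.mult = monoid.mult R, one = one R, ring.zero = ring.zero R, add = add R,
     smult = monoid.mult R\<rparr>"

text \<open>The fields \<open>mult\<close> and \<open>one\<close> are present only because the record type of modules extends
  that of rings; the locale \<^locale>\<open>module\<close> ignores them.\<close>

definition quot_module :: "('r, 'm, 'x) module_scheme \<Rightarrow> 'm set \<Rightarrow> ('r, 'm set) module" where
  "quot_module M N =
    \<lparr>carrier = a_rcosets\<^bsub>M\<^esub> N, monoid.mult = (\<lambda>_ _. undefined), one = undefined,
     ring.zero = N, add = set_add M,
     smult = (\<lambda>r C. \<Union>x\<in>C. N +>\<^bsub>M\<^esub> (r \<odot>\<^bsub>M\<^esub> x))\<rparr>"

definition ideal_quot :: "('r, 'x) ring_scheme \<Rightarrow> 'r set \<Rightarrow> 'r set \<Rightarrow> ('r, 'r set) module" where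
  "ideal_quot R J L = quot_module (ideal_module R J) L"

definition ideal_quot_grading ::
    "'v set \<Rightarrow> ('v, 'k::field) mpoly set \<Rightarrow> ('v, 'k) mpoly set \<Rightarrow> ('v \<Rightarrow> int) \<Rightarrow>
     ('v, 'k) mpoly set set"
  where
  "ideal_quot_grading V J L a =
    (\<lambda>f. L +>\<^bsub>mpoly_ring V\<^esub> f) ` (J \<inter> multidegree_part a)"


section \<open>Depth\<close>

text \<open>The submodule \<open>r\<^sub>1 M + \<dots> + r\<^sub>d M\<close>.\<close>

primrec seq_submodule :: "('r, 'm, 'x) module_scheme \<Rightarrow> 'r list \<Rightarrow> 'm set" where
  "seq_submodule M [] = {\<zero>\<^bsub>M\<^esub>}"
| "seq_submodule M (r # rs) = ((\<lambda>x. r \<odot>\<^bsub>M\<^esub> x) ` carrier M) <+>\<^bsub>M\<^esub> seq_submodule M rs"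

text \<open>The first condition says that each \<open>rs ! i\<close> is a nonzerodivisor on the quotient of \<open>M\<close>
  by the submodule generated by the preceding elements.\<close>

definition regular_sequence :: "('r, 'm, 'x) module_scheme \<Rightarrow> 'r list \<Rightarrow> bool" where
  "regular_sequence M rs \<longleftrightarrow>
    (\<forall>i<length rs. \<forall>x\<in>carrier M.
       rs ! i \<odot>\<^bsub>M\<^esub> x \<in> seq_submodule M (take i rs) \<longrightarrow> x \<in> seq_submodule M (take i rs)) \<and>
    seq_submodule M rs \<noteq> carrier M"

definition depth :: "'r set \<Rightarrow> ('r, 'm, 'x) module_scheme \<Rightarrow> enat" where
  "depth A M =
    (if carrier M = {\<zero>\<^bsub>M\<^esub>} then \<infinity>
     else Sup {enat (length rs) | rs. set rs \<subseteq> A \<and> regular_sequence M rs})"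


section \<open>Stanley depth\<close>

text \<open>Coefficient families are functions on the whole type that vanish outside the basis.\<close>

definition module_basis ::
    "('r, 'y) ring_scheme \<Rightarrow> ('r, 'm, 'x) module_scheme \<Rightarrow> 'm set \<Rightarrow> bool" where
  "module_basis R M B \<longleftrightarrow> B \<subseteq> carrier M \<and>
    (\<forall>x\<in>carrier M. \<exists>!c. c \<in> UNIV \<rightarrow> carrier R \<and>
       finite {b. c b \<noteq> \<zero>\<^bsub>R\<^esub>} \<and> {b. c b \<noteq> \<zero>\<^bsub>R\<^esub>} \<subseteq> B \<and>
       x = (\<Oplus>\<^bsub>M\<^esub>b\<in>{b. c b \<noteq> \<zero>\<^bsub>R\<^esub>}. c b \<odot>\<^bsub>M\<^esub> b))"

definition free_module :: "('r, 'y) ring_scheme \<Rightarrow> ('r, 'm, 'x) module_scheme \<Rightarrow> bool" where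
  "free_module R M \<longleftrightarrow> module R M \<and> (\<exists>B. module_basis R M B)"

definition cyclic_space ::
    "(('v, 'k::field) mpoly, 'm, 'x) module_scheme \<Rightarrow> 'm \<Rightarrow> 'v set \<Rightarrow> 'm set" where
  "cyclic_space M u Z = (\<lambda>f. f \<odot>\<^bsub>M\<^esub> u) ` carrier (mpoly_ring Z)"

text \<open>In the following, \<open>M\<close> is a multigraded module over \<^term>\<open>mpoly_ring V\<close> and \<open>gr a\<close> is its
  homogeneous component of multidegree \<open>a\<close>. A Stanley space is given by the pair \<open>(u, Z)\<close>.
  Taken literally, freeness admits \<open>u = 0\<close> (the free module with empty basis); such summands do
  not affect \<open>sdepth\<close>, since omitting them from a decomposition of a nonzero module never lowers
  the minimum.\<close>

definition stanley_space ::
    "'v set \<Rightarrow> (('v, 'k::field) mpoly, 'm, 'x) module_scheme \<Rightarrow> (('v \<Rightarrow> int) \<Rightarrow> 'm set) \<Rightarrow>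
     'm \<times> 'v set \<Rightarrow> bool" where
  "stanley_space V M gr = (\<lambda>(u, Z). (\<exists>a. u \<in> gr a) \<and> Z \<subseteq> V \<and>
     free_module (mpoly_ring Z) (M\<lparr>carrier := cyclic_space M u Z\<rparr>))"

definition stanley_decomposition ::
    "'v set \<Rightarrow> (('v, 'k::field) mpoly, 'm, 'x) module_scheme \<Rightarrow> (('v \<Rightarrow> int) \<Rightarrow> 'm set) \<Rightarrow>
     ('m \<times> 'v set) set \<Rightarrow> bool" where
  "stanley_decomposition V M gr D \<longleftrightarrow> finite D \<and> (\<forall>p\<in>D. stanley_space V M gr p) \<and>
     (\<forall>x\<in>carrier M. \<exists>!s. s \<in> (\<Pi>\<^sub>E (u, Z)\<in>D. cyclic_space M u Z) \<and> x = finsum M s D)"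

definition sdepth_of_decomposition :: "('m \<times> 'v set) set \<Rightarrow> nat" where
  "sdepth_of_decomposition D = Min ((\<lambda>(u, Z). card Z) ` D)"

text \<open>The supremum is a maximum, because every dimension is at most \<open>card V\<close>.\<close>

definition sdepth ::
    "'v set \<Rightarrow> (('v, 'k::field) mpoly, 'm, 'x) module_scheme \<Rightarrow> (('v \<Rightarrow> int) \<Rightarrow> 'm set) \<Rightarrow> enat"
  where
  "sdepth V M gr =
    (if carrier M = {\<zero>\<^bsub>M\<^esub>} then \<infinity>
     else Sup {enat (sdepth_of_decomposition D) | D. stanley_decomposition V M gr D})"

end

theory Submission
  imports Defs
begin

text \<open>Let \<open>p\<close> be the number of bipartite components of the graph, isolated vertices included. For
  large \<open>k\<close> the number \<open>p\<close> separates the two invariants.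

  Upper bound for the depth: let \<open>u\<close> be a product of \<open>k\<close> edges in which all edges occur often. Exchanging
  edges along walks of odd length shows that modulo \<open>I\<^sup>k\<^sup>+\<^sup>1\<close> the element \<open>u\<close> is annihilated by
  \<open>x\<^sub>i x\<^sub>j\<close> for all \<open>i\<close>, \<open>j\<close> on opposite sides of a bipartite component and, after multiplying \<open>u\<close> by
  one vertex of each nonbipartite component, by all variables of these components. The wedge product of
  the one-forms \<open>\<Sum>\<^sub>i x\<^sub>i e\<^sub>i\<close>, where \<open>i\<close> runs through one side of a bipartite component, with
  coefficient \<open>u\<close>, is then a Koszul cocycle of degree \<open>p\<close> on \<open>I\<^sup>k / I\<^sup>k\<^sup>+\<^sup>1\<close>; an isolated vertex \<open>i\<close>
  contributes the form \<open>e\<^sub>i\<close>. The cocycle is not a coboundary, so no regular sequence has more than \<open>p\<close> elements.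

  Lower bound for the Stanley depth: the monomials in \<open>I\<^sup>k\<close> but not in \<open>I\<^sup>k\<^sup>+\<^sup>1\<close> are a disjoint union of
  products of such sets for the components, so it suffices to find Stanley spaces of dimension at
  least one for a bipartite component. There, by Koenig's theorem, each monomial can be multiplied by
  all powers of some variable.\<close>

section \<open>Combinatorial Stanley decompositions\<close>

text \<open>The number \<open>p\<close> enters only through \<open>good\<close>, which collects the
  two bounds with a common \<open>p\<close>. Both bounds pass to disjoint unions of graphs, because
  the largest number of edges whose product divides a monomial is additive. So only connected graphs
  need an argument of their own.

  Large \<open>k\<close> is needed for the depth only: one and the same product of \<open>k\<close>
  edges has to serve all pairs of vertices joined by an odd walk, and this takes sufficiently many
  edges. The Stanley spaces of dimension at least \<open>p\<close> exist for every \<open>k\<close>.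

  Koenig's theorem enters since in a bipartite graph a vertex cover of weight \<open>k\<close>
  certifies that no \<open>k + 1\<close> edges divide a monomial. Raising a variable outside the
  cover does not change the weight, so the certificate stays valid in that whole direction. This is
  why the cover has to be a proper subset of the vertices.

  A cocycle that is not a coboundary bounds the length of regular sequences because contraction with
  a regular element lowers its degree by one. All this is done with representatives in
  \<open>I^k\<close>, modulo a growing submodule, instead of with cohomology groups. Nontriviality
  is read off from an explicit linear functional, \<open>component_cycle\<close>.\<close>

text \<open>Used for exponent vectors, with \<open>A\<close> a set of variables, and for
  polynomials, with \<open>A\<close> a set of exponent vectors.\<close>

definition restr :: "'a set \<Rightarrow> ('a \<Rightarrow>\<^sub>0 'b::zero) \<Rightarrow> 'a \<Rightarrow>\<^sub>0 'b" where
  "restr A t = Poly_Mapping.mapp (\<lambda>k c. c when k \<in> A) t"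

lemma lookup_restr: "Poly_Mapping.lookup (restr A t) k = (Poly_Mapping.lookup t k when k \<in> A)"
  by (auto simp: restr_def lookup_mapp when_def in_keys_iff)

lemma keys_restr: "Poly_Mapping.keys (restr A t) = Poly_Mapping.keys t \<inter> A"
  by (auto simp: in_keys_iff lookup_restr)

lemma restr_add: "restr A (s + t) = restr A s + restr A t"
  for s t :: "'a \<Rightarrow>\<^sub>0 'b::monoid_add"
  by (rule poly_mapping_eqI) (simp add: lookup_restr lookup_add when_def)

lemma restr_id: "Poly_Mapping.keys t \<subseteq> A \<Longrightarrow> restr A t = t"
  by (rule poly_mapping_eqI) (auto simp: lookup_restr when_def in_keys_iff)

lemma restr_disjoint: "Poly_Mapping.keys t \<inter> A = {} \<Longrightarrow> restr A t = 0"
  by (rule poly_mapping_eqI) (auto simp: lookup_restr when_def in_keys_iff)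

lemma restr_add_restr:
  fixes t :: "'a \<Rightarrow>\<^sub>0 'b::monoid_add"
  assumes "Poly_Mapping.keys t \<subseteq> A \<union> B" "A \<inter> B = {}"
  shows "restr A t + restr B t = t"
proof (rule poly_mapping_eqI)
  fix k
  show "Poly_Mapping.lookup (restr A t + restr B t) k = Poly_Mapping.lookup t k"
    using assms by (cases "k \<in> A"; cases "k \<in> B")
      (auto simp: lookup_restr lookup_add in_keys_iff when_def)
qed

lemma keys_add_nat: "Poly_Mapping.keys (s + t) = Poly_Mapping.keys s \<union> Poly_Mapping.keys t"
  for s t :: "'a \<Rightarrow>\<^sub>0 nat"
  by (auto simp: in_keys_iff lookup_add)

lemma add_eq_disjoint_keys:
  fixes s t s' t' :: "'a \<Rightarrow>\<^sub>0 nat"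
  assumes "s + t = s' + t'" "A \<inter> B = {}" "Poly_Mapping.keys s \<subseteq> A" "Poly_Mapping.keys s' \<subseteq> A"
    "Poly_Mapping.keys t \<subseteq> B" "Poly_Mapping.keys t' \<subseteq> B"
  shows "s = s' \<and> t = t'"
proof -
  have t: "restr A t = 0" "restr A t' = 0" "restr B s = 0" "restr B s' = 0"
    using assms by (auto intro!: restr_disjoint)
  have "restr A (s + t) = restr A (s' + t')" "restr B (s + t) = restr B (s' + t')"
    using assms(1) by auto
  then show ?thesis using t assms(3-6) by (simp add: restr_add restr_id)
qed

text \<open>The exponents of the monomials spanning the Stanley space \<open>u K[Z]\<close>, for
  \<open>p = (u, Z)\<close>.\<close>

definition cylinder :: "('v \<Rightarrow>\<^sub>0 nat) \<times> 'v set \<Rightarrow> ('v \<Rightarrow>\<^sub>0 nat) set" where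
  "cylinder p = {fst p + t | t. Poly_Mapping.keys t \<subseteq> snd p}"

text \<open>The combinatorial form of a Stanley decomposition of Stanley depth at least \<open>q\<close>.\<close>

definition decomposable :: "nat \<Rightarrow> 'v set \<Rightarrow> ('v \<Rightarrow>\<^sub>0 nat) set \<Rightarrow> bool" where
  "decomposable q V P \<longleftrightarrow> (\<exists>D. finite D \<and>
     (\<forall>(u, Z)\<in>D. Poly_Mapping.keys u \<subseteq> V \<and> Z \<subseteq> V \<and> q \<le> card Z) \<and>
     (\<Union>p\<in>D. cylinder p) = P \<and> disjoint_family_on cylinder D)"

lemma decomposable_empty [simp]: "decomposable q V {}"
  unfolding decomposable_def by (rule exI[of _ "{}"]) (simp add: disjoint_family_on_def)

lemma decomposable_mono:
  assumes "decomposable q V P" "q' \<le> q"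
  shows "decomposable q' V P"
  using assms unfolding decomposable_def by (fastforce intro: order_trans)

lemma decomposable_Un:
  assumes "decomposable q V P" "decomposable q V Q" "P \<inter> Q = {}"
  shows "decomposable q V (P \<union> Q)"
proof -
  from assms(1) obtain D where D: "finite D"
    "\<forall>(u, Z)\<in>D. Poly_Mapping.keys u \<subseteq> V \<and> Z \<subseteq> V \<and> q \<le> card Z"
    "(\<Union>p\<in>D. cylinder p) = P" "disjoint_family_on cylinder D"
    unfolding decomposable_def by blast
  from assms(2) obtain E where E: "finite E"
    "\<forall>(u, Z)\<in>E. Poly_Mapping.keys u \<subseteq> V \<and> Z \<subseteq> V \<and> q \<le> card Z"
    "(\<Union>p\<in>E. cylinder p) = Q" "disjoint_family_on cylinder E"
    unfolding decomposable_def by blast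
  have "disjoint_family_on cylinder (D \<union> E)"
    using D(3,4) E(3,4) assms(3) unfolding disjoint_family_on_def by blast
  then show ?thesis
    unfolding decomposable_def using D E by (intro exI[of _ "D \<union> E"]) auto
qed

lemma decomposable_UN:
  assumes "finite A" "\<And>i. i \<in> A \<Longrightarrow> decomposable q V (P i)" "disjoint_family_on P A"
  shows "decomposable q V (\<Union>i\<in>A. P i)"
  using assms
proof (induction A rule: finite_induct)
  case (insert i A)
  have "P i \<inter> (\<Union>i\<in>A. P i) = {}"
    using insert.prems(2) insert.hyps(2) by (fastforce simp: disjoint_family_on_def)
  moreover have "disjoint_family_on P A"
    using insert.prems(2) by (auto simp: disjoint_family_on_def)
  ultimately show ?case
    using decomposable_Un[of q V "P i" "\<Union>i\<in>A. P i"] insert by simp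
qed simp

lemma cylinder_prod:
  assumes "Z1 \<inter> Z2 = {}"
  shows "cylinder (u1 + u2, Z1 \<union> Z2) =
    {s + t | s t. s \<in> cylinder (u1, Z1) \<and> t \<in> cylinder (u2, Z2)}"
proof (intro Set.set_eqI iffI)
  fix w assume "w \<in> cylinder (u1 + u2, Z1 \<union> Z2)"
  then obtain t where t: "Poly_Mapping.keys t \<subseteq> Z1 \<union> Z2" "w = (u1 + u2) + t"
    by (auto simp: cylinder_def)
  have "w = (u1 + restr Z1 t) + (u2 + restr Z2 t)"
    using restr_add_restr[OF t(1) assms] t(2) by (simp add: ac_simps)
  then show "w \<in> {s + t | s t. s \<in> cylinder (u1, Z1) \<and> t \<in> cylinder (u2, Z2)}"
    unfolding cylinder_def
    by (intro CollectI exI[of _ "u1 + restr Z1 t"] exI[of _ "u2 + restr Z2 t"]) (auto simp: keys_restr)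
next
  fix w assume "w \<in> {s + t | s t. s \<in> cylinder (u1, Z1) \<and> t \<in> cylinder (u2, Z2)}"
  then obtain s t where "Poly_Mapping.keys s \<subseteq> Z1" "Poly_Mapping.keys t \<subseteq> Z2"
    "w = (u1 + u2) + (s + t)"
    by (auto simp: cylinder_def ac_simps)
  then show "w \<in> cylinder (u1 + u2, Z1 \<union> Z2)"
    unfolding cylinder_def by (intro CollectI exI[of _ "s + t"]) (auto simp: keys_add_nat)
qed

lemma keys_cylinder:
  assumes "Poly_Mapping.keys u \<subseteq> V" "Z \<subseteq> V" "w \<in> cylinder (u, Z)"
  shows "Poly_Mapping.keys w \<subseteq> V"
proof -
  obtain t where "w = u + t" "Poly_Mapping.keys t \<subseteq> Z" using assms(3) by (auto simp: cylinder_def)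
  then show ?thesis using assms(1,2) keys_add_nat[of u t] by blast
qed

text \<open>Stanley spaces in disjoint sets of variables multiply to a Stanley space, and their
  dimensions add up. The products stay disjoint because a monomial factors uniquely along the two
  sets of variables.\<close>

lemma decomposable_prod:
  assumes "decomposable q1 V1 P1" "decomposable q2 V2 P2" "V1 \<inter> V2 = {}" "finite V1" "finite V2"
  shows "decomposable (q1 + q2) (V1 \<union> V2) {s + t | s t. s \<in> P1 \<and> t \<in> P2}"
proof -
  from assms(1) obtain D where D: "finite D"
    "\<forall>(u, Z)\<in>D. Poly_Mapping.keys u \<subseteq> V1 \<and> Z \<subseteq> V1 \<and> q1 \<le> card Z"
    "(\<Union>p\<in>D. cylinder p) = P1" "disjoint_family_on cylinder D"
    unfolding decomposable_def by blast
  have Dd: "Poly_Mapping.keys u \<subseteq> V1 \<and> Z \<subseteq> V1 \<and> q1 \<le> card Z" if "(u, Z) \<in> D" for u Z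
    using D(2) that by blast
  from assms(2) obtain E where E: "finite E"
    "\<forall>(u, Z)\<in>E. Poly_Mapping.keys u \<subseteq> V2 \<and> Z \<subseteq> V2 \<and> q2 \<le> card Z"
    "(\<Union>p\<in>E. cylinder p) = P2" "disjoint_family_on cylinder E"
    unfolding decomposable_def by blast
  have Ed: "Poly_Mapping.keys u \<subseteq> V2 \<and> Z \<subseteq> V2 \<and> q2 \<le> card Z" if "(u, Z) \<in> E" for u Z
    using E(2) that by blast
  define h where "h = (\<lambda>((u1, Z1), (u2, Z2)).
    (u1 + u2 :: 'a \<Rightarrow>\<^sub>0 nat, Z1 \<union> Z2 :: 'a set))"
  have cyl: "cylinder (h (a, b)) = {s + t | s t. s \<in> cylinder a \<and> t \<in> cylinder b}"
    if "a \<in> D" "b \<in> E" for a b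
  proof -
    obtain u1 Z1 u2 Z2 where "a = (u1, Z1)" "b = (u2, Z2)" by (metis surj_pair)
    moreover from this have "Z1 \<inter> Z2 = {}"
      using Dd[of u1 Z1] Ed[of u2 Z2] that assms(3) by blast
    ultimately show ?thesis
      using cylinder_prod[of Z1 Z2 u1 u2] by (simp add: h_def)
  qed
  have key: "Poly_Mapping.keys s \<subseteq> V1" if "a \<in> D" "s \<in> cylinder a" for a s
    using keys_cylinder[of "fst a" V1 "snd a" s] Dd[of "fst a" "snd a"] that by simp
  have key': "Poly_Mapping.keys s \<subseteq> V2" if "a \<in> E" "s \<in> cylinder a" for a s
    using keys_cylinder[of "fst a" V2 "snd a" s] Ed[of "fst a" "snd a"] that by simp
  show ?thesis
    unfolding decomposable_def
  proof (intro exI[of _ "h ` (D \<times> E)"] conjI)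
    show "finite (h ` (D \<times> E))" using D(1) E(1) by simp
    show "\<forall>(u, Z)\<in>h ` (D \<times> E). Poly_Mapping.keys u \<subseteq> V1 \<union> V2 \<and> Z \<subseteq> V1 \<union> V2 \<and> q1 + q2 \<le> card Z"
    proof (clarify)
      fix u Z u1 Z1 u2 Z2
      assume *: "(u, Z) = h ((u1, Z1), (u2, Z2))" "(u1, Z1) \<in> D" "(u2, Z2) \<in> E"
      have "card (Z1 \<union> Z2) = card Z1 + card Z2"
        using Dd[OF *(2)] Ed[OF *(3)] assms(3-5)
        by (intro card_Un_disjoint) (auto intro: finite_subset)
      then show "Poly_Mapping.keys u \<subseteq> V1 \<union> V2 \<and> Z \<subseteq> V1 \<union> V2 \<and> q1 + q2 \<le> card Z"
        using * Dd[OF *(2)] Ed[OF *(3)] by (auto simp: h_def keys_add_nat)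
    qed
    show "(\<Union>p\<in>h ` (D \<times> E). cylinder p) = {s + t | s t. s \<in> P1 \<and> t \<in> P2}"
    proof -
      have "(\<Union>p\<in>h ` (D \<times> E). cylinder p) =
          (\<Union>a\<in>D. \<Union>b\<in>E. cylinder (h (a, b)))" by auto
      also have "\<dots> = (\<Union>a\<in>D. \<Union>b\<in>E. {s + t | s t. s \<in> cylinder a \<and> t \<in> cylinder b})"
        by (intro SUP_cong refl cyl)
      also have "\<dots> = {s + t | s t. s \<in> P1 \<and> t \<in> P2}"
        unfolding D(3)[symmetric] E(3)[symmetric] by blast
      finally show ?thesis .
    qed
    show "disjoint_family_on cylinder (h ` (D \<times> E))"
      unfolding disjoint_family_on_def
    proof (intro ballI impI)
      fix p p' assume "p \<in> h ` (D \<times> E)" "p' \<in> h ` (D \<times> E)" and ne: "p \<noteq> p'"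
      then obtain a b a' b' where *: "p = h (a, b)" "p' = h (a', b')" "a \<in> D" "a' \<in> D"
        "b \<in> E" "b' \<in> E" by auto
      show "cylinder p \<inter> cylinder p' = {}"
      proof (rule ccontr)
        assume "cylinder p \<inter> cylinder p' \<noteq> {}"
        then obtain s t s' t' where st: "s \<in> cylinder a" "t \<in> cylinder b" "s' \<in> cylinder a'"
          "t' \<in> cylinder b'" "s + t = s' + t'"
          using cyl[OF *(3,5)] cyl[OF *(4,6)] * by auto
        have "s = s' \<and> t = t'"
          by (rule add_eq_disjoint_keys[OF st(5) assms(3)]) (use key key' st * in blast)+
        then have "a = a'" "b = b'"
          using D(4) E(4) st * unfolding disjoint_family_on_def by blast+
        then show False using ne * by simp
      qed
    qed
  qed
qed

lemma decomposable_shift: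
  assumes "decomposable q V P" "x \<notin> V" "finite V"
  shows "decomposable q (insert x V) {Poly_Mapping.single x j + t | t. t \<in> P}"
proof -
  have "decomposable 0 {x} {Poly_Mapping.single x j}"
    unfolding decomposable_def
    by (rule exI[of _ "{(Poly_Mapping.single x j, {})}"])
      (auto simp: cylinder_def disjoint_family_on_def)
  from decomposable_prod[OF this assms(1)] assms(2,3) show ?thesis by simp
qed

text \<open>All powers of \<open>x\<close> from \<open>j\<close> on form one cylinder with free
  variable \<open>x\<close>; this is the dimension gained over \<open>decomposable_shift\<close>,
  where the power of \<open>x\<close> is fixed.\<close>

lemma decomposable_ray:
  assumes "decomposable q V P" "x \<notin> V" "finite V"
  shows "decomposable (Suc q) (insert x V) {Poly_Mapping.single x i + t | i t. j \<le> i \<and> t \<in> P}"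
proof -
  have "cylinder (Poly_Mapping.single x j, {x}) = {Poly_Mapping.single x i | i. j \<le> i}"
  proof (intro Set.set_eqI iffI)
    fix w assume "w \<in> cylinder (Poly_Mapping.single x j, {x})"
    then obtain t where t: "Poly_Mapping.keys t \<subseteq> {x}" "w = Poly_Mapping.single x j + t"
      by (auto simp: cylinder_def)
    have "w = Poly_Mapping.single x (j + Poly_Mapping.lookup t x)"
      unfolding t(2) using t(1)
      by (intro poly_mapping_eqI) (auto simp: lookup_add lookup_single when_def in_keys_iff)
    then show "w \<in> {Poly_Mapping.single x i | i. j \<le> i}" by auto
  next
    fix w assume "w \<in> {Poly_Mapping.single x i | i. j \<le> i}"
    then obtain i where "j \<le> i" "w = Poly_Mapping.single x i" by auto
    then have "w = Poly_Mapping.single x j + Poly_Mapping.single x (i - j)"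
      by (simp flip: single_add)
    then show "w \<in> cylinder (Poly_Mapping.single x j, {x})"
      unfolding cylinder_def by (auto intro!: exI[of _ "Poly_Mapping.single x (i - j)"])
  qed
  then have "decomposable 1 {x} {Poly_Mapping.single x i | i. j \<le> i}"
    unfolding decomposable_def
    by (intro exI[of _ "{(Poly_Mapping.single x j, {x})}"]) (auto simp: disjoint_family_on_def)
  from decomposable_prod[OF this assms(1)] assms(2,3)
  have "decomposable (Suc q) (insert x V)
    {s + t |s t. s \<in> {Poly_Mapping.single x i | i. j \<le> i} \<and> t \<in> P}" by simp
  also have "{s + t |s t. s \<in> {Poly_Mapping.single x i | i. j \<le> i} \<and> t \<in> P} =
      {Poly_Mapping.single x i + t | i t. j \<le> i \<and> t \<in> P}" by blast
  finally show ?thesis .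
qed

section \<open>Differences of monomial ideals\<close>

definition upset :: "('v \<Rightarrow>\<^sub>0 nat) set \<Rightarrow> bool" where
  "upset I \<longleftrightarrow> (\<forall>t\<in>I. \<forall>s. t + s \<in> I)"

text \<open>For an upset this means that minimal generators have exponent at most \<open>N\<close>
  in every variable of \<open>V\<close>.\<close>

definition bounded_gens :: "nat \<Rightarrow> 'v set \<Rightarrow> ('v \<Rightarrow>\<^sub>0 nat) set \<Rightarrow> bool" where
  "bounded_gens N V I \<longleftrightarrow> (\<forall>x\<in>V. \<forall>t. N \<le> Poly_Mapping.lookup t x \<longrightarrow>
     t + Poly_Mapping.single x 1 \<in> I \<longrightarrow> t \<in> I)"

text \<open>The exponents of the colon ideal \<open>I : x^j\<close>. On vectors free of
  \<open>x\<close> this is the section of \<open>I\<close> at \<open>x\<close>-exponent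
  \<open>j\<close>.\<close>

definition slice :: "'v \<Rightarrow> nat \<Rightarrow> ('v \<Rightarrow>\<^sub>0 nat) set \<Rightarrow> ('v \<Rightarrow>\<^sub>0 nat) set" where
  "slice x j I = {t. Poly_Mapping.single x j + t \<in> I}"

lemma upset_Un: "upset I \<Longrightarrow> upset J \<Longrightarrow> upset (I \<union> J)"
  and upset_Int: "upset I \<Longrightarrow> upset J \<Longrightarrow> upset (I \<inter> J)"
  by (auto simp: upset_def)

lemma bounded_gens_Un: "bounded_gens N V I \<Longrightarrow> bounded_gens N V J \<Longrightarrow> bounded_gens N V (I \<union> J)"
  and bounded_gens_Int: "bounded_gens N V I \<Longrightarrow> bounded_gens N V J \<Longrightarrow> bounded_gens N V (I \<inter> J)"
  by (auto simp: bounded_gens_def)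

lemma upset_slice: "upset I \<Longrightarrow> upset (slice x j I)"
  by (auto simp: upset_def slice_def simp flip: add.assoc)

lemma bounded_gens_slice:
  assumes "bounded_gens N (insert x V) I" "x \<notin> V"
  shows "bounded_gens N V (slice x j I)"
  unfolding bounded_gens_def slice_def
proof (intro ballI allI impI)
  fix y t assume y: "y \<in> V" "N \<le> Poly_Mapping.lookup t y"
    "t + Poly_Mapping.single y 1 \<in> {t. Poly_Mapping.single x j + t \<in> I}"
  have "N \<le> Poly_Mapping.lookup (Poly_Mapping.single x j + t) y" using y by (simp add: lookup_add)
  then show "t \<in> {t. Poly_Mapping.single x j + t \<in> I}"
    using assms(1) y unfolding bounded_gens_def by (auto simp: add.assoc)
qed

lemma slice_mono:
  assumes "upset I" "i \<le> j"
  shows "slice x i I \<subseteq> slice x j I"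
proof
  fix t assume "t \<in> slice x i I"
  then have "(Poly_Mapping.single x i + t) + Poly_Mapping.single x (j - i) \<in> I"
    using assms(1) by (auto simp: slice_def upset_def)
  also have "(Poly_Mapping.single x i + t) + Poly_Mapping.single x (j - i) =
      Poly_Mapping.single x (i + (j - i)) + t"
    unfolding single_add by (simp add: ac_simps)
  finally show "t \<in> slice x j I" using assms(2) by (simp add: slice_def)
qed

text \<open>Together with \<open>slice_mono\<close> this makes the slices constant from
  \<open>N\<close> on, so that finitely many of them describe \<open>I\<close>.\<close>

lemma slice_bounded:
  assumes "bounded_gens N (insert x V) I" "N \<le> j"
  shows "slice x j I \<subseteq> slice x N I"
proof -
  have "slice x (N + i) I \<subseteq> slice x N I" for i
  proof (induction i)
    case (Suc i)
    have "t \<in> slice x (N + i) I" if "t \<in> slice x (N + Suc i) I" for t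
    proof -
      have "Poly_Mapping.single x (N + Suc i) + t =
          (Poly_Mapping.single x (N + i) + t) + Poly_Mapping.single x 1"
        by (intro poly_mapping_eqI) (auto simp: lookup_add lookup_single when_def)
      then show ?thesis
        using assms(1) that unfolding bounded_gens_def slice_def
        by (auto simp: lookup_add)
    qed
    then show ?case using Suc by blast
  qed simp
  from this[of "j - N"] show ?thesis using assms(2) by simp
qed

text \<open>Slice by the exponent of a variable \<open>x\<close>. Exponent vectors that never enter \<open>J\<close> in direction
  \<open>x\<close> are covered by rays in direction \<open>x\<close>, started where they enter \<open>I\<close>; the others form finitely
  many slices, for which the free direction is different from \<open>x\<close>.\<close>

lemma decomposable_upset_diff:
  assumes "finite V" "upset I" "upset J" "bounded_gens N V I" "bounded_gens N V J" "q \<le> 1"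
    and "\<And>t. q = 1 \<Longrightarrow> t \<in> I - J \<Longrightarrow> Poly_Mapping.keys t \<subseteq> V \<Longrightarrow>
      \<exists>x\<in>V. \<forall>m. t + Poly_Mapping.single x m \<notin> J"
  shows "decomposable q V {t \<in> I - J. Poly_Mapping.keys t \<subseteq> V}"
  using assms
proof (induction V arbitrary: I J q rule: finite_induct)
  case empty
  show ?case
  proof (cases "0 \<in> I - J")
    case True
    then have "q = 0" using empty.prems(6)[of 0] empty.prems(5) by (cases "q = 1") auto
    moreover have "{t \<in> I - J. Poly_Mapping.keys t \<subseteq> {}} = {0}" using True by auto
    ultimately show ?thesis
      unfolding decomposable_def
      by (intro exI[of _ "{(0, {})}"]) (auto simp: cylinder_def disjoint_family_on_def)
  next
    case False
    then have "{t \<in> I - J. Poly_Mapping.keys t \<subseteq> {}} = {}" by auto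
    then show ?thesis by (simp only: decomposable_empty)
  qed
next
  case (insert x V)
  note I = insert.prems(1) and J = insert.prems(2) and bI = insert.prems(3) and bJ = insert.prems(4)
  \<comment> \<open>\<open>slice x N J\<close> is the largest slice of \<open>J\<close>, so lying
    outside it means never entering \<open>J\<close> in direction \<open>x\<close>. Removing
    \<open>slice x (j - 1) I\<close> makes \<open>j\<close> the first exponent at which
    \<open>t\<close> enters \<open>I\<close>, so that no ray is counted twice.\<close>
  define Q where "Q j = {t \<in> slice x j I -
    ((if j = 0 then {} else slice x (j - 1) I) \<union> slice x N J). Poly_Mapping.keys t \<subseteq> V}" for j
  define R where "R j = {t \<in> slice x j I \<inter> slice x N J - slice x j J. Poly_Mapping.keys t \<subseteq> V}" for j
  let ?s = "\<lambda>(i::nat) t. Poly_Mapping.single x i + t"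
  have below: "upset (if j = 0 then {} else slice x (j - 1) I)"
    "bounded_gens N V (if j = 0 then {} else slice x (j - 1) I)" for j
    using I bI insert.hyps(2) by (auto intro: upset_slice bounded_gens_slice) (auto simp: upset_def bounded_gens_def)
  \<comment> \<open>Dimension 0 is enough here, since the ray itself supplies a free
    variable.\<close>
  have dQ: "decomposable 0 V (Q j)" for j
    unfolding Q_def
  proof (rule insert.IH)
    show "upset ((if j = 0 then {} else slice x (j - 1) I) \<union> slice x N J)"
      by (intro upset_Un below upset_slice J)
    show "bounded_gens N V ((if j = 0 then {} else slice x (j - 1) I) \<union> slice x N J)"
      by (intro bounded_gens_Un below bounded_gens_slice bJ insert.hyps(2))
  qed (use I bI insert.hyps(2) in \<open>auto intro: upset_slice bounded_gens_slice\<close>)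
  have dR: "decomposable q V (R j)" for j
    unfolding R_def
  proof (rule insert.IH)
    show "upset (slice x j I \<inter> slice x N J)" "upset (slice x j J)"
      by (intro upset_Int upset_slice I J)+
    show "bounded_gens N V (slice x j I \<inter> slice x N J)" "bounded_gens N V (slice x j J)"
      by (intro bounded_gens_Int bounded_gens_slice bI bJ insert.hyps(2))+
    show "q \<le> 1" by (rule insert.prems(5))
    fix t assume t: "q = 1" "t \<in> slice x j I \<inter> slice x N J - slice x j J" "Poly_Mapping.keys t \<subseteq> V"
    have "\<exists>y\<in>insert x V. \<forall>m. ?s j t + Poly_Mapping.single y m \<notin> J"
      by (rule insert.prems(6)) (use t in \<open>auto simp: slice_def keys_add_nat split: if_splits\<close>)
    then obtain y where y: "y \<in> insert x V" "\<And>m. ?s j t + Poly_Mapping.single y m \<notin> J"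
      by blast
    have "y \<noteq> x"
    proof
      assume "y = x"
      have "t \<in> slice x (j + N) J" using t(2) slice_mono[OF J, of N "j + N" x] by auto
      then have "?s (j + N) t \<in> J" by (simp add: slice_def)
      then have "?s j t + Poly_Mapping.single y N \<in> J"
        using \<open>y = x\<close> by (simp add: single_add ac_simps)
      then show False using y(2) by blast
    qed
    then show "\<exists>y\<in>V. \<forall>m. t + Poly_Mapping.single y m \<notin> slice x j J"
      using y by (auto simp: slice_def add.assoc)
  qed
  have s_inj: "i = i' \<and> t = t'"
    if "?s i t = ?s i' t'" "Poly_Mapping.keys t \<subseteq> V" "Poly_Mapping.keys t' \<subseteq> V" for i i' t t'
  proof -
    have "Poly_Mapping.single x i = Poly_Mapping.single x i' \<and> t = t'"
      by (rule add_eq_disjoint_keys[OF that(1), of "{x}" V]) (use that insert.hyps(2) in auto)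
    then show ?thesis by (metis lookup_single_eq)
  qed
  let ?rays = "\<lambda>j. {?s i t | i t. j \<le> i \<and> t \<in> Q j}"
  let ?shifts = "\<lambda>j. {?s j t | t. t \<in> R j}"
  have Q_keys: "Poly_Mapping.keys t \<subseteq> V" if "t \<in> Q j" for t j using that by (auto simp: Q_def)
  have R_keys: "Poly_Mapping.keys t \<subseteq> V" if "t \<in> R j" for t j using that by (auto simp: R_def)
  have Q_disj: "j = j'" if "t \<in> Q j" "t \<in> Q j'" for t j j'
  proof -
    have "\<not> j < j'" if "t \<in> Q j" "t \<in> Q j'" for j j'
    proof
      assume "j < j'"
      then have "slice x j I \<subseteq> slice x (j' - 1) I" by (intro slice_mono[OF I]) simp
      then show False using that \<open>j < j'\<close> by (auto simp: Q_def)
    qed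
    from this[OF that] this[OF that(2,1)] show ?thesis by simp
  qed
  have "decomposable q (insert x V) (\<Union>j\<in>{..N}. ?rays j)"
  proof (rule decomposable_UN)
    show "decomposable q (insert x V) (?rays j)" for j
      by (rule decomposable_mono[OF decomposable_ray[OF dQ insert.hyps(2,1)]])
        (use insert.prems(5) in auto)
    show "disjoint_family_on ?rays {..N}"
      unfolding disjoint_family_on_def using s_inj Q_keys Q_disj by blast
  qed simp
  moreover have "decomposable q (insert x V) (\<Union>j\<in>{..<N}. ?shifts j)"
  proof (rule decomposable_UN)
    show "decomposable q (insert x V) (?shifts j)" for j
      by (rule decomposable_shift[OF dR insert.hyps(2,1)])
    show "disjoint_family_on ?shifts {..<N}"
      unfolding disjoint_family_on_def using s_inj R_keys by blast
  qed simp
  moreover have "(\<Union>j\<in>{..N}. ?rays j) \<inter> (\<Union>j\<in>{..<N}. ?shifts j) = {}"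
  proof -
    have "t \<notin> slice x N J" if "t \<in> Q j" for t j using that by (simp add: Q_def)
    moreover have "t \<in> slice x N J" if "t \<in> R j" for t j using that by (simp add: R_def)
    ultimately show ?thesis using s_inj Q_keys R_keys by blast
  qed
  \<comment> \<open>A vector that enters \<open>I\<close> does so at an exponent at most
    \<open>N\<close>, hence rays for \<open>j \<le> N\<close>. For \<open>j \<ge> N\<close> the set
    \<open>slice x N J\<close> lies in \<open>slice x j J\<close> and \<open>R j\<close> is empty,
    hence shifts for \<open>j < N\<close> only.\<close>
  moreover have "{t \<in> I - J. Poly_Mapping.keys t \<subseteq> insert x V} =
      (\<Union>j\<in>{..N}. ?rays j) \<union> (\<Union>j\<in>{..<N}. ?shifts j)"
  proof (intro Set.set_eqI iffI)
    fix w assume w: "w \<in> {t \<in> I - J. Poly_Mapping.keys t \<subseteq> insert x V}"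
    define i t where "i = Poly_Mapping.lookup w x" and "t = restr V w"
    have wt: "w = ?s i t" unfolding i_def t_def
      using w insert.hyps(2) by (intro poly_mapping_eqI)
        (auto simp: lookup_add lookup_single lookup_restr when_def in_keys_iff)
    have t: "Poly_Mapping.keys t \<subseteq> V" by (simp add: t_def keys_restr)
    have tI: "t \<in> slice x i I" "t \<notin> slice x i J" using w wt by (auto simp: slice_def)
    show "w \<in> (\<Union>j\<in>{..N}. ?rays j) \<union> (\<Union>j\<in>{..<N}. ?shifts j)"
    proof (cases "t \<in> slice x N J")
      case True
      then have "i < N" using tI(2) slice_mono[OF J, of N i x] by (cases "N \<le> i") auto
      moreover have "t \<in> R i" using True tI t by (simp add: R_def)
      ultimately show ?thesis using wt by blast
    next
      case False
      define j where "j = (LEAST j. t \<in> slice x j I)"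
      have j: "t \<in> slice x j I" unfolding j_def by (rule LeastI[of _ i]) (rule tI)
      have "j \<le> i" unfolding j_def by (rule Least_le) (rule tI)
      have "j \<le> N"
      proof (cases "N \<le> i")
        case True
        then show ?thesis
          unfolding j_def by (intro Least_le) (use slice_bounded[OF bI True] tI in blast)
      qed (use \<open>j \<le> i\<close> in simp)
      have "t \<notin> slice x (j - 1) I" if "j \<noteq> 0"
        using not_less_Least[of "j - 1" "\<lambda>j. t \<in> slice x j I"] that by (simp add: j_def)
      then have "t \<in> Q j" using j False t by (simp add: Q_def)
      then show ?thesis using \<open>j \<le> i\<close> \<open>j \<le> N\<close> wt by blast
    qed
  next
    fix w assume "w \<in> (\<Union>j\<in>{..N}. ?rays j) \<union> (\<Union>j\<in>{..<N}. ?shifts j)"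
    then consider (ray) i j t where "w = ?s i t" "j \<le> i" "t \<in> Q j" |
      (shift) j t where "w = ?s j t" "t \<in> R j" by blast
    then show "w \<in> {t \<in> I - J. Poly_Mapping.keys t \<subseteq> insert x V}"
    proof cases
      case ray
      have "t \<in> slice x i I" using ray slice_mono[OF I ray(2), of x] by (auto simp: Q_def)
      moreover have "t \<notin> slice x i J"
        using ray slice_mono[OF J, of i N x] slice_bounded[OF bJ, of i]
        by (cases "i \<le> N") (auto simp: Q_def)
      moreover have "Poly_Mapping.keys w \<subseteq> insert x V"
        unfolding ray(1) keys_add_nat using Q_keys[OF ray(3)] by (auto split: if_splits)
      ultimately show ?thesis unfolding ray(1) by (simp add: slice_def)
    next
      case shift
      have "Poly_Mapping.keys w \<subseteq> insert x V"
        unfolding shift(1) keys_add_nat using R_keys[OF shift(2)] by (auto split: if_splits)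
      then show ?thesis using shift by (simp add: R_def slice_def)
    qed
  qed
  ultimately show ?case by (simp only: decomposable_Un)
qed

section \<open>Monomials divisible by products of edges\<close>

text \<open>Multisets of edges stand for products of edges; this is the exponent of \<open>v\<close>
  in the product.\<close>

definition mdeg :: "'v set multiset \<Rightarrow> 'v \<Rightarrow> nat" where
  "mdeg M v = size (filter_mset (\<lambda>e. v \<in> e) M)"

lemma mdeg_empty [simp]: "mdeg {#} v = 0"
  and mdeg_add_mset [simp]: "mdeg (add_mset e M) v = (if v \<in> e then 1 else 0) + mdeg M v"
  and mdeg_union [simp]: "mdeg (M + N) v = mdeg M v + mdeg N v"
  by (auto simp: mdeg_def)

text \<open>Double counting of the incidences between \<open>C\<close> and the edges of
  \<open>M\<close>.\<close>

lemma sum_mdeg: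
  assumes "finite C"
  shows "(\<Sum>v\<in>C. mdeg M v) = (\<Sum>e\<in>#M. card (e \<inter> C))"
proof (induction M)
  case (add e M)
  have "(\<Sum>v\<in>C. if v \<in> e then 1 else 0) = card (e \<inter> C)"
    using assms by (simp add: sum.If_cases Int_commute)
  then show ?case using add by (simp add: sum.distrib)
qed simp

text \<open>The exponents of the monomials in \<open>I^k\<close>. A multiset is needed because edges
  may be repeated; that the support lies in the vertex set is imposed separately.\<close>

definition edge_power :: "'v set set \<Rightarrow> nat \<Rightarrow> ('v \<Rightarrow>\<^sub>0 nat) set" where
  "edge_power E k = {t. \<exists>M. set_mset M \<subseteq> E \<and> size M = k \<and> (\<forall>v. mdeg M v \<le> Poly_Mapping.lookup t v)}"

text \<open>The cover is read off from a set \<open>R \<subseteq> A\<close> of vertices to which the slack of a maximum matching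
  can be moved along alternating paths. Each path is kept as the matching \<open>N\<close> that results from it,
  together with the information that it uses no edge outside \<open>R\<close>.\<close>

lemma koenig_cover:
  fixes t :: "'v \<Rightarrow>\<^sub>0 nat"
  assumes "finite A" "finite B" "A \<inter> B = {}" "B \<noteq> {}"
    and E: "\<And>e. e \<in> E \<Longrightarrow> \<exists>a\<in>A. \<exists>b\<in>B. e = {a, b}"
    and t: "t \<in> edge_power E k" "t \<notin> edge_power E (Suc k)"
  shows "\<exists>C\<subset>A \<union> B. (\<forall>e\<in>E. e \<inter> C \<noteq> {}) \<and> (\<Sum>v\<in>C. Poly_Mapping.lookup t v) \<le> k"
proof -
  obtain M where M: "set_mset M \<subseteq> E" "size M = k" "\<And>v. mdeg M v \<le> Poly_Mapping.lookup t v"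
    using t(1) by (auto simp: edge_power_def)
  \<comment> \<open>\<open>t\<close> is read as a capacity on the vertices and \<open>M\<close> as a
    largest multiset of edges respecting it; \<open>S\<close> consists of the vertices of
    \<open>A\<close> with capacity left.\<close>
  define S where "S = {a\<in>A. mdeg M a < Poly_Mapping.lookup t a}"
  \<comment> \<open>One unit of degree passes from \<open>a\<close> to \<open>a0\<close>, which has
    slack. So \<open>N\<close> still respects the capacities and leaves room for one more edge at
    \<open>a\<close>.\<close>
  define good where "good R a N a0 \<longleftrightarrow> set_mset N \<subseteq> E \<and> size N = k \<and> (\<forall>b\<in>B. mdeg N b = mdeg M b) \<and>
    a0 \<in> S \<and> (\<forall>v\<in>A. mdeg N v + (if v = a then 1 else 0) = mdeg M v + (if v = a0 then 1 else 0)) \<and>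
    filter_mset (\<lambda>e. e \<inter> R = {}) N = filter_mset (\<lambda>e. e \<inter> R = {}) M" for R a N a0
  define Rs where "Rs = {R. S \<subseteq> R \<and> R \<subseteq> A \<and> (\<forall>a\<in>R. \<exists>N a0. good R a N a0)}"
  have SRs: "S \<in> Rs"
    unfolding Rs_def
  proof (intro CollectI conjI ballI)
    fix a assume "a \<in> S"
    then have "good S a M a" using M by (simp add: good_def)
    then show "\<exists>N a0. good S a N a0" by blast
  qed (auto simp: S_def)
  have "finite Rs"
    by (rule finite_subset[of _ "Pow A"]) (use assms(1) in \<open>auto simp: Rs_def\<close>)
  \<comment> \<open>A maximal \<open>R\<close> replaces the search along alternating paths.\<close>
  from finite_has_maximal2[OF this SRs] obtain R where R: "R \<in> Rs" "\<forall>R'\<in>Rs. R \<subseteq> R' \<longrightarrow> R = R'"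
    by blast
  have RA: "S \<subseteq> R" "R \<subseteq> A" and Rgood: "\<And>a. a \<in> R \<Longrightarrow> \<exists>N a0. good R a N a0"
    using R(1) unfolding Rs_def by blast+
  \<comment> \<open>Otherwise \<open>{a, b}\<close> could be added to \<open>N\<close>, which is the
    augmenting path of the classical proof, and \<open>k + 1\<close> edges would divide
    \<open>t\<close>.\<close>
  have no_slack: "Poly_Mapping.lookup t b \<le> mdeg M b" if ab: "a \<in> R" "{a, b} \<in> E" "b \<in> B" for a b
  proof (rule ccontr)
    assume "\<not> ?thesis"
    then have slack: "mdeg M b < Poly_Mapping.lookup t b" by simp
    from Rgood[OF ab(1)] obtain N a0 where "good R a N a0" by blast
    then have N: "set_mset N \<subseteq> E" "size N = k" "\<And>b. b \<in> B \<Longrightarrow> mdeg N b = mdeg M b"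
      "a0 \<in> S" "\<And>v. v \<in> A \<Longrightarrow> mdeg N v + (if v = a then 1 else 0) = mdeg M v + (if v = a0 then 1 else 0)"
      unfolding good_def by blast+
    have "mdeg (add_mset {a, b} N) v \<le> Poly_Mapping.lookup t v" for v
    proof (cases "v \<in> A")
      case True
      then have "v \<noteq> b" using ab(3) assms(3) by blast
      moreover have "mdeg N v + (if v = a then 1 else 0) \<le> Poly_Mapping.lookup t v"
        unfolding N(5)[OF True] using N(4) M(3)[of v] by (auto simp: S_def)
      ultimately show ?thesis by auto
    next
      case False
      then have va: "v \<noteq> a" using ab(1) RA by blast
      show ?thesis
      proof (cases "v \<in> B")
        case True
        then show ?thesis using va N(3)[OF True] slack M(3)[of v] by auto
      next
        case nB: False
        have "v \<notin> e" if "e \<in># N" for e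
          using N(1) E[of e] False nB that by blast
        then have "mdeg N v = 0" by (simp add: mdeg_def)
        then show ?thesis using va nB ab(3) by auto
      qed
    qed
    then have "t \<in> edge_power E (Suc k)"
      unfolding edge_power_def using N ab by (intro CollectI exI[of _ "add_mset {a, b} N"]) auto
    then show False using t(2) by blast
  qed
  \<comment> \<open>If \<open>a'\<close> were missing, \<open>R\<close> could be enlarged:
    \<open>{a', b}\<close> avoids \<open>R\<close>, so it still occurs in the \<open>N\<close> that
    moves slack to \<open>a\<close>, and replacing it there by \<open>{a, b}\<close> moves the slack
    on to \<open>a'\<close>.\<close>
  have closed: "a' \<in> R" if ab: "a \<in> R" "{a, b} \<in> E" "b \<in> B" "{a', b} \<in># M" "a' \<in> A" for a b a'
  proof (rule ccontr)
    assume a': "a' \<notin> R"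
    have bR: "b \<notin> R" using ab(3) RA assms(3) by blast
    have "insert a' R \<in> Rs"
      unfolding Rs_def
    proof (intro CollectI conjI ballI)
      show "S \<subseteq> insert a' R" "insert a' R \<subseteq> A" using RA ab(5) by auto
      have mono: "filter_mset (\<lambda>e. e \<inter> insert a' R = {}) N = filter_mset (\<lambda>e. e \<inter> insert a' R = {}) M"
        if "filter_mset (\<lambda>e. e \<inter> R = {}) N = filter_mset (\<lambda>e. e \<inter> R = {}) M" for N
      proof -
        have "filter_mset (\<lambda>e. e \<inter> insert a' R = {}) N =
            filter_mset (\<lambda>e. e \<inter> insert a' R = {}) (filter_mset (\<lambda>e. e \<inter> R = {}) N)" for N
          unfolding filter_filter_mset by (rule filter_mset_cong) auto
        then show ?thesis using that by metis
      qed
      fix c assume c: "c \<in> insert a' R"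
      show "\<exists>N a0. good (insert a' R) c N a0"
      proof (cases "c = a'")
        case False
        then obtain N a0 where "good R c N a0" using c Rgood[of c] by blast
        then have "good (insert a' R) c N a0" using mono[of N] unfolding good_def by blast
        then show ?thesis by blast
      next
        case True
        from Rgood[OF ab(1)] obtain N a0 where N: "good R a N a0" by blast
        have "{a', b} \<in># filter_mset (\<lambda>e. e \<inter> R = {}) M" using ab(4) a' bR by simp
        then have "{a', b} \<in># filter_mset (\<lambda>e. e \<inter> R = {}) N" using N by (simp add: good_def)
        then obtain N0 where N0: "N = add_mset {a', b} N0"
          by (auto dest: multi_member_split)
        have ne: "a \<noteq> a'" "b \<noteq> a" "b \<noteq> a'" using ab a' RA assms(3) by blast+
        have "good (insert a' R) a' (add_mset {a, b} N0) a0"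
          unfolding good_def
        proof (intro conjI ballI)
          show "set_mset (add_mset {a, b} N0) \<subseteq> E" "size (add_mset {a, b} N0) = k"
            using N N0 ab(2) by (auto simp: good_def)
          show "mdeg (add_mset {a, b} N0) v = mdeg M v" if "v \<in> B" for v
          proof -
            have "mdeg N v = mdeg M v" using N that by (simp add: good_def)
            moreover have "v \<noteq> a" "v \<noteq> a'" using that ab RA assms(3) by blast+
            ultimately show ?thesis using N0 by simp
          qed
          show "a0 \<in> S" using N by (simp add: good_def)
          show "mdeg (add_mset {a, b} N0) v + (if v = a' then 1 else 0) = mdeg M v + (if v = a0 then 1 else 0)"
            if "v \<in> A" for v
          proof -
            have "mdeg N v + (if v = a then 1 else 0) = mdeg M v + (if v = a0 then 1 else 0)"
              using N that by (simp add: good_def)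
            moreover have "v \<noteq> b" using that ab(3) assms(3) by blast
            ultimately show ?thesis using N0 ne by (auto split: if_splits)
          qed
          have "filter_mset (\<lambda>e. e \<inter> insert a' R = {}) N = filter_mset (\<lambda>e. e \<inter> insert a' R = {}) M"
            by (rule mono) (use N in \<open>simp add: good_def\<close>)
          then show "filter_mset (\<lambda>e. e \<inter> insert a' R = {}) (add_mset {a, b} N0) =
              filter_mset (\<lambda>e. e \<inter> insert a' R = {}) M"
            using N0 ab(1) by auto
        qed
        then show ?thesis using True by blast
      qed
    qed
    then show False using R(2) a' by blast
  qed
  define T where "T = {b\<in>B. \<exists>a\<in>R. {a, b} \<in> E}"
  \<comment> \<open>Koenig's cover: the vertices of \<open>A\<close> that slack cannot reach and the
    vertices of \<open>B\<close> adjacent to those it reaches.\<close>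
  define C where "C = (A - R) \<union> T"
  have fin: "finite C" using assms(1,2) by (auto simp: C_def T_def)
  show ?thesis
  proof (intro exI[of _ C] conjI ballI)
    show "C \<subset> A \<union> B"
    proof -
      have "C \<noteq> A \<union> B"
      proof
        assume *: "C = A \<union> B"
        have "T \<inter> A = {}" using assms(3) by (auto simp: T_def)
        then have "R = {}" using * RA by (auto simp: C_def)
        then have "T = {}" by (auto simp: T_def)
        then show False using * \<open>R = {}\<close> assms(3,4) by (auto simp: C_def)
      qed
      then show ?thesis by (auto simp: C_def T_def)
    qed
    show "e \<inter> C \<noteq> {}" if "e \<in> E" for e
      using E[OF that] that by (auto simp: C_def T_def)
    \<comment> \<open>By \<open>closed\<close> no edge of \<open>M\<close> has both ends in
      \<open>C\<close>, so \<open>C\<close> counts each of the \<open>k\<close> edges once. By the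
      choice of \<open>S\<close> and \<open>no_slack\<close>, \<open>M\<close> exhausts the capacity
      on \<open>C\<close>, which therefore is at most \<open>k\<close>.\<close>
    have one: "card (e \<inter> C) = 1" if e: "e \<in># M" for e
    proof -
      obtain a b where ab: "a \<in> A" "b \<in> B" "e = {a, b}" using E e M(1) by blast
      have "e \<in> E" using e M(1) by blast
      have nb: "a \<notin> T" "b \<notin> A" using ab assms(3) by (auto simp: T_def)
      show ?thesis
      proof (cases "a \<in> R")
        case True
        then have "b \<in> T" using ab \<open>e \<in> E\<close> by (auto simp: T_def)
        then have "e \<inter> C = {b}" using ab True nb by (auto simp: C_def)
        then show ?thesis by simp
      next
        case False
        then have "b \<notin> T" using closed[of _ b a] ab e by (auto simp: T_def)
        then have "e \<inter> C = {a}" using ab False nb by (auto simp: C_def)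
        then show ?thesis by simp
      qed
    qed
    have "(\<Sum>v\<in>C. Poly_Mapping.lookup t v) \<le> (\<Sum>v\<in>C. mdeg M v)"
    proof (rule sum_mono)
      fix v assume "v \<in> C"
      then show "Poly_Mapping.lookup t v \<le> mdeg M v"
        using RA no_slack by (auto simp: C_def T_def S_def not_less)
    qed
    also have "\<dots> = (\<Sum>e\<in>#M. card (e \<inter> C))" by (rule sum_mdeg[OF fin])
    also have "\<dots> = (\<Sum>e\<in>#M. 1)" using one by (intro arg_cong[of _ _ sum_mset] image_mset_cong) auto
    also have "\<dots> = k" using M(2) by simp
    finally show "(\<Sum>v\<in>C. Poly_Mapping.lookup t v) \<le> k" .
  qed
qed

text \<open>Choose \<open>x\<close> outside the cover \<open>C\<close>. Any product of
  \<open>k + 1\<close> edges has weight at least \<open>k + 1\<close> on \<open>C\<close>, whereas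
  \<open>t\<close> times a power of \<open>x\<close> keeps the weight of \<open>t\<close> there, at
  most \<open>k\<close>.\<close>

lemma bipartite_free_direction:
  fixes t :: "'v \<Rightarrow>\<^sub>0 nat"
  assumes "finite A" "finite B" "A \<inter> B = {}" "B \<noteq> {}"
    and E: "\<And>e. e \<in> E \<Longrightarrow> \<exists>a\<in>A. \<exists>b\<in>B. e = {a, b}"
    and t: "t \<in> edge_power E k" "t \<notin> edge_power E (Suc k)"
  shows "\<exists>x\<in>A \<union> B. \<forall>m. t + Poly_Mapping.single x m \<notin> edge_power E (Suc k)"
proof -
  obtain C where C: "C \<subset> A \<union> B" "\<And>e. e \<in> E \<Longrightarrow> e \<inter> C \<noteq> {}" "(\<Sum>v\<in>C. Poly_Mapping.lookup t v) \<le> k"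
    using koenig_cover[OF assms] by blast
  obtain x where x: "x \<in> A \<union> B" "x \<notin> C" using C(1) by blast
  have fin: "finite C" using C(1) assms(1,2) by (meson finite_Un finite_subset psubset_imp_subset)
  have "t + Poly_Mapping.single x m \<notin> edge_power E (Suc k)" for m
  proof
    assume "t + Poly_Mapping.single x m \<in> edge_power E (Suc k)"
    then obtain M where M: "set_mset M \<subseteq> E" "size M = Suc k"
      "\<And>v. mdeg M v \<le> Poly_Mapping.lookup (t + Poly_Mapping.single x m) v"
      by (auto simp: edge_power_def)
    have "Suc k = (\<Sum>e\<in>#M. 1)" using M(2) by simp
    also have "\<dots> \<le> (\<Sum>e\<in>#M. card (e \<inter> C))"
    proof (rule sum_mset_mono)
      fix e assume "e \<in># M"
      then have "e \<inter> C \<noteq> {}" using C(2) M(1) by blast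
      then show "1 \<le> card (e \<inter> C)" using fin by (simp add: Suc_le_eq card_gt_0_iff)
    qed
    also have "\<dots> = (\<Sum>v\<in>C. mdeg M v)" by (rule sum_mdeg[OF fin, symmetric])
    also have "\<dots> \<le> (\<Sum>v\<in>C. Poly_Mapping.lookup t v)"
    proof (rule sum_mono)
      fix v assume "v \<in> C"
      then show "mdeg M v \<le> Poly_Mapping.lookup t v"
        using M(3)[of v] x(2) by (cases "x = v") (auto simp: lookup_add lookup_single)
    qed
    finally show False using C(3) by simp
  qed
  then show ?thesis using x(1) by blast
qed

lemma edge_powerI:
  "set_mset M \<subseteq> E \<Longrightarrow> size M = k \<Longrightarrow> (\<And>v. mdeg M v \<le> Poly_Mapping.lookup t v) \<Longrightarrow> t \<in> edge_power E k"
  by (auto simp: edge_power_def)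

lemma edge_powerE:
  assumes "t \<in> edge_power E k"
  obtains M where "set_mset M \<subseteq> E" "size M = k" "\<And>v. mdeg M v \<le> Poly_Mapping.lookup t v"
  using assms by (auto simp: edge_power_def)

lemma edge_power_0 [simp]: "t \<in> edge_power E 0"
  by (rule edge_powerI[of "{#}"]) auto

lemma edge_power_empty: "t \<in> edge_power {} k \<longleftrightarrow> k = 0"
  by (auto elim: edge_powerE)

lemma edge_power_mono: "E \<subseteq> F \<Longrightarrow> edge_power E k \<subseteq> edge_power F k"
  by (auto simp: edge_power_def)

lemma edge_power_add:
  assumes "s \<in> edge_power E j" "t \<in> edge_power E k"
  shows "s + t \<in> edge_power E (j + k)"
proof -
  obtain M where M: "set_mset M \<subseteq> E" "size M = j" "\<And>v. mdeg M v \<le> Poly_Mapping.lookup s v"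
    using assms(1) by (auto elim: edge_powerE)
  obtain N where N: "set_mset N \<subseteq> E" "size N = k" "\<And>v. mdeg N v \<le> Poly_Mapping.lookup t v"
    using assms(2) by (auto elim: edge_powerE)
  show ?thesis
    by (rule edge_powerI[of "M + N"]) (use M N in \<open>auto simp: lookup_add intro: add_mono\<close>)
qed

lemma edge_power_Suc_subset: "edge_power E (Suc k) \<subseteq> edge_power E k"
proof
  fix t assume "t \<in> edge_power E (Suc k)"
  then obtain M where M: "set_mset M \<subseteq> E" "size M = Suc k" "\<And>v. mdeg M v \<le> Poly_Mapping.lookup t v"
    by (auto elim: edge_powerE)
  then obtain e N where "M = add_mset e N" by (metis size_eq_Suc_imp_eq_union)
  then show "t \<in> edge_power E k"
    using M by (intro edge_powerI[of N]) (auto intro: order_trans[OF _ M(3)])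
qed

lemma edge_power_antimono: "j \<le> k \<Longrightarrow> edge_power E k \<subseteq> edge_power E j"
  by (rule lift_Suc_antimono_le[of "edge_power E"]) (auto intro: subsetD[OF edge_power_Suc_subset])

lemma upset_edge_power: "upset (edge_power E k)"
  unfolding upset_def using edge_power_add[of _ E k _ 0] by simp

lemma mdeg_le_size: "mdeg M v \<le> size M"
  by (simp add: mdeg_def size_filter_mset_lesseq)

text \<open>A product of \<open>k\<close> edges has exponent at most \<open>k\<close> in each
  variable, so a further factor \<open>x\<close> does not help once \<open>t\<close> has exponent
  \<open>k\<close> in \<open>x\<close>.\<close>

lemma bounded_gens_edge_power:
  assumes "k \<le> N"
  shows "bounded_gens N V (edge_power E k)"
  unfolding bounded_gens_def
proof (intro ballI allI impI)
  fix x t assume *: "N \<le> Poly_Mapping.lookup t x" "t + Poly_Mapping.single x 1 \<in> edge_power E k"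
  then obtain M where M: "set_mset M \<subseteq> E" "size M = k"
    "\<And>v. mdeg M v \<le> Poly_Mapping.lookup (t + Poly_Mapping.single x 1) v"
    by (auto elim: edge_powerE)
  show "t \<in> edge_power E k"
  proof (rule edge_powerI[OF M(1,2)])
    show "mdeg M v \<le> Poly_Mapping.lookup t v" for v
      using M(3)[of v] mdeg_le_size[of M v] M(2) * assms
      by (cases "v = x") (auto simp: lookup_add lookup_single)
  qed
qed

text \<open>The factors of a product of edges split into those from \<open>E1\<close> and the
  others, and each part divides the monomial in its own variables.\<close>

lemma edge_power_Un:
  assumes "V1 \<inter> V2 = {}" "\<forall>e\<in>E1. e \<subseteq> V1 \<and> e \<noteq> {}" "\<forall>e\<in>E2. e \<subseteq> V2 \<and> e \<noteq> {}"
    and "Poly_Mapping.keys s \<subseteq> V1" "Poly_Mapping.keys t \<subseteq> V2" "s + t \<in> edge_power (E1 \<union> E2) k"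
  shows "\<exists>i j. i + j = k \<and> s \<in> edge_power E1 i \<and> t \<in> edge_power E2 j"
proof -
  obtain M where M: "set_mset M \<subseteq> E1 \<union> E2" "size M = k" "\<And>v. mdeg M v \<le> Poly_Mapping.lookup (s + t) v"
    using assms(6) by (auto elim: edge_powerE)
  define M1 where "M1 = filter_mset (\<lambda>e. e \<in> E1) M"
  define M2 where "M2 = filter_mset (\<lambda>e. e \<notin> E1) M"
  have M12: "M = M1 + M2" unfolding M1_def M2_def by (rule multiset_partition)
  have le: "mdeg M1 v \<le> mdeg M v" "mdeg M2 v \<le> mdeg M v" for v by (simp_all add: M12)
  have s0: "Poly_Mapping.lookup s v = 0" if "v \<notin> V1" for v
    using assms(4) that by (auto simp: in_keys_iff)
  have t0: "Poly_Mapping.lookup t v = 0" if "v \<notin> V2" for v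
    using assms(5) that by (auto simp: in_keys_iff)
  have "s \<in> edge_power E1 (size M1)"
  proof (rule edge_powerI)
    show "set_mset M1 \<subseteq> E1" by (auto simp: M1_def)
    show "mdeg M1 v \<le> Poly_Mapping.lookup s v" for v
    proof (cases "v \<in> V1")
      case True
      then have "v \<notin> V2" using assms(1) by blast
      then show ?thesis using le(1)[of v] M(3)[of v] t0[of v] by (simp add: lookup_add)
    next
      case False
      then have "v \<notin> e" if "e \<in># M1" for e using assms(2) that by (auto simp: M1_def)
      then have "mdeg M1 v = 0" by (simp add: mdeg_def)
      then show ?thesis by simp
    qed
  qed simp
  moreover have "t \<in> edge_power E2 (size M2)"
  proof (rule edge_powerI)
    show M2: "set_mset M2 \<subseteq> E2" using M(1) by (auto simp: M2_def)
    show "mdeg M2 v \<le> Poly_Mapping.lookup t v" for v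
    proof (cases "v \<in> V2")
      case True
      then have "v \<notin> V1" using assms(1) by blast
      then show ?thesis using le(2)[of v] M(3)[of v] s0[of v] by (simp add: lookup_add)
    next
      case False
      then have "v \<notin> e" if "e \<in># M2" for e using assms(3) that M2 by auto
      then have "mdeg M2 v = 0" by (simp add: mdeg_def)
      then show ?thesis by simp
    qed
  qed simp
  ultimately show ?thesis using M(2) M12 by (intro exI[of _ "size M1"] exI[of _ "size M2"]) simp
qed

text \<open>The exponents of the monomial basis of \<open>I^k / I^(k+1)\<close>.\<close>

definition edge_level :: "'v set \<Rightarrow> 'v set set \<Rightarrow> nat \<Rightarrow> ('v \<Rightarrow>\<^sub>0 nat) set" where
  "edge_level V E k = {t \<in> edge_power E k - edge_power E (Suc k). Poly_Mapping.keys t \<subseteq> V}"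

text \<open>The level of a monomial is the largest number of edges whose product divides it, and for
  disjoint graphs these numbers add up.\<close>

lemma edge_level_Un:
  assumes "V1 \<inter> V2 = {}" "\<forall>e\<in>E1. e \<subseteq> V1 \<and> e \<noteq> {}" "\<forall>e\<in>E2. e \<subseteq> V2 \<and> e \<noteq> {}"
  shows "edge_level (V1 \<union> V2) (E1 \<union> E2) k =
    (\<Union>i\<in>{..k}. {s + t | s t. s \<in> edge_level V1 E1 i \<and> t \<in> edge_level V2 E2 (k - i)})"
proof (intro Set.set_eqI iffI)
  have add: "s + t \<in> edge_power (E1 \<union> E2) (i + j)" if "s \<in> edge_power E1 i" "t \<in> edge_power E2 j" for s t i j
    using edge_power_add[of s "E1 \<union> E2" i t j] edge_power_mono[of E1 "E1 \<union> E2" i]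
      edge_power_mono[of E2 "E1 \<union> E2" j] that by blast
  {
    fix w assume w: "w \<in> edge_level (V1 \<union> V2) (E1 \<union> E2) k"
    then have "restr V1 w + restr V2 w = w"
      by (intro restr_add_restr assms) (auto simp: edge_level_def)
    define s t where "s = restr V1 w" and "t = restr V2 w"
    have st: "w = s + t" "Poly_Mapping.keys s \<subseteq> V1" "Poly_Mapping.keys t \<subseteq> V2"
      using \<open>restr V1 w + restr V2 w = w\<close> by (auto simp: s_def t_def keys_restr)
    have w': "s + t \<in> edge_power (E1 \<union> E2) k" "s + t \<notin> edge_power (E1 \<union> E2) (Suc k)"
      using w st(1) by (auto simp: edge_level_def)
    obtain i j where ij: "i + j = k" "s \<in> edge_power E1 i" "t \<in> edge_power E2 j"
      using edge_power_Un[OF assms st(2,3) w'(1)] by blast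
    have "s \<notin> edge_power E1 (Suc i)" using add[OF _ ij(3), of s "Suc i"] w'(2) ij(1) by auto
    moreover have "t \<notin> edge_power E2 (Suc j)" using add[OF ij(2), of t "Suc j"] w'(2) ij(1) by auto
    ultimately have "s \<in> edge_level V1 E1 i" "t \<in> edge_level V2 E2 (k - i)" "i \<le> k"
      using ij st by (auto simp: edge_level_def)
    then show "w \<in> (\<Union>i\<in>{..k}. {s + t | s t. s \<in> edge_level V1 E1 i \<and> t \<in> edge_level V2 E2 (k - i)})"
      using st(1) by blast
  }
  fix w assume "w \<in> (\<Union>i\<in>{..k}. {s + t | s t. s \<in> edge_level V1 E1 i \<and> t \<in> edge_level V2 E2 (k - i)})"
  then obtain i s t where i: "i \<le> k" "w = s + t" and s: "s \<in> edge_level V1 E1 i"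
    and t: "t \<in> edge_level V2 E2 (k - i)" by blast
  have "w \<notin> edge_power (E1 \<union> E2) (Suc k)"
  proof
    assume "w \<in> edge_power (E1 \<union> E2) (Suc k)"
    then obtain i' j' where ij: "i' + j' = Suc k" "s \<in> edge_power E1 i'" "t \<in> edge_power E2 j'"
      using edge_power_Un[OF assms, of s t "Suc k"] s t i(2) by (auto simp: edge_level_def)
    then have "Suc i \<le> i' \<or> Suc (k - i) \<le> j'" using i(1) by linarith
    then show False
      using ij(2,3) edge_power_antimono[of "Suc i" i' E1] edge_power_antimono[of "Suc (k - i)" j' E2] s t
      by (auto simp: edge_level_def)
  qed
  moreover have "w \<in> edge_power (E1 \<union> E2) k"
    using add[of s i t "k - i"] s t i by (auto simp: edge_level_def)
  moreover have "Poly_Mapping.keys w \<subseteq> V1 \<union> V2"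
    unfolding i(2) keys_add_nat using s t by (auto simp: edge_level_def)
  ultimately show "w \<in> edge_level (V1 \<union> V2) (E1 \<union> E2) k" by (simp add: edge_level_def)
qed

lemma edge_level_disjoint: "t \<in> edge_level V E i \<Longrightarrow> t \<in> edge_level V E j \<Longrightarrow> i = j"
  using edge_power_antimono[of "Suc i" j E] edge_power_antimono[of "Suc j" i E]
  by (cases i j rule: linorder_cases) (auto simp: edge_level_def)

lemma decomposable_edge_level_Un:
  assumes V: "V1 \<inter> V2 = {}" "finite V1" "finite V2"
    and E: "\<forall>e\<in>E1. e \<subseteq> V1 \<and> e \<noteq> {}" "\<forall>e\<in>E2. e \<subseteq> V2 \<and> e \<noteq> {}"
    and D: "\<And>k. decomposable q1 V1 (edge_level V1 E1 k)" "\<And>k. decomposable q2 V2 (edge_level V2 E2 k)"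
  shows "decomposable (q1 + q2) (V1 \<union> V2) (edge_level (V1 \<union> V2) (E1 \<union> E2) k)"
  unfolding edge_level_Un[OF V(1) E]
proof (rule decomposable_UN)
  show "decomposable (q1 + q2) (V1 \<union> V2)
    {s + t | s t. s \<in> edge_level V1 E1 i \<and> t \<in> edge_level V2 E2 (k - i)}" for i
    by (rule decomposable_prod[OF D V])
  show "disjoint_family_on (\<lambda>i. {s + t | s t. s \<in> edge_level V1 E1 i \<and> t \<in> edge_level V2 E2 (k - i)}) {..k}"
    unfolding disjoint_family_on_def
  proof (intro ballI impI, rule ccontr)
    fix i j assume "i \<noteq> j" and "{s + t | s t. s \<in> edge_level V1 E1 i \<and> t \<in> edge_level V2 E2 (k - i)} \<inter>
      {s + t | s t. s \<in> edge_level V1 E1 j \<and> t \<in> edge_level V2 E2 (k - j)} \<noteq> {}"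
    then obtain s t s' t' where *: "s + t = s' + t'" "s \<in> edge_level V1 E1 i" "s' \<in> edge_level V1 E1 j"
      "t \<in> edge_level V2 E2 (k - i)" "t' \<in> edge_level V2 E2 (k - j)" by blast
    have "s = s' \<and> t = t'"
      by (rule add_eq_disjoint_keys[OF *(1) V(1)]) (use * in \<open>auto simp: edge_level_def\<close>)
    then show False using * edge_level_disjoint \<open>i \<noteq> j\<close> by blast
  qed
qed simp

lemma decomposable_edge_level:
  assumes "finite V" "q \<le> 1"
    and "\<And>t. q = 1 \<Longrightarrow> t \<in> edge_level V E k \<Longrightarrow>
      \<exists>x\<in>V. \<forall>m. t + Poly_Mapping.single x m \<notin> edge_power E (Suc k)"
  shows "decomposable q V (edge_level V E k)"
  unfolding edge_level_def
proof (rule decomposable_upset_diff[where N = "Suc k"])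
  show "bounded_gens (Suc k) V (edge_power E k)" "bounded_gens (Suc k) V (edge_power E (Suc k))"
    by (rule bounded_gens_edge_power; simp)+
qed (use assms upset_edge_power in \<open>auto simp: edge_level_def\<close>)

section \<open>Components and odd walks\<close>

definition matching_mon :: "'v set multiset \<Rightarrow> 'v \<Rightarrow>\<^sub>0 nat" where
  "matching_mon M = (\<Sum>e\<in>#M. \<Sum>v\<in>e. Poly_Mapping.single v 1)"

lemma matching_mon_empty [simp]: "matching_mon {#} = 0"
  and matching_mon_union [simp]: "matching_mon (M + N) = matching_mon M + matching_mon N"
  and matching_mon_add_mset: "matching_mon (add_mset e M) = (\<Sum>v\<in>e. Poly_Mapping.single v 1) + matching_mon M"
  by (simp_all add: matching_mon_def)

lemma lookup_matching_mon:
  assumes "\<forall>e\<in>#M. finite e"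
  shows "Poly_Mapping.lookup (matching_mon M) v = mdeg M v"
  using assms
  by (induction M) (auto simp: matching_mon_add_mset lookup_add lookup_sum lookup_single when_def)

lemma matching_mon_in_edge_power:
  assumes "set_mset M \<subseteq> E" "\<forall>e\<in>E. finite e"
  shows "matching_mon M \<in> edge_power E (size M)"
proof (rule edge_powerI)
  show "mdeg M v \<le> Poly_Mapping.lookup (matching_mon M) v" for v
    using assms by (subst lookup_matching_mon) auto
qed (use assms in auto)

lemma keys_matching_mon:
  assumes "set_mset M \<subseteq> E" "\<forall>e\<in>E. finite e \<and> e \<subseteq> V"
  shows "Poly_Mapping.keys (matching_mon M) \<subseteq> V"
proof
  fix v assume "v \<in> Poly_Mapping.keys (matching_mon M)"
  then have "mdeg M v \<noteq> 0" using assms by (subst (asm) in_keys_iff, subst (asm) lookup_matching_mon) auto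
  then obtain e where "e \<in># M" "v \<in> e" by (auto simp: mdeg_def)
  then show "v \<in> V" using assms by blast
qed

lemma edge_in_edge_power:
  assumes "{x, y} \<in> E"
  shows "Poly_Mapping.single x 1 + Poly_Mapping.single y 1 \<in> edge_power E 1"
  by (rule edge_powerI[of "{#{x, y}#}"]) (use assms in \<open>auto simp: lookup_add lookup_single when_def\<close>)

text \<open>This holds if a walk of odd length joins \<open>x\<close> and \<open>y\<close>: let \<open>M\<close> consist of the edges in even
  position; then the product of the edges in odd position divides the monomial.\<close>

definition linked :: "'v set set \<Rightarrow> 'v \<Rightarrow> 'v \<Rightarrow> bool" where
  "linked E x y \<longleftrightarrow> (\<exists>M. set_mset M \<subseteq> E \<and>
    Poly_Mapping.single x 1 + Poly_Mapping.single y 1 + matching_mon M \<in> edge_power E (Suc (size M)))"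

lemma linked_edge: "{x, y} \<in> E \<Longrightarrow> linked E x y"
  unfolding linked_def using edge_in_edge_power[of x y E] by (intro exI[of _ "{#}"]) simp

text \<open>The walk is prolonged by two edges: \<open>{y, z}\<close> joins those in even position,
  which are multiplied to both ends, and \<open>{z, w}\<close> those in odd position, which
  divide.\<close>

lemma linked_step:
  assumes "linked E x y" "{y, z} \<in> E" "y \<noteq> z" "{z, w} \<in> E"
  shows "linked E x w"
proof -
  obtain M where M: "set_mset M \<subseteq> E"
    "Poly_Mapping.single x 1 + Poly_Mapping.single y 1 + matching_mon M \<in> edge_power E (Suc (size M))"
    using assms(1) by (auto simp: linked_def)
  have "Poly_Mapping.single x 1 + Poly_Mapping.single w 1 + matching_mon (add_mset {y, z} M) =
      (Poly_Mapping.single x 1 + Poly_Mapping.single y 1 + matching_mon M) +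
      (Poly_Mapping.single z 1 + Poly_Mapping.single w 1)"
    using assms(3) by (simp add: matching_mon_add_mset ac_simps)
  also have "\<dots> \<in> edge_power E (Suc (size M) + 1)"
    by (intro edge_power_add M edge_in_edge_power assms)
  finally show ?thesis
    unfolding linked_def using M(1) assms(2) by (intro exI[of _ "add_mset {y, z} M"]) simp
qed

text \<open>Multiply the products belonging to the single pairs: each pair uses its own factor for
  the exchange, and the other factors contribute their number of edges unchanged. Copies of
  \<open>e\<close> then reach every larger \<open>k\<close>. This is where the bound on
  \<open>k\<close> comes from.\<close>

lemma linked_family:
  assumes "finite F" "\<forall>(x, y)\<in>F. linked E x y" "e \<in> E" "\<forall>e\<in>E. finite e"
  shows "\<exists>K. \<forall>k\<ge>K. \<exists>M. set_mset M \<subseteq> E \<and> size M = k \<and>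
    (\<forall>(x, y)\<in>F. Poly_Mapping.single x 1 + Poly_Mapping.single y 1 + matching_mon M \<in> edge_power E (Suc k))"
proof -
  have "\<exists>M. set_mset M \<subseteq> E \<and>
    (\<forall>(x, y)\<in>F. Poly_Mapping.single x 1 + Poly_Mapping.single y 1 + matching_mon M \<in> edge_power E (Suc (size M)))"
    using assms(1,2)
  proof (induction F rule: finite_induct)
    case empty
    then show ?case by (intro exI[of _ "{#}"]) simp
  next
    case (insert p F)
    obtain x y where p: "p = (x, y)" by (cases p)
    obtain M where M: "set_mset M \<subseteq> E"
      "\<forall>(x, y)\<in>F. Poly_Mapping.single x 1 + Poly_Mapping.single y 1 + matching_mon M \<in> edge_power E (Suc (size M))"
      using insert by auto
    obtain N where N: "set_mset N \<subseteq> E"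
      "Poly_Mapping.single x 1 + Poly_Mapping.single y 1 + matching_mon N \<in> edge_power E (Suc (size N))"
      using insert.prems p by (auto simp: linked_def)
    have "Poly_Mapping.single x' 1 + Poly_Mapping.single y' 1 + matching_mon (M + N) \<in> edge_power E (Suc (size (M + N)))"
      if "(x', y') \<in> insert p F" for x' y'
    proof (cases "(x', y') = p")
      case True
      then show ?thesis
        using edge_power_add[OF N(2) matching_mon_in_edge_power[OF M(1) assms(4)]] p
        by (simp add: ac_simps)
    next
      case False
      then have "Poly_Mapping.single x' 1 + Poly_Mapping.single y' 1 + matching_mon M \<in> edge_power E (Suc (size M))"
        using M(2) that by blast
      from edge_power_add[OF this matching_mon_in_edge_power[OF N(1) assms(4)]]
      show ?thesis by (simp add: ac_simps)
    qed
    then show ?case using M(1) N(1) by (intro exI[of _ "M + N"]) auto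
  qed
  then obtain M where M: "set_mset M \<subseteq> E"
    "\<forall>(x, y)\<in>F. Poly_Mapping.single x 1 + Poly_Mapping.single y 1 + matching_mon M \<in> edge_power E (Suc (size M))"
    by blast
  show ?thesis
  proof (intro exI[of _ "size M"] allI impI)
    fix k assume k: "size M \<le> k"
    let ?N = "replicate_mset (k - size M) e"
    have N: "set_mset ?N \<subseteq> E" using assms(3) by (auto simp: in_replicate_mset)
    have "Poly_Mapping.single x 1 + Poly_Mapping.single y 1 + matching_mon (M + ?N) \<in> edge_power E (Suc k)"
      if "(x, y) \<in> F" for x y
    proof -
      have "Poly_Mapping.single x 1 + Poly_Mapping.single y 1 + matching_mon M \<in> edge_power E (Suc (size M))"
        using M(2) that by blast
      from edge_power_add[OF this matching_mon_in_edge_power[OF N assms(4)]]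
      show ?thesis using k by (simp add: ac_simps)
    qed
    then show "\<exists>M. set_mset M \<subseteq> E \<and> size M = k \<and>
      (\<forall>(x, y)\<in>F. Poly_Mapping.single x 1 + Poly_Mapping.single y 1 + matching_mon M \<in> edge_power E (Suc k))"
      using M(1) N k by (intro exI[of _ "M + ?N"]) auto
  qed
qed

text \<open>The obstruction to divisibility by \<open>k\<close> edges. It is used with
  \<open>c = 1\<close> for one side of a bipartite component and with \<open>c = 2\<close> for all
  vertices of a nonbipartite one.\<close>

lemma edge_power_weight_le:
  assumes "finite C" "\<forall>e\<in>E. card (e \<inter> C) = c" "t \<in> edge_power E k"
  shows "c * k \<le> (\<Sum>v\<in>C. Poly_Mapping.lookup t v)"
proof -
  obtain M where M: "set_mset M \<subseteq> E" "size M = k" "\<And>v. mdeg M v \<le> Poly_Mapping.lookup t v"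
    using assms(3) by (auto elim: edge_powerE)
  have "c * k = (\<Sum>e\<in>#M. c)" using M(2) by simp
  also have "\<dots> = (\<Sum>e\<in>#M. card (e \<inter> C))"
    using assms(2) M(1) by (intro arg_cong[of _ _ sum_mset] image_mset_cong) auto
  also have "\<dots> = (\<Sum>v\<in>C. mdeg M v)" by (rule sum_mdeg[OF assms(1), symmetric])
  also have "\<dots> \<le> (\<Sum>v\<in>C. Poly_Mapping.lookup t v)" using M(3) by (intro sum_mono)
  finally show ?thesis .
qed

lemma weight_matching_mon:
  assumes "finite C" "\<forall>e\<in>E. card (e \<inter> C) = c" "set_mset M \<subseteq> E" "\<forall>e\<in>E. finite e"
  shows "(\<Sum>v\<in>C. Poly_Mapping.lookup (matching_mon M) v) = c * size M"
proof -
  have "(\<Sum>v\<in>C. Poly_Mapping.lookup (matching_mon M) v) = (\<Sum>v\<in>C. mdeg M v)"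
    using assms by (intro sum.cong refl lookup_matching_mon) auto
  also have "\<dots> = (\<Sum>e\<in>#M. card (e \<inter> C))" by (rule sum_mdeg[OF assms(1)])
  also have "\<dots> = (\<Sum>e\<in>#M. c)"
    using assms(2,3) by (intro arg_cong[of _ _ sum_mset] image_mset_cong) auto
  finally show ?thesis by simp
qed

section \<open>Witnesses for the bound on the depth\<close>

text \<open>The exponents, relative to \<open>u\<close>, at which the functional
  \<open>component_cycle\<close> reads coefficients.\<close>

fun choices :: "('v set \<times> 'v set \<times> 'v \<times> 'v) list \<Rightarrow> ('v \<Rightarrow>\<^sub>0 nat) set" where
  "choices [] = {0}"
| "choices ((A, B, a, b) # cs) = (if B = {} then choices cs else
    (\<lambda>s. Poly_Mapping.single a 1 + s) ` choices cs \<union> (\<lambda>s. Poly_Mapping.single b 1 + s) ` choices cs)"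

text \<open>An entry \<open>(A, B, a, b)\<close> stands for a bipartite component with the parts \<open>A\<close> and \<open>B\<close>, and
  \<open>a \<in> A\<close>, \<open>b \<in> B\<close>. An isolated vertex \<open>a\<close> is encoded by \<open>A = {a}\<close>, \<open>B = {}\<close> and an arbitrary \<open>b\<close>.
  For the ideal \<open>I\<close> of the graph, a witness \<open>u \<in> I\<^sup>k\<close> has the property that \<open>I\<^sup>k\<^sup>+\<^sup>1 : u\<close> contains the
  variables of all other components and the products \<open>x\<^sub>i x\<^sub>j\<close> with \<open>i \<in> A\<close>, \<open>j \<in> B\<close>, but no product
  of variables, one of \<open>x\<^sub>a\<close> and \<open>x\<^sub>b\<close> for each entry with \<open>B \<noteq> {}\<close>.\<close>

definition witness_entry :: "'v set \<Rightarrow> 'v set set \<Rightarrow> nat \<Rightarrow> ('v \<Rightarrow>\<^sub>0 nat) \<Rightarrow>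
    'v set \<times> 'v set \<times> 'v \<times> 'v \<Rightarrow> bool" where
  "witness_entry V E k u = (\<lambda>(A, B, a, b). A \<union> B \<subseteq> V \<and> A \<inter> B = {} \<and> a \<in> A \<and>
      (if B = {} then A = {a} \<and> Poly_Mapping.lookup u a = 0
       else b \<in> B \<and> (\<forall>x\<in>A. \<forall>y\<in>B.
         Poly_Mapping.single x 1 + Poly_Mapping.single y 1 + u \<in> edge_power E (Suc k))))"

definition component_vertices :: "'v set \<times> 'v set \<times> 'v \<times> 'v \<Rightarrow> 'v set" where
  "component_vertices = (\<lambda>(A, B, a, b). A \<union> B)"

text \<open>The colon conditions make the associated Koszul cochain a cocycle modulo
  \<open>I^(k+1)\<close>; the last condition keeps it from being a coboundary.\<close>

definition witness :: "'v set \<Rightarrow> 'v set set \<Rightarrow> nat \<Rightarrow> ('v set \<times> 'v set \<times> 'v \<times> 'v) list \<Rightarrow>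
    ('v \<Rightarrow>\<^sub>0 nat) \<Rightarrow> bool" where
  "witness V E k cs u \<longleftrightarrow> Poly_Mapping.keys u \<subseteq> V \<and> u \<in> edge_power E k \<and>
    (\<forall>c\<in>set cs. witness_entry V E k u c) \<and>
    sorted_wrt (\<lambda>c c'. component_vertices c \<inter> component_vertices c' = {}) cs \<and>
    (\<forall>v\<in>V. (\<forall>c\<in>set cs. v \<notin> component_vertices c) \<longrightarrow>
      Poly_Mapping.single v 1 + u \<in> edge_power E (Suc k)) \<and>
    (\<forall>s\<in>choices cs. u + s \<notin> edge_power E (Suc k))"

lemma component_vertices_subset: "witness_entry V E k u c \<Longrightarrow> component_vertices c \<subseteq> V"
  by (auto simp: witness_entry_def component_vertices_def split: prod.splits)

lemma choices_appendD:
  assumes "w \<in> choices (cs @ ds)"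
  shows "\<exists>s\<in>choices cs. \<exists>t\<in>choices ds. w = s + t"
  using assms
proof (induction cs arbitrary: w)
  case (Cons c cs)
  obtain A B a b where c: "c = (A, B, a, b)" by (metis surj_pair)
  show ?case
  proof (cases "B = {}")
    case True
    then show ?thesis using Cons by (simp add: c)
  next
    case False
    then obtain x w' where x: "x = a \<or> x = b" and w: "w' \<in> choices (cs @ ds)"
      "w = Poly_Mapping.single x 1 + w'"
      using Cons.prems by (auto simp: c)
    obtain s t where "s \<in> choices cs" "t \<in> choices ds" "w' = s + t" using Cons.IH[OF w(1)] by blast
    moreover from this(1) have "Poly_Mapping.single x 1 + s \<in> choices (c # cs)"
      using x False by (auto simp: c)
    ultimately show ?thesis using w(2)
      by (intro bexI[of _ "Poly_Mapping.single x 1 + s"] bexI[of _ t]) (simp_all add: add.assoc)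
  qed
qed simp

lemma keys_choices:
  assumes "\<forall>c\<in>set cs. witness_entry V E k u c" "s \<in> choices cs"
  shows "Poly_Mapping.keys s \<subseteq> V"
  using assms
proof (induction cs arbitrary: s)
  case (Cons c cs)
  obtain A B a b where c: "c = (A, B, a, b)" by (metis surj_pair)
  have IH: "Poly_Mapping.keys s \<subseteq> V" if "s \<in> choices cs" for s
    using Cons.IH Cons.prems(1) that by simp
  show ?case
    using Cons.prems unfolding c by (auto simp: keys_add_nat witness_entry_def split: if_splits dest!: IH)
qed simp

lemma edge_power_Un_add:
  assumes "s \<in> edge_power E1 i" "t \<in> edge_power E2 j"
  shows "s + t \<in> edge_power (E1 \<union> E2) (i + j)"
  using edge_power_add[of s "E1 \<union> E2" i t j] edge_power_mono[of E1 "E1 \<union> E2" i]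
    edge_power_mono[of E2 "E1 \<union> E2" j] assms by blast

lemma witness_entry_lift:
  assumes "witness_entry V1 E1 k1 u1 c" "u2 \<in> edge_power E2 k2" "Poly_Mapping.keys u2 \<inter> V1 = {}"
  shows "witness_entry (V1 \<union> V2) (E1 \<union> E2) (k1 + k2) (u1 + u2) c"
proof -
  obtain A B a b where c: "c = (A, B, a, b)" by (metis surj_pair)
  have ep: "x + (u1 + u2) \<in> edge_power (E1 \<union> E2) (Suc (k1 + k2))" if "x + u1 \<in> edge_power E1 (Suc k1)" for x
    using edge_power_Un_add[OF that assms(2)] by (simp add: add.assoc)
  have "Poly_Mapping.lookup u2 a = 0" if "a \<in> V1" using assms(3) that by (auto simp: in_keys_iff)
  then show ?thesis
    using assms(1) ep unfolding witness_entry_def c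
    by (auto simp: lookup_add split: if_splits)
qed

text \<open>The colon conditions survive multiplication by the other factor. For the last condition:
  \<open>k1 + k2 + 1\<close> edges of the disjoint union are more than \<open>k1\<close> in the
  first or more than \<open>k2\<close> in the second graph.\<close>

lemma witness_append:
  assumes V: "V1 \<inter> V2 = {}"
    and E: "\<forall>e\<in>E1. e \<subseteq> V1 \<and> e \<noteq> {}" "\<forall>e\<in>E2. e \<subseteq> V2 \<and> e \<noteq> {}"
    and w1: "witness V1 E1 k1 cs1 u1" and w2: "witness V2 E2 k2 cs2 u2"
  shows "witness (V1 \<union> V2) (E1 \<union> E2) (k1 + k2) (cs1 @ cs2) (u1 + u2)"
proof -
  note w1 = w1[unfolded witness_def] and w2 = w2[unfolded witness_def]
  have keys: "Poly_Mapping.keys u2 \<inter> V1 = {}" "Poly_Mapping.keys u1 \<inter> V2 = {}" using w1 w2 V by blast+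
  have entries: "witness_entry (V1 \<union> V2) (E1 \<union> E2) (k1 + k2) (u1 + u2) c" if "c \<in> set (cs1 @ cs2)" for c
    using that witness_entry_lift[of V1 E1 k1 u1 c u2 E2 k2 V2] witness_entry_lift[of V2 E2 k2 u2 c u1 E1 k1 V1]
      w1 w2 keys by (auto simp: Un_commute add.commute)
  have "sorted_wrt (\<lambda>c c'. component_vertices c \<inter> component_vertices c' = {}) (cs1 @ cs2)"
  proof -
    have "component_vertices c \<inter> component_vertices c' = {}" if "c \<in> set cs1" "c' \<in> set cs2" for c c'
    proof -
      have "component_vertices c \<subseteq> V1" "component_vertices c' \<subseteq> V2"
        using component_vertices_subset that w1 w2 by blast+
      then show ?thesis using V by blast
    qed
    then show ?thesis unfolding sorted_wrt_append using w1 w2 by simp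
  qed
  moreover have "Poly_Mapping.single v 1 + (u1 + u2) \<in> edge_power (E1 \<union> E2) (Suc (k1 + k2))"
    if v: "v \<in> V1 \<union> V2" "\<forall>c\<in>set (cs1 @ cs2). v \<notin> component_vertices c" for v
  proof (cases "v \<in> V1")
    case True
    then have "Poly_Mapping.single v 1 + u1 \<in> edge_power E1 (Suc k1)" using w1 v by auto
    from edge_power_Un_add[OF this, of u2 E2 k2] w2 show ?thesis by (simp add: add.assoc)
  next
    case False
    then have "Poly_Mapping.single v 1 + u2 \<in> edge_power E2 (Suc k2)" using w2 v by auto
    from edge_power_Un_add[OF _ this, of u1 E1 k1] w1 show ?thesis by (simp add: ac_simps)
  qed
  moreover have "u1 + u2 + s \<notin> edge_power (E1 \<union> E2) (Suc (k1 + k2))" if s: "s \<in> choices (cs1 @ cs2)" for s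
  proof
    assume *: "u1 + u2 + s \<in> edge_power (E1 \<union> E2) (Suc (k1 + k2))"
    obtain s1 s2 where s12: "s1 \<in> choices cs1" "s2 \<in> choices cs2" "s = s1 + s2"
      using choices_appendD[OF s] by blast
    have k1: "Poly_Mapping.keys (u1 + s1) \<subseteq> V1"
      unfolding keys_add_nat using w1 keys_choices[of cs1 V1 E1 k1 u1 s1] s12(1) by blast
    have k2: "Poly_Mapping.keys (u2 + s2) \<subseteq> V2"
      unfolding keys_add_nat using w2 keys_choices[of cs2 V2 E2 k2 u2 s2] s12(2) by blast
    obtain i j where ij: "i + j = Suc (k1 + k2)" "u1 + s1 \<in> edge_power E1 i" "u2 + s2 \<in> edge_power E2 j"
      using edge_power_Un[OF V E k1 k2, of "Suc (k1 + k2)"] * s12(3) by (auto simp: ac_simps)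
    then have "Suc k1 \<le> i \<or> Suc k2 \<le> j" by linarith
    then show False
      using ij(2,3) edge_power_antimono[of "Suc k1" i E1] edge_power_antimono[of "Suc k2" j E2] w1 w2 s12
      by blast
  qed
  moreover have "Poly_Mapping.keys (u1 + u2) \<subseteq> V1 \<union> V2" unfolding keys_add_nat using w1 w2 by blast
  moreover have "u1 + u2 \<in> edge_power (E1 \<union> E2) (k1 + k2)" by (rule edge_power_Un_add) (use w1 w2 in auto)
  ultimately show ?thesis unfolding witness_def using entries by blast
qed

section \<open>Both bounds for components and for whole graphs\<close>

text \<open>A graph without edges has witnesses for \<open>k = 0\<close> only. Asking for a single
  exponent \<open>K\<close> in general, and for all larger ones if there is an edge, gives a
  property that passes to disjoint unions with isolated vertices.\<close>

definition good :: "nat \<Rightarrow> 'v set \<Rightarrow> 'v set set \<Rightarrow> bool" where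
  "good p V E \<longleftrightarrow> (\<forall>k. decomposable p V (edge_level V E k)) \<and>
    (\<exists>K. (\<exists>cs u. length cs = p \<and> witness V E K cs u) \<and>
      (E \<noteq> {} \<longrightarrow> (\<forall>k\<ge>K. \<exists>cs u. length cs = p \<and> witness V E k cs u)))"

lemma goodI:
  assumes "\<And>k. decomposable p V (edge_level V E k)"
    "\<And>k. K \<le> k \<Longrightarrow> \<exists>cs u. length cs = p \<and> witness V E k cs u"
  shows "good p V E"
  unfolding good_def using assms by blast

lemma good_Un:
  assumes "V1 \<inter> V2 = {}" "finite V1" "finite V2"
    and "\<forall>e\<in>E1. e \<subseteq> V1 \<and> e \<noteq> {}" "\<forall>e\<in>E2. e \<subseteq> V2 \<and> e \<noteq> {}"
    and "good p1 V1 E1" "good p2 V2 E2"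
  shows "good (p1 + p2) (V1 \<union> V2) (E1 \<union> E2)"
proof -
  let ?W = "\<lambda>p V E k. \<exists>cs u. length cs = p \<and> witness V E k cs u"
  have app: "?W (p1 + p2) (V1 \<union> V2) (E1 \<union> E2) (k1 + k2)" if "?W p1 V1 E1 k1" "?W p2 V2 E2 k2" for k1 k2
    using that witness_append[OF assms(1,4,5)] by (metis length_append)
  obtain K1 where K1: "?W p1 V1 E1 K1" "E1 \<noteq> {} \<Longrightarrow> k \<ge> K1 \<Longrightarrow> ?W p1 V1 E1 k" for k
    using assms(6) unfolding good_def by blast
  obtain K2 where K2: "?W p2 V2 E2 K2" "E2 \<noteq> {} \<Longrightarrow> k \<ge> K2 \<Longrightarrow> ?W p2 V2 E2 k" for k
    using assms(7) unfolding good_def by blast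
  \<comment> \<open>A factor that has an edge absorbs the surplus of \<open>k\<close>; the other
    factor stays at its threshold.\<close>
  have "?W (p1 + p2) (V1 \<union> V2) (E1 \<union> E2) k" if "E1 \<union> E2 \<noteq> {}" "k \<ge> K1 + K2" for k
  proof (cases "E1 = {}")
    case True
    then have "?W p2 V2 E2 (k - K1)" using that by (intro K2(2)) auto
    from app[OF K1(1) this] show ?thesis using that(2) by simp
  next
    case False
    then have "?W p1 V1 E1 (k - K2)" using that by (intro K1(2)) auto
    from app[OF this K2(1)] show ?thesis using that(2) by simp
  qed
  moreover have "decomposable (p1 + p2) (V1 \<union> V2) (edge_level (V1 \<union> V2) (E1 \<union> E2) k)" for k
    by (rule decomposable_edge_level_Un[OF assms(1-5)]) (use assms(6,7) in \<open>auto simp: good_def\<close>)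
  ultimately show ?thesis unfolding good_def using app[OF K1(1) K2(1)] by blast
qed

lemma good_empty: "good 0 {} {}"
  unfolding good_def
proof (intro conjI allI exI[of _ 0])
  show "decomposable 0 {} (edge_level {} {} k)" for k by (rule decomposable_edge_level) auto
  show "\<exists>cs u. length cs = 0 \<and> witness {} {} 0 cs u"
    by (intro exI[of _ "[]"] exI[of _ 0]) (auto simp: witness_def edge_power_empty)
qed simp

text \<open>All powers of the variable form one Stanley space of dimension 1. The witness is the
  monomial 1, whose exponent vector is 0.\<close>

lemma good_isolated: "good 1 {v} {}"
  unfolding good_def
proof (intro conjI allI exI[of _ 0])
  show "decomposable 1 {v} (edge_level {v} {} k)" for k
    by (rule decomposable_edge_level) (auto simp: edge_power_empty)
  show "\<exists>cs u. length cs = 1 \<and> witness {v} {} 0 cs u"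
    by (intro exI[of _ "[({v}, {}, v, v)]"] exI[of _ 0])
      (auto simp: witness_def witness_entry_def component_vertices_def edge_power_empty)
qed simp

lemma good_bipartite:
  assumes "finite A" "finite B" "A \<inter> B = {}" "A \<noteq> {}" "B \<noteq> {}"
    and E: "\<forall>e\<in>E. \<exists>a\<in>A. \<exists>b\<in>B. e = {a, b}" "E \<noteq> {}"
    and linked: "\<forall>x\<in>A. \<forall>y\<in>B. linked E x y"
  shows "good 1 (A \<union> B) E"
proof -
  obtain a b where ab: "a \<in> A" "b \<in> B" using assms by blast
  obtain e where e: "e \<in> E" using E by blast
  have fin: "\<forall>e\<in>E. finite e" using E(1) by fastforce
  have sides: "card (e \<inter> A) = 1" "card (e \<inter> B) = 1" "e \<subseteq> A \<union> B" if e: "e \<in> E" for e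
  proof -
    obtain x y where "x \<in> A" "y \<in> B" "e = {x, y}" using bspec[OF E(1) e] by (elim bexE)
    then have "e \<inter> A = {x}" "e \<inter> B = {y}" "e \<subseteq> A \<union> B" using assms(3) by auto
    then show "card (e \<inter> A) = 1" "card (e \<inter> B) = 1" "e \<subseteq> A \<union> B" by simp_all
  qed
  obtain K where K: "\<And>k. k \<ge> K \<Longrightarrow> \<exists>M. set_mset M \<subseteq> E \<and> size M = k \<and> (\<forall>(x, y)\<in>A \<times> B.
      Poly_Mapping.single x 1 + Poly_Mapping.single y 1 + matching_mon M \<in> edge_power E (Suc k))"
  proof -
    have "finite (A \<times> B)" "\<forall>(x, y)\<in>A \<times> B. linked E x y" using assms(1,2) linked by auto
    from linked_family[OF this e fin] show ?thesis using that by blast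
  qed
  show ?thesis
  proof (rule goodI)
    show "decomposable 1 (A \<union> B) (edge_level (A \<union> B) E k)" for k
    proof (rule decomposable_edge_level)
      show "\<exists>x\<in>A \<union> B. \<forall>m. t + Poly_Mapping.single x m \<notin> edge_power E (Suc k)"
        if "t \<in> edge_level (A \<union> B) E k" for t
        by (rule bipartite_free_direction)
          (use assms that in \<open>auto simp: edge_level_def\<close>)
    qed (use assms in auto)
    fix k assume "k \<ge> K"
    then obtain M where M: "set_mset M \<subseteq> E" "size M = k" "\<forall>(x, y)\<in>A \<times> B.
      Poly_Mapping.single x 1 + Poly_Mapping.single y 1 + matching_mon M \<in> edge_power E (Suc k)"
      using K by blast
    \<comment> \<open>Every edge meets the side \<open>C\<close> once, so \<open>k + 1\<close> edges
      have weight \<open>k + 1\<close> on \<open>C\<close>, while a vertex of the other side leaves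
      the weight of \<open>u\<close> at \<open>k\<close>. It is applied to \<open>a\<close> with
      \<open>C = B\<close> and to \<open>b\<close> with \<open>C = A\<close>.\<close>
    have notin: "matching_mon M + Poly_Mapping.single x 1 \<notin> edge_power E (Suc k)"
      if C: "finite C" "\<forall>e\<in>E. card (e \<inter> C) = 1" "x \<notin> C" for C x
    proof
      assume "matching_mon M + Poly_Mapping.single x 1 \<in> edge_power E (Suc k)"
      from edge_power_weight_le[OF C(1,2) this]
      have "Suc k \<le> (\<Sum>v\<in>C. Poly_Mapping.lookup (matching_mon M + Poly_Mapping.single x 1) v)" by simp
      also have "\<dots> = (\<Sum>v\<in>C. Poly_Mapping.lookup (matching_mon M) v)"
        using C(3) by (intro sum.cong) (auto simp: lookup_add lookup_single when_def)
      also have "\<dots> = k" using weight_matching_mon[OF C(1,2) M(1) fin] M(2) by simp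
      finally show False by simp
    qed
    have "witness (A \<union> B) E k [(A, B, a, b)] (matching_mon M)"
      unfolding witness_def
    proof (intro conjI ballI impI)
      show "Poly_Mapping.keys (matching_mon M) \<subseteq> A \<union> B"
        by (rule keys_matching_mon[OF M(1)]) (use fin sides in auto)
      show "matching_mon M \<in> edge_power E k"
        using matching_mon_in_edge_power[OF M(1) fin] M(2) by simp
      show "witness_entry (A \<union> B) E k (matching_mon M) c" if "c \<in> set [(A, B, a, b)]" for c
        using that M(3) ab assms(3,5) by (auto simp: witness_entry_def)
      show "matching_mon M + s \<notin> edge_power E (Suc k)" if "s \<in> choices [(A, B, a, b)]" for s
        using that notin[of B a] notin[of A b] ab assms(1-3,5) sides by auto
    qed (auto simp: component_vertices_def)
    then show "\<exists>cs u. length cs = 1 \<and> witness (A \<union> B) E k cs u"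
      by (intro exI[of _ "[(A, B, a, b)]"] exI[of _ "matching_mon M"]) simp
  qed
qed

lemma good_nonbipartite:
  assumes "finite V" and E: "\<forall>e\<in>E. e \<subseteq> V \<and> card e = 2" "E \<noteq> {}"
    and linked: "\<forall>x\<in>V. \<forall>y\<in>V. linked E x y"
  shows "good 0 V E"
proof -
  obtain e where e: "e \<in> E" using E by blast
  then obtain a where a: "a \<in> V" using E(1) by fastforce
  have fin: "\<forall>e\<in>E. finite e" using E(1) assms(1) finite_subset by blast
  have sides: "\<forall>e\<in>E. card (e \<inter> V) = 2" using E(1) by (auto simp: Int_absorb2)
  obtain K where K: "\<And>k. k \<ge> K \<Longrightarrow> \<exists>M. set_mset M \<subseteq> E \<and> size M = k \<and> (\<forall>(x, y)\<in>V \<times> V.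
      Poly_Mapping.single x 1 + Poly_Mapping.single y 1 + matching_mon M \<in> edge_power E (Suc k))"
  proof -
    have "finite (V \<times> V)" "\<forall>(x, y)\<in>V \<times> V. linked E x y" using assms(1,2) linked by auto
    from linked_family[OF this e fin] show ?thesis using that by blast
  qed
  show ?thesis
  proof (rule goodI)
    show "decomposable 0 V (edge_level V E k)" for k
      by (rule decomposable_edge_level) (use assms(1) in auto)
    fix k assume "k \<ge> K"
    then obtain M where M: "set_mset M \<subseteq> E" "size M = k" "\<forall>(x, y)\<in>V \<times> V.
      Poly_Mapping.single x 1 + Poly_Mapping.single y 1 + matching_mon M \<in> edge_power E (Suc k)"
      using K by blast
    \<comment> \<open>The degree \<open>2 * k + 1\<close> is one short of that of
      \<open>k + 1\<close> edges. With the factor \<open>a\<close> present, any further vertex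
      \<open>v\<close> completes an exchange, since \<open>v\<close> and \<open>a\<close> are
      linked.\<close>
    let ?u = "matching_mon M + Poly_Mapping.single a 1"
    have "?u \<notin> edge_power E (Suc k)"
    proof
      assume "?u \<in> edge_power E (Suc k)"
      from edge_power_weight_le[OF assms(1) sides this]
      have "2 * Suc k \<le> (\<Sum>v\<in>V. Poly_Mapping.lookup ?u v)" .
      also have "\<dots> = (\<Sum>v\<in>V. Poly_Mapping.lookup (matching_mon M) v) +
          (\<Sum>v\<in>V. Poly_Mapping.lookup (Poly_Mapping.single a 1) v)"
        by (simp add: lookup_add sum.distrib)
      also have "(\<Sum>v\<in>V. Poly_Mapping.lookup (Poly_Mapping.single a (1::nat)) v) = 1"
        using a assms(1) by (simp add: lookup_single when_def)
      also have "(\<Sum>v\<in>V. Poly_Mapping.lookup (matching_mon M) v) = 2 * k"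
        using weight_matching_mon[OF assms(1) sides M(1) fin] M(2) by simp
      finally show False by simp
    qed
    moreover have "Poly_Mapping.keys ?u \<subseteq> V"
      unfolding keys_add_nat using keys_matching_mon[OF M(1), of V] fin E(1) a by auto
    moreover have "?u \<in> edge_power E k"
      using matching_mon_in_edge_power[OF M(1) fin] M(2) upset_edge_power[of E k] by (auto simp: upset_def)
    moreover have "Poly_Mapping.single v 1 + ?u \<in> edge_power E (Suc k)" if "v \<in> V" for v
      using M(3) a that by (auto simp: ac_simps)
    ultimately have "witness V E k [] ?u" by (simp add: witness_def)
    then show "\<exists>cs u. length cs = 0 \<and> witness V E k cs u"
      by (intro exI[of _ "[]"] exI[of _ ?u]) simp
  qed
qed

text \<open>The Boolean argument is \<open>True\<close> for walks of even length.\<close>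

inductive walk :: "'v set set \<Rightarrow> bool \<Rightarrow> 'v \<Rightarrow> 'v \<Rightarrow> bool" for E where
  walk_refl: "walk E True v v"
| walk_step: "walk E p v w \<Longrightarrow> {w, x} \<in> E \<Longrightarrow> walk E (\<not> p) v x"

text \<open>The sum of two lengths is even iff their parities agree, hence the equation
  \<open>p = q\<close>.\<close>

lemma walk_trans:
  assumes "walk E q w x" "walk E p v w"
  shows "walk E (p = q) v x"
  using assms
proof (induction rule: walk.induct)
  case (walk_step q w x y)
  have "walk E (\<not> (p = q)) v y"
    by (rule walk.walk_step[OF walk_step.IH]) (use walk_step in auto)
  moreover have "(\<not> (p = q)) = (p = (\<not> q))" by blast
  ultimately show ?case by simp
qed simp

lemma walk_sym: "walk E p v w \<Longrightarrow> walk E p w v"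
proof (induction rule: walk.induct)
  case (walk_step p v w x)
  have "walk E (\<not> True) x w" by (rule walk.walk_step[OF walk_refl]) (use walk_step.hyps(2) in \<open>simp add: insert_commute\<close>)
  from walk_trans[OF walk_step.IH this] show ?case by simp
qed (rule walk_refl)

text \<open>\<open>linked\<close> speaks of odd walks and grows by two edges at a time; the clause
  for even walks remembers the last edge until the next one arrives.\<close>

lemma linked_of_walk:
  assumes "walk E p v w" "\<forall>e\<in>E. card e = 2"
  shows "if p then w = v \<or> (\<exists>y. linked E v y \<and> {y, w} \<in> E) else linked E v w"
  using assms
proof (induction rule: walk.induct)
  case (walk_step p v w x)
  show ?case
  proof (cases p)
    case False
    then show ?thesis using walk_step by auto
  next
    case True
    then consider "w = v" | y where "linked E v y" "{y, w} \<in> E" using walk_step by auto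
    then have "linked E v x"
    proof cases
      case 1
      then show ?thesis using linked_edge walk_step.hyps(2) by metis
    next
      case 2
      then have "y \<noteq> w" using walk_step.prems by fastforce
      from linked_step[OF 2 this walk_step.hyps(2)] show ?thesis .
    qed
    then show ?thesis using True by simp
  qed
qed simp

text \<open>Sort the vertices by the parity of walks from \<open>v\<close>. If the classes are
  disjoint, they are the two sides of a bipartite graph. Otherwise there is a closed odd walk at
  \<open>v\<close>, and it corrects the parity of any walk through \<open>v\<close>.\<close>

lemma good_connected:
  assumes "simple_graph C E" "v \<in> C" "\<And>w. w \<in> C \<Longrightarrow> \<exists>p. walk E p v w"
  shows "\<exists>p. good p C E"
proof (cases "E = {}")
  case True
  have "w = v" if "w \<in> C" for w
    using assms(3)[OF that] by (auto simp: True elim: walk.cases)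
  then have "C = {v}" using assms(2) by blast
  then show ?thesis using good_isolated[of v] True by auto
next
  case False
  have fin: "finite C" and E: "\<forall>e\<in>E. e \<subseteq> C \<and> card e = 2"
    using assms(1) by (auto simp: simple_graph_def)
  have linked: "linked E x y" if "walk E False x y" for x y
    using linked_of_walk[OF that] E by simp
  define A where "A = {w \<in> C. walk E True v w}"
  define B where "B = {w \<in> C. walk E False v w}"
  have C: "C = A \<union> B"
  proof -
    have "w \<in> A \<union> B" if "w \<in> C" for w
    proof -
      obtain p where "walk E p v w" using assms(3)[OF \<open>w \<in> C\<close>] by blast
      then show ?thesis using that by (cases p) (auto simp: A_def B_def)
    qed
    then show ?thesis by (auto simp: A_def B_def)
  qed
  show ?thesis
  proof (cases "A \<inter> B = {}")
    case True
    have edges: "\<exists>a\<in>A. \<exists>b\<in>B. e = {a, b}" if e: "e \<in> E" for e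
    proof -
      have "card e = 2" "e \<subseteq> C" using E e by auto
      then obtain x y where xy: "e = {x, y}" by (meson card_2_iff)
      then have "x \<in> C" "y \<in> C" using \<open>e \<subseteq> C\<close> by auto
      then obtain p where p: "walk E p v x" using assms(3) by blast
      have "walk E (\<not> p) v y" by (rule walk_step[OF p]) (use e xy in simp)
      then show ?thesis
        using p \<open>x \<in> C\<close> \<open>y \<in> C\<close> xy by (cases p) (auto simp: A_def B_def insert_commute)
    qed
    have "good 1 (A \<union> B) E"
    proof (rule good_bipartite)
      show "finite A" "finite B" using fin C by auto
      show "A \<noteq> {}" "B \<noteq> {}" using edges False by blast+
      show "\<forall>x\<in>A. \<forall>y\<in>B. linked E x y"
      proof (intro ballI linked)
        fix x y assume "x \<in> A" "y \<in> B"
        then have "walk E True x v" "walk E False v y" using walk_sym by (auto simp: A_def B_def)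
        from walk_trans[OF this(2,1)] show "walk E False x y" by simp
      qed
    qed (use True edges False in auto)
    then show ?thesis using C by blast
  next
    case nonempty: False
    then obtain z where "walk E True v z" "walk E False v z" by (auto simp: A_def B_def)
    from walk_trans[OF walk_sym[OF this(1)] this(2)] have odd: "walk E False v v" by simp
    have "good 0 C E"
    proof (rule good_nonbipartite[OF fin E False], intro ballI linked)
      fix x y assume "x \<in> C" "y \<in> C"
      then obtain p q where pq: "walk E p x v" "walk E q v y" using assms(3) walk_sym by metis
      show "walk E False x y"
      proof (cases "p = q")
        case True
        from walk_trans[OF pq(2) walk_trans[OF odd pq(1)]] show ?thesis using True by (cases q) simp_all
      next
        case False
        from walk_trans[OF pq(2,1)] show ?thesis using False by simp
      qed
    qed
    then show ?thesis by blast
  qed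
qed

text \<open>Induction on the number of vertices, splitting off the component \<open>C\<close> of one
  vertex.\<close>

lemma simple_graph_good: "simple_graph V E \<Longrightarrow> \<exists>p. good p V E"
proof (induction "card V" arbitrary: V E rule: less_induct)
  case less
  have fin: "finite V" and E: "\<And>e. e \<in> E \<Longrightarrow> e \<subseteq> V \<and> card e = 2"
    using less.prems by (auto simp: simple_graph_def)
  show ?case
  proof (cases "V = {}")
    case True
    then have "E = {}" using E by fastforce
    then show ?thesis using True good_empty by blast
  next
    case False
    then obtain v where v: "v \<in> V" by blast
    define C where "C = {w. \<exists>p. walk E p v w}"
    have walk_V: "w \<in> V" if "walk E p x w" "x \<in> V" for p x w
      using that by (induction rule: walk.induct) (use E in blast)+
    have CV: "C \<subseteq> V" using walk_V v by (auto simp: C_def)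
    have vC: "v \<in> C" unfolding C_def by (intro CollectI exI[of _ True] walk_refl)
    define E1 where "E1 = {e \<in> E. e \<subseteq> C}"
    define E2 where "E2 = {e \<in> E. e \<subseteq> V - C}"
    have "e \<in> E1 \<union> E2" if e: "e \<in> E" for e
    proof -
      have "card e = 2" "e \<subseteq> V" using E[OF e] by auto
      then obtain x y where xy: "e = {x, y}" by (meson card_2_iff)
      have "x \<in> C \<longleftrightarrow> y \<in> C"
      proof -
        have *: "y \<in> C" if "x \<in> C" "{x, y} \<in> E" for x y
        proof -
          obtain p where "walk E p v x" using \<open>x \<in> C\<close> by (auto simp: C_def)
          from walk_step[OF this that(2)] show ?thesis by (auto simp: C_def)
        qed
        show ?thesis using *[of x y] *[of y x] e xy by (auto simp: insert_commute)
      qed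
      then show ?thesis using e \<open>e \<subseteq> V\<close> xy by (auto simp: E1_def E2_def)
    qed
    then have E12: "E = E1 \<union> E2" by (auto simp: E1_def E2_def)
    have ne: "e \<noteq> {}" if "e \<in> E" for e using E[OF that] by auto
    \<comment> \<open>A walk that starts in \<open>C\<close> stays in \<open>C\<close>, so it uses
      edges of \<open>E1\<close> only.\<close>
    have "\<exists>p. walk E1 p v w" if "w \<in> C" for w
    proof -
      have "walk E1 p x w" if "walk E p x w" "x \<in> C" for p x
        using that
      proof (induction rule: walk.induct)
        case (walk_step p x w y)
        have w: "walk E1 p x w" by (rule walk_step.IH) (rule walk_step.prems)
        obtain q where "walk E q v x" using walk_step.prems by (auto simp: C_def)
        from walk_trans[OF walk_step.hyps(1) this] have "walk E (q = p) v w" .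
        moreover from walk.walk_step[OF this walk_step.hyps(2)] have "walk E (\<not> (q = p)) v y" .
        ultimately have "{w, y} \<in> E1" using walk_step.hyps(2) by (auto simp: E1_def C_def)
        from walk.walk_step[OF w this] show ?case .
      qed (rule walk_refl)
      then show ?thesis using that vC by (auto simp: C_def)
    qed
    moreover have "simple_graph C E1"
      using E fin CV finite_subset by (auto simp: simple_graph_def E1_def)
    ultimately obtain p1 where p1: "good p1 C E1" using good_connected vC by metis
    have "simple_graph (V - C) E2" using E fin by (auto simp: simple_graph_def E2_def)
    moreover have "card (V - C) < card V"
      using fin v vC by (intro psubset_card_mono) auto
    ultimately obtain p2 where p2: "good p2 (V - C) E2" using less.hyps by blast
    have "good (p1 + p2) (C \<union> (V - C)) (E1 \<union> E2)"
      by (rule good_Un[OF _ _ _ _ _ p1 p2])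
        (use fin CV finite_subset ne in \<open>auto simp: E1_def E2_def\<close>)
    then show ?thesis using E12 CV by (metis Un_Diff_cancel Un_absorb1)
  qed
qed

section \<open>Koszul cochains and regular sequences\<close>

text \<open>Exterior multiplication of the cochain \<open>c\<close> by the one-form with
  coefficients \<open>y\<close>; for \<open>y = var\<close> it is the Koszul differential. Cochains
  are arbitrary functions on lists, those of length \<open>p\<close> for degree \<open>p\<close>.
  The recursion over the first index proves the identities without an alternating condition to carry
  along.\<close>

fun koszul :: "('v \<Rightarrow> 'r::comm_ring_1) \<Rightarrow> ('v list \<Rightarrow> 'r) \<Rightarrow> 'v list \<Rightarrow> 'r" where
  "koszul y c [] = 0"
| "koszul y c (v # vs) = y v * c vs - koszul y (\<lambda>ws. c (v # ws)) vs"

lemma koszul_add: "koszul y (\<lambda>vs. c vs + d vs) vs = koszul y c vs + koszul y d vs"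
  by (induction vs arbitrary: c d) (simp_all add: algebra_simps)

lemma koszul_scale: "koszul y (\<lambda>vs. r * c vs) vs = r * koszul y c vs"
  by (induction vs arbitrary: c) (simp_all add: algebra_simps)

lemma koszul_diff: "koszul y (\<lambda>vs. c vs - d vs) vs = koszul y c vs - koszul y d vs"
  using koszul_add[of y c "\<lambda>vs. (-1) * d vs" vs] koszul_scale[of y "-1" d vs] by simp

lemma koszul_zero [simp]: "koszul y (\<lambda>vs. 0) vs = 0"
  using koszul_scale[of y 0 "\<lambda>_. 0" vs] by simp

lemma koszul_sum: "koszul y (\<lambda>vs. \<Sum>i\<in>A. c i vs) vs = (\<Sum>i\<in>A. koszul y (c i) vs)"
  by (induction A rule: infinite_finite_induct) (simp_all add: koszul_add)

lemma koszul_form_add: "koszul (\<lambda>v. y v + z v) c vs = koszul y c vs + koszul z c vs"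
  by (induction vs arbitrary: c) (simp_all add: algebra_simps)

lemma koszul_anticommute:
  "koszul x (koszul y c) vs + koszul y (koszul x c) vs = 0"
proof (induction vs arbitrary: c)
  case (Cons v vs)
  have "koszul x (koszul y c) (v # vs) + koszul y (koszul x c) (v # vs) =
      koszul x (koszul y (\<lambda>ws. c (v # ws))) vs + koszul y (koszul x (\<lambda>ws. c (v # ws))) vs"
    by (simp add: koszul_diff koszul_scale)
  then show ?case using Cons by simp
qed simp

lemma koszul_square [simp]: "koszul y (koszul y c) vs = 0"
proof (induction vs arbitrary: c)
  case (Cons v vs)
  then show ?case by (simp add: koszul_diff koszul_scale)
qed simp

text \<open>The Cartan formula: contraction with \<open>f\<close> and multiplication by
  \<open>x\<close> anticommute up to the scalar obtained by pairing \<open>f\<close> with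
  \<open>x\<close>. Hence elements of the ideal generated by the \<open>x v\<close> act as zero on
  cohomology.\<close>

lemma koszul_homotopy:
  "koszul x (\<lambda>ws. \<Sum>v\<in>U. f v * c (v # ws)) vs + (\<Sum>v\<in>U. f v * koszul x c (v # vs)) =
    (\<Sum>v\<in>U. f v * x v) * c vs"
  by (simp add: koszul_sum koszul_scale algebra_simps sum_subtractf sum_distrib_left)

lemma koszul_eq_0:
  assumes "\<And>v. v \<in> set vs \<Longrightarrow> y v = 0"
  shows "koszul y c vs = 0"
  using assms by (induction vs arbitrary: c) simp_all

lemma koszul_form_cong:
  assumes "\<And>v. v \<in> set vs \<Longrightarrow> y v = z v"
  shows "koszul y c vs = koszul z c vs"
  using assms by (induction vs arbitrary: c) simp_all

lemma koszul_form_scale: "koszul (\<lambda>v. r * y v) c vs = r * koszul y c vs"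
  by (induction vs arbitrary: c) (simp_all add: algebra_simps)

text \<open>The submodules of a polynomial ring met below are modules over a subring \<open>A\<close>, the ring of
  polynomials in fewer variables.\<close>

definition submod :: "'r::comm_ring_1 set \<Rightarrow> 'r set \<Rightarrow> bool" where
  "submod A L \<longleftrightarrow> 0 \<in> L \<and> (\<forall>f\<in>L. \<forall>g\<in>L. f - g \<in> L) \<and> (\<forall>a\<in>A. \<forall>f\<in>L. a * f \<in> L)"

lemma submodD:
  assumes "submod A L"
  shows "0 \<in> L" "f \<in> L \<Longrightarrow> g \<in> L \<Longrightarrow> f - g \<in> L" "a \<in> A \<Longrightarrow> f \<in> L \<Longrightarrow> a * f \<in> L"
    "f \<in> L \<Longrightarrow> - f \<in> L" "f \<in> L \<Longrightarrow> g \<in> L \<Longrightarrow> f + g \<in> L"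
proof -
  show z: "0 \<in> L" and "a \<in> A \<Longrightarrow> f \<in> L \<Longrightarrow> a * f \<in> L"
    using assms by (auto simp: submod_def)
  have d: "f - g \<in> L" if "f \<in> L" "g \<in> L" for f g
    using assms that by (auto simp: submod_def)
  then show "f \<in> L \<Longrightarrow> g \<in> L \<Longrightarrow> f - g \<in> L" .
  have n: "- g \<in> L" if "g \<in> L" for g using d[OF z that] by simp
  then show "f \<in> L \<Longrightarrow> - f \<in> L" .
  show "f + g \<in> L" if "f \<in> L" "g \<in> L" using d[OF that(1) n[OF that(2)]] by simp
qed

lemma submod_sum:
  assumes "submod A L" "\<And>i. i \<in> U \<Longrightarrow> f i \<in> L"
  shows "sum f U \<in> L"
  using assms(2)
  by (induction U rule: infinite_finite_induct) (auto intro: submodD[OF assms(1)])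

lemma submod_multiples:
  assumes "submod A A"
  shows "submod A ((\<lambda>f. f * m) ` A)"
  unfolding submod_def
proof (intro conjI ballI)
  note A = submodD[OF assms]
  show "0 \<in> (\<lambda>f. f * m) ` A" by (rule image_eqI[of _ _ 0]) (simp_all add: A)
  fix f assume "f \<in> (\<lambda>f. f * m) ` A"
  then obtain f' where f: "f = f' * m" "f' \<in> A" by blast
  show "f - g \<in> (\<lambda>f. f * m) ` A" if g: "g \<in> (\<lambda>f. f * m) ` A" for g
  proof -
    obtain g' where "g = g' * m" "g' \<in> A" using g by blast
    then show ?thesis using f by (intro image_eqI[of _ _ "f' - g'"]) (simp_all add: A left_diff_distrib)
  qed
  show "a * f \<in> (\<lambda>f. f * m) ` A" if "a \<in> A" for a
    using that f by (intro image_eqI[of _ _ "a * f'"]) (simp_all add: A mult.assoc)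
qed

lemma koszul_in_submod:
  assumes "submod A L" "set vs \<subseteq> U" "\<And>v. v \<in> U \<Longrightarrow> y v \<in> A"
    and "\<And>ws. set ws \<subseteq> U \<Longrightarrow> Suc (length ws) = length vs \<Longrightarrow> c ws \<in> L"
  shows "koszul y c vs \<in> L"
  using assms(2,4)
proof (induction vs arbitrary: c)
  case Nil
  then show ?case using submodD(1)[OF assms(1)] by simp
next
  case (Cons v vs)
  have "koszul y (\<lambda>ws. c (v # ws)) vs \<in> L"
    by (rule Cons.IH) (use Cons.prems in auto)
  moreover have "y v * c vs \<in> L"
    by (rule submodD(3)[OF assms(1)]) (use Cons.prems assms(3) in auto)
  ultimately show ?case using submodD(2)[OF assms(1)] by simp
qed

text \<open>The variant of \<open>koszul_in_submod\<close> for cochains whose values enter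
  \<open>L\<close> only after multiplication by the form.\<close>

lemma koszul_prod_in_submod:
  assumes "submod A L" "set vs \<subseteq> U" "\<And>v ws. v \<in> U \<Longrightarrow> set ws \<subseteq> U \<Longrightarrow> y v * c ws \<in> L"
  shows "koszul y c vs \<in> L"
  using assms(2,3)
proof (induction vs arbitrary: c)
  case Nil
  then show ?case using submodD(1)[OF assms(1)] by simp
next
  case (Cons v vs)
  have "koszul y (\<lambda>ws. c (v # ws)) vs \<in> L" by (rule Cons.IH) (use Cons.prems in auto)
  moreover have "y v * c vs \<in> L" using Cons.prems by simp
  ultimately show ?case using submodD(2)[OF assms(1)] by simp
qed

definition adjoin :: "'r::comm_ring_1 \<Rightarrow> 'r set \<Rightarrow> 'r set \<Rightarrow> 'r set" where
  "adjoin r W L = {r * w + l | w l. w \<in> W \<and> l \<in> L}"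

lemma submod_adjoin:
  assumes "submod A W" "submod A L"
  shows "submod A (adjoin r W L)"
  unfolding submod_def adjoin_def
proof (intro conjI ballI)
  show "0 \<in> {r * w + l |w l. w \<in> W \<and> l \<in> L}"
    using submodD(1)[OF assms(1)] submodD(1)[OF assms(2)] by force
next
  fix f g assume "f \<in> {r * w + l |w l. w \<in> W \<and> l \<in> L}" "g \<in> {r * w + l |w l. w \<in> W \<and> l \<in> L}"
  then obtain w l w' l' where 
    "f = r * w + l" "w \<in> W" "l \<in> L" "g = r * w' + l'" "w' \<in> W" "l' \<in> L" by blast
  then show "f - g \<in> {r * w + l |w l. w \<in> W \<and> l \<in> L}"
    using submodD(2)[OF assms(1), of w w'] submodD(2)[OF assms(2), of l l']
    by (intro CollectI exI[of _ "w - w'"] exI[of _ "l - l'"]) (simp add: algebra_simps)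
next
  fix a f assume "a \<in> A" "f \<in> {r * w + l |w l. w \<in> W \<and> l \<in> L}"
  then obtain w l where "f = r * w + l" "w \<in> W" "l \<in> L" by blast
  then show "a * f \<in> {r * w + l |w l. w \<in> W \<and> l \<in> L}"
    using submodD(3)[OF assms(1) \<open>a \<in> A\<close>, of w] submodD(3)[OF assms(2) \<open>a \<in> A\<close>, of l]
    by (intro CollectI exI[of _ "a * w"] exI[of _ "a * l"]) (simp add: algebra_simps)
qed

text \<open>Regularity on \<open>W / L\<close>, stated for representatives in \<open>W\<close>;
  dividing out an element just enlarges \<open>L\<close>.\<close>

fun regular_mod :: "'r::comm_ring_1 set \<Rightarrow> 'r set \<Rightarrow> 'r list \<Rightarrow> bool" where
  "regular_mod W L [] \<longleftrightarrow> True"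
| "regular_mod W L (r # rs) \<longleftrightarrow>
    (\<forall>w\<in>W. r * w \<in> L \<longrightarrow> w \<in> L) \<and> regular_mod W (adjoin r W L) rs"

text \<open>A nonzero class in degree \<open>p\<close> of the Koszul cohomology of \<open>W / L\<close> turns, after contraction
  with a regular element \<open>r\<close>, into a nonzero class in degree \<open>p - 1\<close> of \<open>W / (L + r W)\<close>; a nonzero
  class in degree \<open>0\<close> is a socle element and excludes regular elements.\<close>

lemma regular_mod_length_le:
  assumes W: "submod A W" and x: "\<And>v. v \<in> U \<Longrightarrow> x v \<in> A"
    and L: "submod A L"
    and rs: "\<And>r. r \<in> set rs \<Longrightarrow> \<exists>f. (\<forall>v\<in>U. f v \<in> A) \<and> r = (\<Sum>v\<in>U. f v * x v)"
    and reg: "regular_mod W L rs"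
    and c: "\<And>vs. set vs \<subseteq> U \<Longrightarrow> c vs \<in> W"
    and cocycle: "\<And>vs. set vs \<subseteq> U \<Longrightarrow> length vs = Suc p \<Longrightarrow> koszul x c vs \<in> L"
    and nontrivial: "\<And>g. (\<And>vs. set vs \<subseteq> U \<Longrightarrow> g vs \<in> W) \<Longrightarrow>
      (\<And>vs. set vs \<subseteq> U \<Longrightarrow> length vs = p \<Longrightarrow> c vs - koszul x g vs \<in> L) \<Longrightarrow> False"
  shows "length rs \<le> p"
  using L rs reg c cocycle nontrivial
proof (induction rs arbitrary: L c p)
  case (Cons r rs)
  note L = Cons.prems(1) and c = Cons.prems(4) and cocycle = Cons.prems(5)
    and nontrivial = Cons.prems(6)
  obtain f where f: "\<And>v. v \<in> U \<Longrightarrow> f v \<in> A" "r = (\<Sum>v\<in>U. f v * x v)"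
    using Cons.prems(2)[of r] by auto
  have reg: "\<And>w. w \<in> W \<Longrightarrow> r * w \<in> L \<Longrightarrow> w \<in> L" "regular_mod W (adjoin r W L) rs"
    using Cons.prems(3) by auto
  show ?case
  proof (cases p)
    case 0
    have x0: "x v * c [] \<in> L" if "v \<in> U" for v
      using cocycle[of "[v]"] that 0 by simp
    have "(\<Sum>v\<in>U. f v * (x v * c [])) \<in> L"
      by (rule submod_sum[OF L]) (use x0 f(1) submodD(3)[OF L] in blast)
    moreover have "(\<Sum>v\<in>U. f v * (x v * c [])) = r * c []"
      by (simp add: f(2) sum_distrib_left algebra_simps)
    ultimately have "c [] \<in> L" using reg(1)[of "c []"] c[of "[]"] by simp
    then have False
      using nontrivial[of "\<lambda>_. 0"] 0 submodD(1)[OF W] by simp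
    then show ?thesis ..
  next
    case (Suc q)
    define c' where "c' ws = (\<Sum>v\<in>U. f v * c (v # ws))" for ws
    let ?L = "adjoin r W L"
    have homotopy: "koszul x c' vs + (\<Sum>v\<in>U. f v * koszul x c (v # vs)) = r * c vs" for vs
      unfolding c'_def f(2) by (rule koszul_homotopy)
    have rest: "(\<Sum>v\<in>U. f v * koszul x c (v # vs)) \<in> L"
      if "set vs \<subseteq> U" "length vs = Suc q" for vs
      using that f(1) Suc by (intro submod_sum[OF L] submodD(3)[OF L] cocycle) auto
    have "length rs \<le> q"
    proof (rule Cons.IH[where c = c'])
      show "submod A ?L" by (rule submod_adjoin[OF W L])
      show "\<exists>f. (\<forall>v\<in>U. f v \<in> A) \<and> s = (\<Sum>v\<in>U. f v * x v)" if "s \<in> set rs" for s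
        using Cons.prems(2)[of s] that by simp
      show "regular_mod W ?L rs" by (rule reg(2))
      show "c' vs \<in> W" if "set vs \<subseteq> U" for vs
        unfolding c'_def using that f(1)
        by (intro submod_sum[OF W] submodD(3)[OF W] c) auto
      show "koszul x c' vs \<in> ?L" if "set vs \<subseteq> U" "length vs = Suc q" for vs
      proof -
        \<comment> \<open>By the homotopy the differential of \<open>c'\<close> is
          \<open>r * c\<close> modulo \<open>L\<close>, and \<open>r * c\<close> vanishes modulo
          \<open>r W\<close>.\<close>
        have "koszul x c' vs = r * c vs + - (\<Sum>v\<in>U. f v * koszul x c (v # vs))"
          using homotopy[of vs] by (simp add: eq_diff_eq)
        then show ?thesis
          unfolding adjoin_def using c[OF that(1)] submodD(4)[OF L rest[OF that]] by blast
      qed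
      show False
        if g: "\<And>vs. set vs \<subseteq> U \<Longrightarrow> g vs \<in> W"
          "\<And>vs. set vs \<subseteq> U \<Longrightarrow> length vs = q \<Longrightarrow> c' vs - koszul x g vs \<in> ?L" for g
      proof -
        have "\<exists>w\<in>W. c' vs - koszul x g vs - r * w \<in> L" if vs: "set vs \<subseteq> U" "length vs = q" for vs
        proof -
          obtain w l where "c' vs - koszul x g vs = r * w + l" "w \<in> W" "l \<in> L"
            using g(2)[OF vs] unfolding adjoin_def by blast
          then show ?thesis by (intro bexI[of _ w]) simp_all
        qed
        then obtain e0 where e0: "\<And>vs. set vs \<subseteq> U \<Longrightarrow> length vs = q \<Longrightarrow>
            e0 vs \<in> W \<and> c' vs - koszul x g vs - r * e0 vs \<in> L" by metis
        \<comment> \<open>The default 0 on lists of other lengths keeps all values of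
          \<open>e\<close> in \<open>W\<close>.\<close>
        define e where "e vs = (if length vs = q then e0 vs else 0)" for vs
        show False
        proof (rule nontrivial[of e])
          show "e vs \<in> W" if "set vs \<subseteq> U" for vs
            using e0[OF that] submodD(1)[OF W] by (simp add: e_def)
        next
          fix vs assume vs: "set vs \<subseteq> U" "length vs = p"
          \<comment> \<open>The differential kills the coboundary of \<open>g\<close>. Combined with
            the homotopy this leaves \<open>r\<close> times the difference of \<open>c\<close> and
            the coboundary of \<open>e\<close> in \<open>L\<close>. Cancelling \<open>r\<close>
            makes \<open>c\<close> a coboundary, a contradiction.\<close>
          have "koszul x (\<lambda>ws. (c' ws - koszul x g ws) - r * e ws) vs \<in> L"
            by (rule koszul_in_submod[OF L vs(1) x]) (use e0 vs Suc in \<open>auto simp: e_def\<close>)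
          then have "koszul x c' vs - r * koszul x e vs \<in> L"
            by (simp add: koszul_diff koszul_scale)
          then have "koszul x c' vs - r * koszul x e vs
              + (\<Sum>v\<in>U. f v * koszul x c (v # vs)) \<in> L"
            using rest vs Suc by (intro submodD(5)[OF L]) auto
          then have *: "r * (c vs - koszul x e vs) \<in> L"
            using homotopy[of vs] by (simp add: algebra_simps)
          have "koszul x e vs \<in> W"
            by (rule koszul_in_submod[OF W vs(1) x])
              (use e0 vs Suc submodD(1)[OF W] in \<open>auto simp: e_def\<close>)
          then show "c vs - koszul x e vs \<in> L"
            by (rule reg(1)[OF submodD(2)[OF W c[OF vs(1)]] *])
        qed
      qed
    qed
    then show ?thesis using Suc by simp
  qed
qed simp

section \<open>Monomial ideals\<close>

text \<open>With \<open>T = UNIV\<close> this is the polynomial ring, with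
  \<open>T = edge_power E k\<close> it will turn out to be \<open>I^k\<close>.\<close>

definition monomial_module :: "'v set \<Rightarrow> ('v \<Rightarrow>\<^sub>0 nat) set \<Rightarrow> ('v, 'k::field) mpoly set" where
  "monomial_module V T = {f. \<forall>t\<in>Poly_Mapping.keys f. Poly_Mapping.keys t \<subseteq> V \<and> t \<in> T}"

lemma carrier_mpoly_ring: "carrier (mpoly_ring V) = monomial_module V UNIV"
  by (simp add: mpoly_ring_def monomial_module_def)

lemma monomial_module_mult:
  assumes "upset T" "f \<in> monomial_module V UNIV" "g \<in> monomial_module V T"
  shows "f * g \<in> monomial_module V T"
  unfolding monomial_module_def
proof (intro CollectI ballI)
  fix t assume "t \<in> Poly_Mapping.keys (f * g)"
  then obtain r s where "t = r + s" "r \<in> Poly_Mapping.keys f" "s \<in> Poly_Mapping.keys g"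
    using keys_mult[of f g] by auto
  then show "Poly_Mapping.keys t \<subseteq> V \<and> t \<in> T"
    using assms by (auto simp: monomial_module_def upset_def keys_add_nat add.commute[of r s])
qed

lemma monomial_module_add:
  "f \<in> monomial_module V T \<Longrightarrow> g \<in> monomial_module V T \<Longrightarrow> f + g \<in> monomial_module V T"
  using keys_add[of f g] by (auto simp: monomial_module_def)

lemma monomial_module_diff:
  "f \<in> monomial_module V T \<Longrightarrow> g \<in> monomial_module V T \<Longrightarrow> f - g \<in> monomial_module V T"
proof -
  have "Poly_Mapping.keys (f - g) \<subseteq> Poly_Mapping.keys f \<union> Poly_Mapping.keys g"
    by (auto simp: in_keys_iff lookup_minus)
  then show "f \<in> monomial_module V T \<Longrightarrow> g \<in> monomial_module V T \<Longrightarrow> f - g \<in> monomial_module V T"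
    by (auto simp: monomial_module_def)
qed

lemma zero_in_monomial_module [simp]: "0 \<in> monomial_module V T"
  by (simp add: monomial_module_def)

lemma single_in_monomial_module:
  "Poly_Mapping.keys t \<subseteq> V \<Longrightarrow> t \<in> T \<Longrightarrow> Poly_Mapping.single t c \<in> monomial_module V T"
  by (auto simp: monomial_module_def)

lemma var_in_monomial_module: "v \<in> V \<Longrightarrow> var v \<in> monomial_module V UNIV"
  unfolding var_def by (rule single_in_monomial_module) auto

lemma submod_monomial_module: "upset T \<Longrightarrow> submod (monomial_module V UNIV) (monomial_module V T)"
  unfolding submod_def by (auto intro: monomial_module_mult monomial_module_diff)

lemma lookup_monomial_mult:
  fixes f :: "('v, 'k::field) mpoly"
  shows "Poly_Mapping.lookup (Poly_Mapping.single s 1 * f) (m + s) = Poly_Mapping.lookup f m"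
proof -
  have "Poly_Mapping.lookup (Poly_Mapping.single s 1 * f) (m + s) =
      (\<Sum>q. Poly_Mapping.lookup f q when m + s = s + q)"
    by (simp add: lookup_mult lookup_single when_mult)
  also have "\<dots> = (\<Sum>q. Poly_Mapping.lookup f q when q = m)"
    by (intro Sum_any.cong) (auto simp: add.commute when_def)
  finally show ?thesis by simp
qed

lemma lookup_var_mult_eq_0:
  fixes f :: "('v, 'k::field) mpoly"
  assumes "Poly_Mapping.lookup m v = 0"
  shows "Poly_Mapping.lookup (var v * f) m = 0"
proof (rule ccontr)
  assume "\<not> ?thesis"
  then have "m \<in> Poly_Mapping.keys (var v * f)" by (simp add: in_keys_iff)
  then obtain q where "m = Poly_Mapping.single v 1 + q"
    using keys_mult[of "var v" f] by (auto simp: var_def)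
  then show False using assms by (simp add: lookup_add)
qed

section \<open>The cocycle of a witness and the functional detecting it\<close>

definition component_form :: "'v set \<times> 'v set \<times> 'v \<times> 'v \<Rightarrow> 'v \<Rightarrow> ('v, 'k::field) mpoly" where
  "component_form = (\<lambda>(A, B, a, b) v. if v \<in> A then (if B = {} then 1 else var v) else 0)"

fun component_cochain :: "('v set \<times> 'v set \<times> 'v \<times> 'v) list \<Rightarrow> ('v \<Rightarrow>\<^sub>0 nat) \<Rightarrow> 'v list \<Rightarrow>
    ('v, 'k::field) mpoly" where
  "component_cochain [] u = (\<lambda>vs. if vs = [] then Poly_Mapping.single u 1 else 0)"
| "component_cochain (c # cs) u = koszul (component_form c) (component_cochain cs u)"

text \<open>A functional on cochains that vanishes on coboundaries: it is the tensor product, over the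
  components, of the functionals that compare a coefficient at \<open>a\<close> with one at \<open>b\<close>.\<close>

fun component_cycle :: "('v set \<times> 'v set \<times> 'v \<times> 'v) list \<Rightarrow> ('v \<Rightarrow>\<^sub>0 nat) \<Rightarrow>
    ('v list \<Rightarrow> ('v, 'k::field) mpoly) \<Rightarrow> 'k" where
  "component_cycle [] m c = Poly_Mapping.lookup (c []) m"
| "component_cycle ((A, B, a, b) # cs) m c =
    (if B = {} then component_cycle cs m (\<lambda>vs. c (a # vs)) else
      component_cycle cs (m + Poly_Mapping.single a 1) (\<lambda>vs. c (a # vs)) -
      component_cycle cs (m + Poly_Mapping.single b 1) (\<lambda>vs. c (b # vs)))"

lemma component_cycle_diff:
  "component_cycle cs m (\<lambda>vs. c vs - d vs) = component_cycle cs m c - component_cycle cs m d"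
  by (induction cs m c arbitrary: d rule: component_cycle.induct) (simp_all add: lookup_minus)

lemma component_cycle_monomial_mult:
  "component_cycle cs (m + s) (\<lambda>vs. Poly_Mapping.single s 1 * c vs) = component_cycle cs m c"
proof (induction cs m c rule: component_cycle.induct)
  case (1 m c)
  then show ?case by (simp add: lookup_monomial_mult)
next
  case (2 A B a b cs m c)
  have "m + s + t = m + t + s" for t by (simp add: ac_simps)
  then show ?case using 2 by simp
qed

text \<open>The functional evaluates cochains only at lists with one representative per entry, and
  there it reads only coefficients at \<open>m + s\<close> with \<open>s\<close> in
  \<open>choices cs\<close>.\<close>

lemma component_cycle_eq_0:
  assumes "\<And>vs s. set vs \<subseteq> U \<Longrightarrow> length vs = length cs \<Longrightarrow> s \<in> choices cs \<Longrightarrow>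
      Poly_Mapping.lookup (c vs) (m + s) = 0"
    and "\<forall>(A, B, a, b)\<in>set cs. a \<in> U \<and> (B = {} \<or> b \<in> U)"
  shows "component_cycle cs m c = 0"
  using assms
proof (induction cs m c rule: component_cycle.induct)
  case (1 m c)
  then show ?case using "1.prems"(1)[of "[]" 0] by simp
next
  case (2 A B a b cs m c)
  have U: "a \<in> U" "B = {} \<or> b \<in> U" "\<forall>(A, B, a, b)\<in>set cs. a \<in> U \<and> (B = {} \<or> b \<in> U)"
    using 2(5) by auto
  show ?case
  proof (cases "B = {}")
    case True
    have "component_cycle cs m (\<lambda>vs. c (a # vs)) = 0"
      by (rule "2.IH"(1)[OF True _ U(3)]) (use 2(4) U True in auto)
    then show ?thesis using True by simp
  next
    case False
    have "Poly_Mapping.lookup (c (x # vs)) (m + Poly_Mapping.single x 1 + s) = 0"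
      if "x = a \<or> x = b" "set vs \<subseteq> U" "length vs = length cs" "s \<in> choices cs" for x vs s
      using 2(4)[of "x # vs" "Poly_Mapping.single x 1 + s"] that U False by (auto simp: add.assoc)
    then have "component_cycle cs (m + Poly_Mapping.single a 1) (\<lambda>vs. c (a # vs)) = 0"
      "component_cycle cs (m + Poly_Mapping.single b 1) (\<lambda>vs. c (b # vs)) = 0"
      by (intro "2.IH"(2)[OF False _ U(3)] "2.IH"(3)[OF False _ U(3)]; auto)+
    then show ?thesis using False by simp
  qed
qed

text \<open>All exponents that the functional reads are free of \<open>v\<close>.\<close>

lemma component_cycle_var_mult:
  assumes "Poly_Mapping.lookup m v = 0" "\<forall>(A, B, a, b)\<in>set cs. v \<noteq> a \<and> (B = {} \<or> v \<noteq> b)"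
  shows "component_cycle cs m (\<lambda>vs. var v * c vs) = 0"
  using assms
proof (induction cs m c rule: component_cycle.induct)
  case (1 m c)
  then show ?case by (simp add: lookup_var_mult_eq_0)
next
  case (2 A B a b cs m c)
  then show ?case by (cases "B = {}") (auto simp: lookup_add lookup_single when_def)
qed

text \<open>After fixing the first index \<open>x\<close>, what remains is \<open>var x * g\<close>
  minus a coboundary, which dies by induction. For a bipartite component the terms for
  \<open>a\<close> and \<open>b\<close> both give the functional of the rest at \<open>g\<close> and
  cancel. For an isolated vertex \<open>a\<close> the term \<open>var a * g\<close> is not seen, as
  \<open>m\<close> is free of \<open>a\<close>.\<close>

lemma component_cycle_coboundary:
  fixes g :: "'v list \<Rightarrow> ('v, 'k::field) mpoly"
  assumes "\<And>c. c \<in> set cs \<Longrightarrow> witness_entry V E k u c"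
    and "sorted_wrt (\<lambda>c c'. component_vertices c \<inter> component_vertices c' = {}) cs"
    and "\<And>A B a b. (A, B, a, b) \<in> set cs \<Longrightarrow> B = {} \<Longrightarrow> Poly_Mapping.lookup m a = 0"
  shows "component_cycle cs m (koszul var g) = 0"
  using assms
proof (induction cs arbitrary: m g)
  case (Cons c cs)
  obtain A B a b where c: "c = (A, B, a, b)" by (metis surj_pair)
  have other: "x \<noteq> a' \<and> (B' = {} \<or> x \<noteq> b')" if "x \<in> A \<union> B" "(A', B', a', b') \<in> set cs" for x A' B' a' b'
    using Cons.prems(1)[of "(A', B', a', b')"] Cons.prems(2) that
    by (cases "B' = {}") (auto simp: c component_vertices_def witness_entry_def)
  have IH: "component_cycle cs m' (koszul var h) = 0"
    if "\<And>A B a b. (A, B, a, b) \<in> set cs \<Longrightarrow> B = {} \<Longrightarrow> Poly_Mapping.lookup m' a = 0" for m' and h :: "'v list \<Rightarrow> ('v, 'k) mpoly"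
    by (rule Cons.IH) (use Cons.prems that in auto)
  have m0: "Poly_Mapping.lookup m a' = 0" if "(A', B', a', b') \<in> set cs" "B' = {}" for A' B' a' b'
    by (rule Cons.prems(3)[of A' B' a' b']) (use that in auto)
  show ?case
  proof (cases "B = {}")
    case True
    have "a \<in> A" "Poly_Mapping.lookup m a = 0"
      using Cons.prems(1)[of c] Cons.prems(3)[of A B a b] True by (auto simp: c witness_entry_def)
    then have "component_cycle cs m (\<lambda>vs. var a * g vs) = 0"
      by (intro component_cycle_var_mult) (use other[of a] in auto)
    moreover have "component_cycle cs m (koszul var (\<lambda>ws. g (a # ws))) = 0"
      by (rule IH) (rule m0)
    ultimately show ?thesis using True by (simp add: c component_cycle_diff)
  next
    case False
    then have ab: "a \<in> A \<union> B" "b \<in> A \<union> B"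
      using Cons.prems(1)[of c] by (auto simp: c witness_entry_def)
    have "component_cycle cs (m + Poly_Mapping.single x 1) (\<lambda>vs. koszul var g (x # vs)) =
        component_cycle cs m g" if x: "x \<in> A \<union> B" for x
    proof -
      have "component_cycle cs (m + Poly_Mapping.single x 1) (koszul var (\<lambda>ws. g (x # ws))) = 0"
        by (rule IH) (use m0 other[OF x] in \<open>force simp: lookup_add lookup_single\<close>)
      then show ?thesis
        using component_cycle_monomial_mult[of cs m "Poly_Mapping.single x 1" g]
        by (simp add: component_cycle_diff var_def)
    qed
    from this[OF ab(1)] this[OF ab(2)] show ?thesis using False by (simp add: c)
  qed
qed simp

text \<open>Of the representatives of the first entry only \<open>a\<close> lies in
  \<open>A\<close>, so one leading term survives; a factor \<open>var a\<close> is absorbed by the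
  shift of \<open>m\<close>. The other terms evaluate the form of this component at vertices of
  other components, where it is zero.\<close>

lemma component_cycle_cochain:
  fixes m :: "'v \<Rightarrow>\<^sub>0 nat"
  assumes "\<And>c. c \<in> set cs \<Longrightarrow> witness_entry V E k u c"
    and "sorted_wrt (\<lambda>c c'. component_vertices c \<inter> component_vertices c' = {}) cs"
  shows "component_cycle cs m (component_cochain cs m) = (1 :: 'k::field)"
  using assms
proof (induction cs)
  case (Cons c cs)
  obtain A B a b where c: "c = (A, B, a, b)" by (metis surj_pair)
  let ?z = "component_cochain cs m :: 'v list \<Rightarrow> ('v, 'k) mpoly"
  have IH: "component_cycle cs m ?z = 1"
    by (rule Cons.IH) (use Cons.prems in auto)
  define U where "U = (\<Union>c\<in>set cs. component_vertices c)"
  have U: "U \<inter> A = {}" using Cons.prems(2) by (auto simp: U_def c component_vertices_def)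
  have reps: "a' \<in> U \<and> (B' = {} \<or> b' \<in> U)" if "(A', B', a', b') \<in> set cs" for A' B' a' b'
  proof -
    have "witness_entry V E k u (A', B', a', b')" by (rule Cons.prems(1)) (use that in simp)
    then have "a' \<in> A' \<union> B'" "B' = {} \<or> b' \<in> A' \<union> B'"
      by (auto simp: witness_entry_def split: if_splits)
    moreover have "component_vertices (A', B', a', b') \<subseteq> U" unfolding U_def using that by blast
    ultimately show ?thesis by (auto simp: component_vertices_def)
  qed
  have rest: "component_cycle cs m' (koszul (component_form c) h) = (0::'k)" for m' h
  proof (rule component_cycle_eq_0[of U])
    fix vs s assume "set vs \<subseteq> U"
    then have "koszul (component_form c) h vs = 0"
      using U by (intro koszul_eq_0) (auto simp: component_form_def c)
    then show "Poly_Mapping.lookup (koszul (component_form c) h vs) (m' + s) = 0" by simp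
  qed (use reps in blast)
  have entry: "witness_entry V E k u c" by (rule Cons.prems(1)) simp
  show ?case
  proof (cases "B = {}")
    case True
    then have "component_form c a = (1 :: ('v, 'k) mpoly)"
      using entry by (auto simp: component_form_def c witness_entry_def)
    then show ?thesis using True IH rest by (simp add: c component_cycle_diff)
  next
    case False
    then have "component_form c a = (var a :: ('v, 'k) mpoly)" "component_form c b = (0 :: ('v, 'k) mpoly)"
      using entry by (auto simp: component_form_def c witness_entry_def)
    moreover have "component_cycle cs (m + Poly_Mapping.single a 1) (\<lambda>vs. var a * ?z vs) = 1"
      using component_cycle_monomial_mult[of cs m "Poly_Mapping.single a 1" ?z] IH by (simp add: var_def)
    moreover have "component_cycle cs m' (\<lambda>vs. - koszul (component_form c) h vs) = (0::'k)" for m' h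
    proof -
      have "component_cycle cs m' (\<lambda>vs. 0) = (0::'k)"
        using component_cycle_diff[of cs m' "\<lambda>_. 0" "\<lambda>_. 0"] by simp
      then show ?thesis
        using component_cycle_diff[of cs m' "\<lambda>_. 0" "koszul (component_form c) h"] rest by simp
    qed
    ultimately show ?thesis using False rest by (simp add: c component_cycle_diff)
  qed
qed simp

lemma component_form_in:
  assumes "witness_entry V E k u c" "v \<in> V"
  shows "component_form c v \<in> monomial_module V UNIV"
  using assms single_in_monomial_module[of 0 V UNIV 1] var_in_monomial_module[of v V]
  by (auto simp: component_form_def single_one split: prod.splits)

text \<open>Divisibility by the monomial of \<open>u\<close> places the cochain in
  \<open>I^k\<close> and makes the colon conditions on \<open>u\<close> applicable to all its
  values.\<close>

lemma component_cochain_multiple: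
  assumes "\<And>c. c \<in> set cs \<Longrightarrow> witness_entry V E k u c" "set vs \<subseteq> V"
  shows "\<exists>f\<in>monomial_module V UNIV. component_cochain cs u vs = f * Poly_Mapping.single u 1"
proof -
  let ?S = "monomial_module V UNIV :: ('a, 'b) mpoly set"
  define P where "P = (\<lambda>f. f * Poly_Mapping.single u 1) ` ?S"
  have S: "submod ?S ?S" by (rule submod_monomial_module) (simp add: upset_def)
  have P: "submod ?S P" unfolding P_def by (rule submod_multiples[OF S])
  have "component_cochain cs u vs \<in> P"
    using assms
  proof (induction cs arbitrary: vs)
    case Nil
    have "1 * Poly_Mapping.single u 1 \<in> P"
      unfolding P_def by (rule imageI) (simp add: monomial_module_def)
    then show ?case using submodD(1)[OF P] by simp
  next
    case (Cons c cs)
    have "witness_entry V E k u c" by (rule Cons.prems(1)) simp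
    then show ?case
      unfolding component_cochain.simps
      by (intro koszul_in_submod[OF P Cons.prems(2)] component_form_in Cons.IH Cons.prems(1)) auto
  qed
  then show ?thesis by (auto simp: P_def)
qed

text \<open>The set \<open>Y\<close> is variable so that it can shrink: moving the differential past
  the form of the first component removes that component from \<open>Y\<close>. In the end only
  vertices outside all components are left, whose variables multiply \<open>u\<close> into
  \<open>I^(k+1)\<close>.\<close>

lemma koszul_component_cochain_in:
  fixes V :: "'v set" and E k and L :: "('v, 'k::field) mpoly set"
  defines "L \<equiv> monomial_module V (edge_power E (Suc k))"
  assumes "\<And>c. c \<in> set cs \<Longrightarrow> witness_entry V E k u c"
    and "sorted_wrt (\<lambda>c c'. component_vertices c \<inter> component_vertices c' = {}) cs"
    and "Poly_Mapping.keys u \<subseteq> V" "Y \<subseteq> V" "\<And>c. c \<in> set cs \<Longrightarrow> component_vertices c \<subseteq> Y"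
    and "\<And>v. v \<in> Y \<Longrightarrow> (\<And>c. c \<in> set cs \<Longrightarrow> v \<notin> component_vertices c) \<Longrightarrow>
      Poly_Mapping.single v 1 + u \<in> edge_power E (Suc k)"
    and "set vs \<subseteq> V"
  shows "koszul (\<lambda>v. if v \<in> Y then var v else 0) (component_cochain cs u) vs \<in> L"
  using assms(2-)
proof (induction cs arbitrary: Y vs)
  case Nil
  have L: "submod (monomial_module V UNIV) L" unfolding L_def by (rule submod_monomial_module[OF upset_edge_power])
  show ?case
  proof (rule koszul_prod_in_submod[OF L Nil.prems(7)])
    fix v ws
    have "var v * Poly_Mapping.single u 1 = (Poly_Mapping.single (Poly_Mapping.single v 1 + u) 1 :: ('v, 'k) mpoly)"
      by (simp add: var_def mult_single)
    also have "\<dots> \<in> L" if "v \<in> Y"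
      unfolding L_def using that Nil.prems(3,4,6)
      by (intro single_in_monomial_module) (auto simp: keys_add_nat split: if_splits)
    finally show "(if v \<in> Y then var v else 0) * component_cochain [] u ws \<in> L"
      using submodD(1)[OF L] by auto
  qed
next
  case (Cons c cs)
  have L: "submod (monomial_module V UNIV) L" unfolding L_def by (rule submod_monomial_module[OF upset_edge_power])
  obtain A B a b where c: "c = (A, B, a, b)" by (metis surj_pair)
  let ?z = "component_cochain cs u :: 'v list \<Rightarrow> ('v, 'k) mpoly"
  let ?y = "component_form c :: 'v \<Rightarrow> ('v, 'k) mpoly"
  let ?r = "if B = {} then var a else 1 :: ('v, 'k) mpoly"
  define Y' where "Y' = Y - component_vertices c"
  define yB where "yB = (\<lambda>v. if v \<in> B then var v else 0 :: ('v, 'k) mpoly)"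
  define yY where "yY = (\<lambda>v. if v \<in> Y' then var v else 0 :: ('v, 'k) mpoly)"
  have entry: "witness_entry V E k u c" by (rule Cons.prems(1)) simp
  have AB: "A \<inter> B = {}" "A \<union> B \<subseteq> Y" "A \<union> B \<subseteq> V" "B = {} \<Longrightarrow> A = {a}"
    using entry Cons.prems(5)[of c] by (auto simp: witness_entry_def c component_vertices_def split: if_splits)
  \<comment> \<open>The parts on \<open>A\<close>, on \<open>B\<close> and outside the component.
    The first is proportional to the component form and squares to zero; the second produces
    products of a vertex of \<open>B\<close>, one of \<open>A\<close> and \<open>u\<close>, which
    lie in \<open>I^(k+1)\<close>; the third anticommutes with the form and is left to the
    induction. For an isolated vertex the form is \<open>e_a\<close> rather than
    \<open>x_a e_a\<close>, hence \<open>?r\<close>.\<close>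
  have "(if v \<in> Y then var v else 0) = ?r * ?y v + yB v + yY v" for v
    using AB by (auto simp: component_form_def c yB_def yY_def Y'_def component_vertices_def)
  then have "koszul (\<lambda>v. if v \<in> Y then var v else 0) (component_cochain (c # cs) u) vs =
      ?r * koszul ?y (koszul ?y ?z) vs + koszul yB (koszul ?y ?z) vs + koszul yY (koszul ?y ?z) vs"
    by (simp only: koszul_form_add koszul_form_scale component_cochain.simps)
  also have "\<dots> = koszul yB (koszul ?y ?z) vs - koszul ?y (koszul yY ?z) vs"
    using koszul_anticommute[of yY ?y ?z vs] by (simp add: add_eq_0_iff)
  also have "\<dots> \<in> L"
  proof (rule submodD(2)[OF L])
    have "yB v * (?y w * ?z ws) \<in> L" if "v \<in> V" "w \<in> V" "set ws \<subseteq> V" for v w ws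
    proof (cases "v \<in> B \<and> w \<in> A")
      case True
      have "\<exists>f\<in>monomial_module V UNIV. ?z ws = f * Poly_Mapping.single u 1"
        by (rule component_cochain_multiple) (use Cons.prems(1) that in auto)
      then obtain f where f: "f \<in> monomial_module V UNIV" "?z ws = f * Poly_Mapping.single u 1" by blast
      have "yB v * (?y w * ?z ws) = f * (var w * var v * Poly_Mapping.single u 1)"
        using True f(2) by (auto simp: yB_def component_form_def c)
      also have "\<dots> = f * Poly_Mapping.single (Poly_Mapping.single w 1 + Poly_Mapping.single v 1 + u) 1"
        by (simp add: var_def mult_single)
      also have "\<dots> \<in> L"
      proof (rule submodD(3)[OF L f(1)])
        have "Poly_Mapping.single w 1 + Poly_Mapping.single v 1 + u \<in> edge_power E (Suc k)"
          using entry True by (auto simp: witness_entry_def c split: if_splits)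
        then show "Poly_Mapping.single (Poly_Mapping.single w 1 + Poly_Mapping.single v 1 + u) 1 \<in> L"
          unfolding L_def using that Cons.prems(3)
          by (intro single_in_monomial_module) (auto simp: keys_add_nat split: if_splits)
      qed
      finally show ?thesis .
    next
      case False
      then have "yB v * (?y w * ?z ws) = 0" by (auto simp: yB_def component_form_def c)
      then show ?thesis using submodD(1)[OF L] by simp
    qed
    note prod = this
    show "koszul yB (koszul ?y ?z) vs \<in> L"
    proof (rule koszul_prod_in_submod[OF L Cons.prems(7)])
      fix v ws assume v: "v \<in> V" "set ws \<subseteq> V"
      have "koszul ?y (\<lambda>ws. yB v * ?z ws) ws \<in> L"
        by (rule koszul_prod_in_submod[OF L v(2)]) (use prod v in \<open>simp add: ac_simps\<close>)
      then show "yB v * koszul ?y ?z ws \<in> L" by (simp add: koszul_scale)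
    qed
    show "koszul ?y (koszul yY ?z) vs \<in> L"
    proof (rule koszul_in_submod[OF L Cons.prems(7)])
      show "?y v \<in> monomial_module V UNIV" if "v \<in> V" for v by (rule component_form_in[OF entry that])
      show "koszul yY ?z ws \<in> L" if ws: "set ws \<subseteq> V" for ws
        unfolding yY_def
      proof (rule Cons.IH)
        show "witness_entry V E k u c'" if "c' \<in> set cs" for c' using Cons.prems(1) that by simp
        show "sorted_wrt (\<lambda>c c'. component_vertices c \<inter> component_vertices c' = {}) cs"
          using Cons.prems(2) by simp
        show "component_vertices c' \<subseteq> Y'" if "c' \<in> set cs" for c'
          using Cons.prems(2) Cons.prems(5)[of c'] that by (auto simp: Y'_def)
        show "Y' \<subseteq> V" using Cons.prems(4) by (auto simp: Y'_def)
        show "Poly_Mapping.single v 1 + u \<in> edge_power E (Suc k)"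
          if "v \<in> Y'" "\<And>c. c \<in> set cs \<Longrightarrow> v \<notin> component_vertices c" for v
          by (rule Cons.prems(6)) (use that in \<open>auto simp: Y'_def\<close>)
      qed (use Cons.prems(3) ws in auto)
    qed
  qed
  finally show ?case .
qed

text \<open>The functional at \<open>m = u\<close> is 1 on the cochain, 0 on coboundaries and 0 on
  cochains with values in \<open>I^(k+1)\<close>, because no \<open>u + s\<close> is an exponent
  there. So the cocycle is not a coboundary modulo \<open>I^(k+1)\<close>.\<close>

lemma witness_regular_mod_length_le:
  fixes rs :: "('v, 'k::field) mpoly list"
  assumes w: "witness V E k cs u"
    and rs: "\<And>r. r \<in> set rs \<Longrightarrow> \<exists>f. (\<forall>v\<in>V. f v \<in> monomial_module V UNIV) \<and> r = (\<Sum>v\<in>V. f v * var v)"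
    and reg: "regular_mod (monomial_module V (edge_power E k)) (monomial_module V (edge_power E (Suc k))) rs"
  shows "length rs \<le> length cs"
proof (rule regular_mod_length_le[OF _ _ _ rs reg])
  let ?S = "monomial_module V UNIV :: ('v, 'k) mpoly set"
  let ?W = "monomial_module V (edge_power E k) :: ('v, 'k) mpoly set"
  let ?L = "monomial_module V (edge_power E (Suc k)) :: ('v, 'k) mpoly set"
  let ?z = "component_cochain cs u :: 'v list \<Rightarrow> ('v, 'k) mpoly"
  note w = w[unfolded witness_def]
  have entries: "witness_entry V E k u c" if "c \<in> set cs" for c using w that by blast
  show W: "submod ?S ?W" and "submod ?S ?L" by (rule submod_monomial_module[OF upset_edge_power])+
  show "var v \<in> ?S" if "v \<in> V" for v by (rule var_in_monomial_module[OF that])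
  show "?z vs \<in> ?W" if vs: "set vs \<subseteq> V" for vs
  proof -
    obtain f where f: "f \<in> ?S" "?z vs = f * Poly_Mapping.single u 1"
      using component_cochain_multiple[OF entries vs] by blast
    show ?thesis
      unfolding f(2) by (intro submodD(3)[OF W f(1)] single_in_monomial_module) (use w in auto)
  qed
  show "koszul var ?z vs \<in> ?L" if vs: "set vs \<subseteq> V" for vs
  proof -
    have "koszul (\<lambda>v. if v \<in> V then var v else 0) ?z vs \<in> ?L"
      by (rule koszul_component_cochain_in) (use w vs component_vertices_subset in blast)+
    also have "koszul (\<lambda>v. if v \<in> V then var v else 0) ?z vs = koszul var ?z vs"
      by (rule koszul_form_cong) (use vs in auto)
    finally show ?thesis .
  qed
  fix g assume g: "\<And>vs. set vs \<subseteq> V \<Longrightarrow> length vs = length cs \<Longrightarrow> ?z vs - koszul var g vs \<in> ?L"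
  have "component_cycle cs u (\<lambda>vs. ?z vs - koszul var g vs) = 0"
  proof (rule component_cycle_eq_0)
    fix vs s assume "set vs \<subseteq> V" "length vs = length cs" "s \<in> choices cs"
    then have "?z vs - koszul var g vs \<in> ?L" "u + s \<notin> edge_power E (Suc k)" using g w by blast+
    then have "u + s \<notin> Poly_Mapping.keys (?z vs - koszul var g vs)"
      unfolding monomial_module_def by blast
    then show "Poly_Mapping.lookup (?z vs - koszul var g vs) (u + s) = 0"
      by (simp add: in_keys_iff)
  next
    have "a \<in> V \<and> (B = {} \<or> b \<in> V)" if "(A, B, a, b) \<in> set cs" for A B a b
      using entries[OF that] by (auto simp: witness_entry_def split: if_splits)
    then show "\<forall>(A, B, a, b)\<in>set cs. a \<in> V \<and> (B = {} \<or> b \<in> V)" by blast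
  qed
  moreover have "component_cycle cs u ?z = 1"
    by (rule component_cycle_cochain) (use w in blast)+
  moreover have "component_cycle cs u (koszul var g) = 0"
    by (rule component_cycle_coboundary[OF entries])
      (use w in \<open>auto dest!: entries simp: witness_entry_def\<close>)
  ultimately show False by (simp add: component_cycle_diff)
qed

section \<open>Powers of edge ideals\<close>

lemma mpoly_ring_simps [simp]:
  "monoid.mult (mpoly_ring V) = (*)" "one (mpoly_ring V) = 1" "ring.zero (mpoly_ring V) = 0" "add (mpoly_ring V) = (+)"
  by (simp_all add: mpoly_ring_def)

lemma upset_UNIV [simp]: "upset UNIV"
  by (simp add: upset_def)

lemma one_in_monomial_module: "(1 :: ('v, 'k::field) mpoly) \<in> monomial_module V UNIV"
  by (simp add: monomial_module_def)

lemma submod_carrier: "submod (monomial_module V UNIV) (monomial_module V UNIV)"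
  by (rule submod_monomial_module) simp

lemma cring_mpoly_ring: "cring (mpoly_ring V)"
proof (rule cringI)
  note S = submodD[OF submod_carrier[of V]]
  show "abelian_group (mpoly_ring V)"
  proof (rule abelian_groupI)
    show "\<exists>y\<in>carrier (mpoly_ring V). y \<oplus>\<^bsub>mpoly_ring V\<^esub> x = \<zero>\<^bsub>mpoly_ring V\<^esub>"
      if "x \<in> carrier (mpoly_ring V)" for x
      using S(4)[of x] that by (intro bexI[of _ "- x"]) (auto simp: carrier_mpoly_ring)
  qed (auto simp: carrier_mpoly_ring intro: S ac_simps)
  show "comm_monoid (mpoly_ring V)"
    by (rule comm_monoidI) (auto simp: carrier_mpoly_ring one_in_monomial_module intro: S ac_simps)
qed (auto simp: algebra_simps)

lemma ideal_mpoly_ring: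
  fixes H :: "('v, 'k::field) mpoly set"
  assumes "submod (monomial_module V UNIV) H" "H \<subseteq> monomial_module V UNIV"
  shows "ideal H (mpoly_ring V)"
proof (rule idealI)
  let ?R = "mpoly_ring V :: ('v, 'k) mpoly ring"
  interpret cring ?R by (rule cring_mpoly_ring)
  note H = submodD[OF assms(1)]
  show "ring ?R" by (rule ring_axioms)
  show "subgroup H (add_monoid ?R)"
  proof (rule subgroup.intro)
    show "inv\<^bsub>add_monoid ?R\<^esub> a \<in> H" if "a \<in> H" for a
    proof -
      have "\<ominus>\<^bsub>?R\<^esub> a = - a"
        by (rule minus_equality) (use that assms(2) H(4) in \<open>auto simp: carrier_mpoly_ring\<close>)
      then show ?thesis using H(4)[OF that] by (simp add: a_inv_def)
    qed
    show "a \<otimes>\<^bsub>add_monoid ?R\<^esub> b \<in> H" if "a \<in> H" "b \<in> H" for a b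
      using H(5)[OF that] by simp
    show "H \<subseteq> carrier (add_monoid ?R)" using assms(2) by (simp add: carrier_mpoly_ring)
    show "\<one>\<^bsub>add_monoid ?R\<^esub> \<in> H" using H(1) by simp
  qed
  fix a x assume "a \<in> H" "x \<in> carrier ?R"
  then show "x \<otimes>\<^bsub>?R\<^esub> a \<in> H" "a \<otimes>\<^bsub>?R\<^esub> x \<in> H"
    using H(3)[of x a] by (simp_all add: carrier_mpoly_ring mult.commute[of a x])
qed

lemma monomial_module_subset: "T \<subseteq> T' \<Longrightarrow> monomial_module V T \<subseteq> monomial_module V T'"
  by (auto simp: monomial_module_def)

lemma mpoly_sum_monomials: "f = (\<Sum>t\<in>Poly_Mapping.keys f. Poly_Mapping.single t (Poly_Mapping.lookup f t))"
  by (rule poly_mapping_eqI) (auto simp: lookup_sum lookup_single when_def in_keys_iff)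

lemma monomial_module_closure:
  assumes "f \<in> monomial_module V T" "0 \<in> H" "\<And>f g. f \<in> H \<Longrightarrow> g \<in> H \<Longrightarrow> f + g \<in> H"
    and "\<And>t c. Poly_Mapping.keys t \<subseteq> V \<Longrightarrow> t \<in> T \<Longrightarrow> Poly_Mapping.single t c \<in> H"
  shows "f \<in> H"
proof -
  have "(\<Sum>t\<in>A. Poly_Mapping.single t (Poly_Mapping.lookup f t)) \<in> H" if "A \<subseteq> Poly_Mapping.keys f" for A
    using finite_subset[OF that finite_keys] that
  proof (induction A rule: finite_induct)
    case (insert t A)
    then show ?case using assms by (auto simp: monomial_module_def)
  qed (simp add: assms(2))
  then show ?thesis using mpoly_sum_monomials[of f] by (metis order_refl)
qed

lemma edge_power_SucE:
  assumes "t \<in> edge_power E (Suc k)" "\<And>e. e \<in> E \<Longrightarrow> card e = 2"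
  obtains i j s where "{i, j} \<in> E" "s \<in> edge_power E k"
    "t = (Poly_Mapping.single i 1 + Poly_Mapping.single j 1) + s"
proof -
  obtain M where M: "set_mset M \<subseteq> E" "size M = Suc k" "\<And>v. mdeg M v \<le> Poly_Mapping.lookup t v"
    using edge_powerE[OF assms(1)] by blast
  obtain e N where N: "M = add_mset e N" using M(2) by (metis size_eq_Suc_imp_eq_union)
  have "card e = 2" using assms(2) M(1) N by simp
  then obtain i j where ij: "e = {i, j}" "i \<noteq> j" by (meson card_2_iff)
  let ?e = "Poly_Mapping.single i 1 + Poly_Mapping.single j (1::nat)"
  have e: "Poly_Mapping.lookup ?e v = (if v \<in> e then 1 else 0)" for v
    using ij by (auto simp: lookup_add lookup_single when_def)
  \<comment> \<open>Subtraction of exponents truncates at 0; this inequality ensures that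
    \<open>t - ?e\<close> loses nothing.\<close>
  have le: "Poly_Mapping.lookup ?e v + mdeg N v \<le> Poly_Mapping.lookup t v" for v
    unfolding e using M(3)[of v] N by simp
  show thesis
  proof (rule that)
    show "{i, j} \<in> E" using M(1) N ij by simp
    show "t - ?e \<in> edge_power E k"
    proof (rule edge_powerI)
      show "mdeg N v \<le> Poly_Mapping.lookup (t - ?e) v" for v
        unfolding lookup_minus using le[of v] by linarith
    qed (use M N in auto)
    show "t = ?e + (t - ?e)"
    proof (rule poly_mapping_eqI)
      show "Poly_Mapping.lookup t v = Poly_Mapping.lookup (?e + (t - ?e)) v" for v
        unfolding lookup_add[of ?e "t - ?e"] lookup_minus using le[of v] by linarith
    qed
  qed
qed

lemma edge_monomial:
  "var i * var j = (Poly_Mapping.single (Poly_Mapping.single i 1 + Poly_Mapping.single j 1) 1 :: ('v, 'k::field) mpoly)"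
  by (simp add: var_def mult_single)

lemma monomial_module_mult_edge_power:
  assumes "f \<in> monomial_module V (edge_power E j)" "g \<in> monomial_module V (edge_power E k)"
  shows "f * g \<in> monomial_module V (edge_power E (j + k))"
  unfolding monomial_module_def
proof (intro CollectI ballI)
  fix t assume "t \<in> Poly_Mapping.keys (f * g)"
  then obtain r s where "t = r + s" "r \<in> Poly_Mapping.keys f" "s \<in> Poly_Mapping.keys g"
    using keys_mult[of f g] by auto
  then show "Poly_Mapping.keys t \<subseteq> V \<and> t \<in> edge_power E (j + k)"
    using assms edge_power_add[of r E j s k] by (auto simp: monomial_module_def keys_add_nat)
qed

lemma ideal_monomial_module: "ideal (monomial_module V (edge_power E k)) (mpoly_ring V)"
  by (intro ideal_mpoly_ring submod_monomial_module upset_edge_power monomial_module_subset) simp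

lemma edge_ideal_eq:
  assumes "simple_graph V E"
  shows "(edge_ideal V E :: ('v, 'k::field) mpoly set) = monomial_module V (edge_power E 1)"
proof
  interpret cring "mpoly_ring V :: ('v, 'k) mpoly ring" by (rule cring_mpoly_ring)
  have E: "e \<subseteq> V" "card e = 2" if "e \<in> E" for e using assms that by (auto simp: simple_graph_def)
  let ?G = "{var i * var j | i j. {i, j} \<in> E} :: ('v, 'k) mpoly set"
  have G: "?G \<subseteq> monomial_module V (edge_power E 1)"
  proof clarify
    fix i j assume ij: "{i, j} \<in> E"
    show "var i * var j \<in> (monomial_module V (edge_power E 1) :: ('v, 'k) mpoly set)"
      unfolding edge_monomial
      by (intro single_in_monomial_module edge_in_edge_power ij) (use E(1)[OF ij] in \<open>auto simp: keys_add_nat\<close>)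
  qed
  show "edge_ideal V E \<subseteq> (monomial_module V (edge_power E 1) :: ('v, 'k) mpoly set)"
    unfolding edge_ideal_def by (rule genideal_minimal[OF ideal_monomial_module G])
  have "?G \<subseteq> carrier (mpoly_ring V)"
    using G monomial_module_subset[of "edge_power E 1" UNIV V] unfolding carrier_mpoly_ring by blast
  then interpret I: ideal "edge_ideal V E :: ('v, 'k) mpoly set" "mpoly_ring V"
    unfolding edge_ideal_def by (rule genideal_ideal)
  have gen: "var i * var j \<in> (edge_ideal V E :: ('v, 'k) mpoly set)" if "{i, j} \<in> E" for i j
    using genideal_self[OF \<open>?G \<subseteq> carrier (mpoly_ring V)\<close>] that unfolding edge_ideal_def by blast
  show "(monomial_module V (edge_power E 1) :: ('v, 'k) mpoly set) \<subseteq> edge_ideal V E"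
  proof
    fix f :: "('v, 'k) mpoly" assume "f \<in> monomial_module V (edge_power E 1)"
    then show "f \<in> edge_ideal V E"
    proof (rule monomial_module_closure)
      show "0 \<in> (edge_ideal V E :: ('v, 'k) mpoly set)" using I.zero_closed by simp
      show "f + g \<in> edge_ideal V E" if "f \<in> edge_ideal V E" "g \<in> edge_ideal V E" for f g :: "('v, 'k) mpoly"
        using I.a_closed[OF that] by simp
      fix t c assume t: "Poly_Mapping.keys t \<subseteq> V" "t \<in> edge_power E 1"
      obtain i j s where ijs: "{i, j} \<in> E" "t = (Poly_Mapping.single i 1 + Poly_Mapping.single j 1) + s"
        using edge_power_SucE[of t E 0] t(2) E(2) by auto
      have "Poly_Mapping.single s c * (var i * var j) \<in> (edge_ideal V E :: ('v, 'k) mpoly set)"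
        using I.I_l_closed[OF gen[OF ijs(1)], of "Poly_Mapping.single s c"] t(1)
        unfolding ijs(2) carrier_mpoly_ring keys_add_nat by (auto intro: single_in_monomial_module)
      then show "Poly_Mapping.single t c \<in> edge_ideal V E"
        unfolding edge_monomial ijs(2) by (simp add: mult_single add.commute)
    qed
  qed
qed

lemma edge_ideal_power_eq:
  assumes "simple_graph V E"
  shows "(ideal_power (mpoly_ring V) (edge_ideal V E) k :: ('v, 'k::field) mpoly set) =
    monomial_module V (edge_power E k)"
proof (induction k)
  case 0
  have "edge_power E 0 = UNIV" by auto
  then show ?case by (simp add: ideal_power_def nat_pow_def ideals_set_def carrier_mpoly_ring)
next
  case (Suc k)
  have E: "e \<subseteq> V" "card e = 2" if "e \<in> E" for e using assms that by (auto simp: simple_graph_def)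
  let ?I = "\<lambda>k. monomial_module V (edge_power E k) :: ('v, 'k) mpoly set"
  have "ideal_power (mpoly_ring V) (edge_ideal V E) (Suc k) = ideal_prod (mpoly_ring V) (?I k) (?I 1)"
    using Suc unfolding edge_ideal_eq[OF assms]
    by (simp add: ideal_power_def nat_pow_def ideals_set_def)
  also have "\<dots> = ?I (Suc k)"
  proof
    show "ideal_prod (mpoly_ring V) (?I k) (?I 1) \<subseteq> ?I (Suc k)"
    proof
      fix f assume "f \<in> ideal_prod (mpoly_ring V) (?I k) (?I 1)"
      then show "f \<in> ?I (Suc k)"
        by (induction rule: ideal_prod.induct)
          (use monomial_module_mult_edge_power[of _ V E k _ 1] in \<open>auto intro: monomial_module_add\<close>)
    qed
    show "?I (Suc k) \<subseteq> ideal_prod (mpoly_ring V) (?I k) (?I 1)"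
    proof
      fix f assume "f \<in> ?I (Suc k)"
      then show "f \<in> ideal_prod (mpoly_ring V) (?I k) (?I 1)"
      proof (rule monomial_module_closure)
        show "0 \<in> ideal_prod (mpoly_ring V) (?I k) (?I 1)"
          using ideal_prod.prod[of 0 "?I k" 0 "?I 1" "mpoly_ring V"] by simp
        show "f + g \<in> ideal_prod (mpoly_ring V) (?I k) (?I 1)"
          if "f \<in> ideal_prod (mpoly_ring V) (?I k) (?I 1)" "g \<in> ideal_prod (mpoly_ring V) (?I k) (?I 1)" for f g
          using ideal_prod.sum[OF that] by simp
        fix t c assume t: "Poly_Mapping.keys t \<subseteq> V" "t \<in> edge_power E (Suc k)"
        obtain i j s where ijs: "{i, j} \<in> E" "s \<in> edge_power E k"
          "t = (Poly_Mapping.single i 1 + Poly_Mapping.single j 1) + s"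
          using edge_power_SucE[OF t(2) E(2)] by metis
        have "Poly_Mapping.single s c \<in> ?I k"
          by (rule single_in_monomial_module) (use t(1) ijs in \<open>auto simp: keys_add_nat\<close>)
        moreover have "var i * var j \<in> ?I 1"
          unfolding edge_monomial
          by (intro single_in_monomial_module edge_in_edge_power ijs)
            (use t(1) in \<open>auto simp: ijs(3) keys_add_nat\<close>)
        ultimately have "Poly_Mapping.single s c * (var i * var j) \<in> ideal_prod (mpoly_ring V) (?I k) (?I 1)"
          using ideal_prod.prod[of "Poly_Mapping.single s c" "?I k" "var i * var j" "?I 1" "mpoly_ring V"] by simp
        then show "Poly_Mapping.single t c \<in> ideal_prod (mpoly_ring V) (?I k) (?I 1)"
          unfolding edge_monomial ijs(3) by (simp add: mult_single add.commute)
      qed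
    qed
  qed
  finally show ?case .
qed

text \<open>The coefficients \<open>f\<close> form the vector with which the Koszul homotopy
  contracts.\<close>

lemma irrelevant_ideal_sum:
  fixes r :: "('v, 'k::field) mpoly"
  assumes "finite V" "r \<in> irrelevant_ideal V"
  shows "\<exists>f. (\<forall>v\<in>V. f v \<in> monomial_module V UNIV) \<and> r = (\<Sum>v\<in>V. f v * var v)"
proof -
  interpret cring "mpoly_ring V :: ('v, 'k) mpoly ring" by (rule cring_mpoly_ring)
  let ?S = "monomial_module V UNIV :: ('v, 'k) mpoly set"
  note S = submodD[OF submod_carrier[of V]]
  define H where "H = {r :: ('v, 'k) mpoly. \<exists>f. (\<forall>v\<in>V. f v \<in> ?S) \<and> r = (\<Sum>v\<in>V. f v * var v)}"
  have "submod ?S H"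
    unfolding submod_def
  proof (intro conjI ballI)
    show "0 \<in> H" unfolding H_def by (intro CollectI exI[of _ "\<lambda>_. 0"]) simp
    show "f - g \<in> H" if fg: "f \<in> H" "g \<in> H" for f g
    proof -
      obtain f' g' where "\<forall>v\<in>V. f' v \<in> ?S" "f = (\<Sum>v\<in>V. f' v * var v)"
        "\<forall>v\<in>V. g' v \<in> ?S" "g = (\<Sum>v\<in>V. g' v * var v)" using fg by (auto simp: H_def)
      then show ?thesis
        unfolding H_def by (intro CollectI exI[of _ "\<lambda>v. f' v - g' v"])
          (auto simp: sum_subtractf left_diff_distrib intro: S)
    qed
    show "a * f \<in> H" if af: "a \<in> ?S" "f \<in> H" for a f
    proof -
      obtain f' where "\<forall>v\<in>V. f' v \<in> ?S" "f = (\<Sum>v\<in>V. f' v * var v)" using af by (auto simp: H_def)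
      then show ?thesis
        unfolding H_def using af(1)
        by (intro CollectI exI[of _ "\<lambda>v. a * f' v"]) (auto simp: sum_distrib_left mult.assoc intro: S)
    qed
  qed
  moreover have "H \<subseteq> ?S"
    unfolding H_def by (auto intro!: submod_sum[OF submod_carrier] S(3) var_in_monomial_module)
  ultimately have "ideal H (mpoly_ring V)" by (rule ideal_mpoly_ring)
  moreover have "var ` V \<subseteq> H"
  proof
    fix r assume "r \<in> (var ` V :: ('v, 'k) mpoly set)"
    then obtain w where w: "w \<in> V" "r = var w" by blast
    have "r = (\<Sum>v\<in>V. if v = w then var v else 0)" using assms(1) w by simp
    also have "\<dots> = (\<Sum>v\<in>V. (if v = w then 1 else 0) * var v)" by (intro sum.cong) auto
    finally have "r = (\<Sum>v\<in>V. (if v = w then 1 else 0) * var v)" .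
    then show "r \<in> H"
      unfolding H_def by (intro CollectI exI[of _ "\<lambda>v. if v = w then 1 else 0"]) (auto simp: one_in_monomial_module)
  qed
  ultimately have "irrelevant_ideal V \<subseteq> H" unfolding irrelevant_ideal_def by (rule genideal_minimal)
  then show ?thesis using assms(2) by (auto simp: H_def)
qed

section \<open>Depth and Stanley depth of quotients of monomial ideals\<close>

text \<open>The coset is written without a ring record, so that the quotient module and its grading
  share it.\<close>

definition coset :: "'r::comm_ring_1 set \<Rightarrow> 'r \<Rightarrow> 'r set" where
  "coset L w = (\<lambda>l. l + w) ` L"

lemma coset_eq_iff:
  assumes "submod A L"
  shows "coset L w = coset L w' \<longleftrightarrow> w - w' \<in> L"
proof
  assume eq: "coset L w = coset L w'"
  have "w \<in> coset L w" unfolding coset_def by (rule image_eqI[of _ _ 0]) (simp_all add: submodD(1)[OF assms])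
  then have "w \<in> coset L w'" using eq by simp
  then show "w - w' \<in> L" by (auto simp: coset_def)
next
  have *: "coset L w \<subseteq> coset L w'" if "w - w' \<in> L" for w w'
    unfolding coset_def
  proof clarify
    fix l assume "l \<in> L"
    then have "l + (w - w') \<in> L" using submodD(5)[OF assms] that by blast
    then show "l + w \<in> (\<lambda>l. l + w') ` L" by (rule rev_image_eqI) simp
  qed
  assume "w - w' \<in> L"
  then show "coset L w = coset L w'"
    using *[of w w'] *[of w' w] submodD(4)[OF assms, of "w - w'"] by auto
qed

lemma coset_add:
  assumes "submod A L"
  shows "(\<Union>x\<in>coset L w. \<Union>y\<in>coset L w'. {x + y}) = coset L (w + w')"
proof (intro Set.set_eqI iffI)
  fix z assume "z \<in> (\<Union>x\<in>coset L w. \<Union>y\<in>coset L w'. {x + y})"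
  then obtain l l' where "l \<in> L" "l' \<in> L" "z = (l + w) + (l' + w')" by (auto simp: coset_def)
  then show "z \<in> coset L (w + w')"
    unfolding coset_def using submodD(5)[OF assms, of l l']
    by (intro image_eqI[of _ _ "l + l'"]) (simp_all add: ac_simps)
next
  fix z assume "z \<in> coset L (w + w')"
  then obtain l where l: "l \<in> L" "z = (l + w) + (0 + w')" by (auto simp: coset_def ac_simps)
  then have "l + w \<in> coset L w" "0 + w' \<in> coset L w'"
    using submodD(1)[OF assms] unfolding coset_def by blast+
  then show "z \<in> (\<Union>x\<in>coset L w. \<Union>y\<in>coset L w'. {x + y})" using l(2) by blast
qed

lemma coset_smult:
  assumes "submod A L" "r \<in> A"
  shows "(\<Union>x\<in>coset L w. coset L (r * x)) = coset L (r * w)"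
proof -
  have "coset L (r * x) = coset L (r * w)" if "x \<in> coset L w" for x
  proof -
    obtain l where "l \<in> L" "x = l + w" using \<open>x \<in> coset L w\<close> by (auto simp: coset_def)
    then have "r * x - r * w \<in> L" using submodD(3)[OF assms, of l] by (simp add: algebra_simps)
    then show ?thesis using coset_eq_iff[OF assms(1)] by blast
  qed
  moreover have "coset L w \<noteq> {}" using submodD(1)[OF assms(1)] by (auto simp: coset_def)
  ultimately show ?thesis by auto
qed

lemma a_r_coset_eq: "add M = (+) \<Longrightarrow> a_r_coset M L w = coset L w"
  unfolding a_r_coset_def' coset_def by auto

section \<open>Depth of a quotient of monomial ideals\<close>

text \<open>The argument \<open>k\<close> fixes the coefficient field, which the sets of exponents
  do not determine.\<close>

locale monomial_quotient =
  fixes V :: "'v set" and T U :: "('v \<Rightarrow>\<^sub>0 nat) set" and k :: "'k::field itself"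
  assumes upset_T: "upset T" and upset_U: "upset U" and UT: "U \<subseteq> T"
begin

abbreviation S :: "('v, 'k) mpoly set" where "S \<equiv> monomial_module V UNIV"
abbreviation W :: "('v, 'k) mpoly set" where "W \<equiv> monomial_module V T"
abbreviation L :: "('v, 'k) mpoly set" where "L \<equiv> monomial_module V U"
abbreviation R :: "('v, 'k) mpoly ring" where "R \<equiv> mpoly_ring V"
abbreviation M :: "(('v, 'k) mpoly, ('v, 'k) mpoly set) module" where "M \<equiv> ideal_quot R W L"

lemma W: "submod S W" and L: "submod S L" and LW: "L \<subseteq> W"
  by (simp_all add: submod_monomial_module upset_T upset_U monomial_module_subset UT)

lemma carrier_M: "carrier M = coset L ` W"
proof -
  have "a_r_coset (ideal_module R W) L w = coset L w" for w
    by (rule a_r_coset_eq) (simp add: ideal_module_def)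
  then show ?thesis
    by (auto simp: ideal_quot_def quot_module_def A_RCOSETS_def' ideal_module_def)
qed

lemma zero_M: "\<zero>\<^bsub>M\<^esub> = coset L 0"
  by (simp add: ideal_quot_def quot_module_def coset_def)

lemma add_M: "coset L w \<oplus>\<^bsub>M\<^esub> coset L w' = coset L (w + w')"
  using coset_add[OF L, where w = w and w' = w']
  by (simp add: ideal_quot_def quot_module_def ideal_module_def set_add_def set_mult_def)

lemma smult_M:
  assumes "r \<in> S"
  shows "r \<odot>\<^bsub>M\<^esub> coset L w = coset L (r * w)"
proof -
  have "a_r_coset (ideal_module R W) L w = coset L w" for w
    by (rule a_r_coset_eq) (simp add: ideal_module_def)
  then show ?thesis
    using coset_smult[OF L assms, of w] by (simp add: ideal_quot_def quot_module_def ideal_module_def)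
qed

lemma carrier_M_trivial_iff: "carrier M = {\<zero>\<^bsub>M\<^esub>} \<longleftrightarrow> W \<subseteq> L"
proof
  assume *: "carrier M = {\<zero>\<^bsub>M\<^esub>}"
  show "W \<subseteq> L"
  proof
    fix w assume "w \<in> W"
    then have "coset L w = coset L 0" using * unfolding carrier_M zero_M by blast
    then show "w \<in> L" using coset_eq_iff[OF L, of w 0] by simp
  qed
next
  assume "W \<subseteq> L"
  then have "coset L w = coset L 0" if "w \<in> W" for w using coset_eq_iff[OF L, of w 0] that by auto
  moreover have "0 \<in> W" by simp
  ultimately show "carrier M = {\<zero>\<^bsub>M\<^esub>}" unfolding carrier_M zero_M by blast
qed

lemma seq_submodule_M:
  assumes "set rs \<subseteq> S"
  shows "seq_submodule M rs = coset L ` foldr (\<lambda>r Y. adjoin r W Y) rs L"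
  using assms
proof (induction rs)
  case Nil
  have "coset L l = coset L 0" if "l \<in> L" for l using coset_eq_iff[OF L, of l 0] that by simp
  moreover have "0 \<in> L" by simp
  ultimately show ?case unfolding seq_submodule.simps zero_M foldr.simps id_apply by blast
next
  case (Cons r rs)
  let ?Y = "foldr (\<lambda>r Y. adjoin r W Y) rs L"
  have "seq_submodule M (r # rs) = (\<Union>x\<in>(\<lambda>w. coset L (r * w)) ` W. \<Union>y\<in>coset L ` ?Y. {x \<oplus>\<^bsub>M\<^esub> y})"
    using Cons by (simp add: set_add_def set_mult_def carrier_M image_image smult_M)
  also have "\<dots> = coset L ` adjoin r W ?Y"
    by (auto simp: add_M adjoin_def)
  finally show ?case by simp
qed

lemma depth_le:
  assumes bound: "\<And>rs. set rs \<subseteq> irrelevant_ideal V \<Longrightarrow> regular_mod W L rs \<Longrightarrow> length rs \<le> p"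
    and "\<not> W \<subseteq> L"
  shows "depth (irrelevant_ideal V) M \<le> enat p"
proof -
  have "length rs \<le> p" if rs: "set rs \<subseteq> irrelevant_ideal V" "regular_sequence M rs" for rs
  proof (rule bound[OF rs(1)])
    have rsS: "set rs \<subseteq> S"
    proof -
      interpret cring R by (rule cring_mpoly_ring)
      have "ideal (irrelevant_ideal V) R"
        unfolding irrelevant_ideal_def
        by (rule genideal_ideal) (auto simp: carrier_mpoly_ring intro: var_in_monomial_module)
      then have "irrelevant_ideal V \<subseteq> carrier R" by (meson ideal.Icarr subsetI)
      then show ?thesis using rs(1) by (simp add: carrier_mpoly_ring)
    qed
    let ?F = "\<lambda>rs L. foldr (\<lambda>r Y. adjoin r W Y) rs L"
    \<comment> \<open>\<open>seq_submodule\<close> adjoins the first element of a sequence last,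
      \<open>regular_mod\<close> adjoins it first; the two orders have to be reconciled.\<close>
    have commute: "adjoin r W (adjoin s W Y) \<subseteq> adjoin s W (adjoin r W Y)" for r s and Y :: "('v, 'k) mpoly set"
    proof
      fix f assume "f \<in> adjoin r W (adjoin s W Y)"
      then obtain w w' l where "w \<in> W" "w' \<in> W" "l \<in> Y" "f = s * w' + (r * w + l)"
        by (auto simp: adjoin_def ac_simps)
      then show "f \<in> adjoin s W (adjoin r W Y)" unfolding adjoin_def by blast
    qed
    then have "adjoin r W (adjoin s W Y) = adjoin s W (adjoin r W Y)" for r s and Y :: "('v, 'k) mpoly set"
      by blast
    then have fusion: "?F rs (adjoin r W Y) = adjoin r W (?F rs Y)" for r rs Y
      by (induction rs) auto
    have reg: "regular_mod W Y rs"
      if "\<And>i w. i < length rs \<Longrightarrow> w \<in> W \<Longrightarrow> rs ! i * w \<in> ?F (take i rs) Y \<Longrightarrow> w \<in> ?F (take i rs) Y" for rs Y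
      using that
    proof (induction rs arbitrary: Y)
      case (Cons r rs)
      have "regular_mod W (adjoin r W Y) rs"
      proof (rule Cons.IH)
        fix i w assume "i < length rs" "w \<in> W" "rs ! i * w \<in> ?F (take i rs) (adjoin r W Y)"
        then show "w \<in> ?F (take i rs) (adjoin r W Y)"
          using Cons.prems[of "Suc i" w] by (simp add: fusion)
      qed
      moreover have "w \<in> Y" if "w \<in> W" "r * w \<in> Y" for w using Cons.prems[of 0 w] that by simp
      ultimately show ?case by simp
    qed simp
    show "regular_mod W L rs"
    proof (rule reg)
      fix i w assume i: "i < length rs" and w: "w \<in> W" and rw: "rs ! i * w \<in> ?F (take i rs) L"
      have sub: "set (take i rs) \<subseteq> S" using rsS set_take_subset[of i rs] by blast
      note seq = seq_submodule_M[OF sub]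
      have "rs ! i \<in> S" using i rsS by auto
      then have "rs ! i \<odot>\<^bsub>M\<^esub> coset L w \<in> seq_submodule M (take i rs)"
        using rw by (simp add: smult_M seq)
      moreover have "coset L w \<in> carrier M" using w by (simp add: carrier_M)
      ultimately have "coset L w \<in> coset L ` ?F (take i rs) L"
        using rs(2) i unfolding regular_sequence_def seq[symmetric] by blast
      then obtain w' where w': "w' \<in> ?F (take i rs) L" "w - w' \<in> L"
        using coset_eq_iff[OF L] by blast
      \<comment> \<open>The lifted submodule contains \<open>L\<close>, so one representative of a
        coset lies in it iff all do.\<close>
      have F: "submod S (?F rs L) \<and> L \<subseteq> ?F rs L" for rs
      proof (induction rs)
        case (Cons r rs)
        have "?F rs L \<subseteq> adjoin r W (?F rs L)"
        proof
          fix l assume "l \<in> ?F rs L"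
          then have "r * 0 + l \<in> adjoin r W (?F rs L)"
            unfolding adjoin_def by (intro CollectI exI[of _ 0] exI[of _ l]) simp
          then show "l \<in> adjoin r W (?F rs L)" by simp
        qed
        then show ?case using Cons submod_adjoin[OF W, of "?F rs L"] by auto
      qed (simp add: L)
      have "w' + (w - w') \<in> ?F (take i rs) L"
        by (rule submodD(5)[of S]) (use F w' in blast)+
      then show "w \<in> ?F (take i rs) L" by simp
    qed
  qed
  then show ?thesis
    unfolding depth_def carrier_M_trivial_iff using assms(2) by (auto intro!: Sup_least)
qed

end

section \<open>Stanley decompositions of the quotient\<close>

lemma restr_in_monomial_module: "f \<in> monomial_module V T \<Longrightarrow> restr A f \<in> monomial_module V (T \<inter> A)"
  by (auto simp: monomial_module_def keys_restr)

lemma monomial_module_cylinder: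
  fixes g :: "('v, 'k::field) mpoly"
  assumes "g \<in> monomial_module V (cylinder (u, Z))"
  shows "\<exists>f\<in>monomial_module Z UNIV. g = f * Poly_Mapping.single u 1"
proof -
  let ?H = "(\<lambda>f. f * Poly_Mapping.single u 1) ` monomial_module Z UNIV :: ('v, 'k) mpoly set"
  have "g \<in> ?H"
    using assms
  proof (rule monomial_module_closure)
    show "0 \<in> ?H" by (rule image_eqI[of _ _ 0]) simp_all
    show "f + g \<in> ?H" if "f \<in> ?H" "g \<in> ?H" for f g
      by (rule submodD(5)[OF submod_multiples[OF submod_carrier] that])
    fix t c assume "t \<in> cylinder (u, Z)"
    then obtain s where s: "t = u + s" "Poly_Mapping.keys s \<subseteq> Z" by (auto simp: cylinder_def)
    show "Poly_Mapping.single t c \<in> ?H"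
      by (rule image_eqI[of _ _ "Poly_Mapping.single s c"])
        (simp_all add: s mult_single add.commute single_in_monomial_module)
  qed
  then show ?thesis by blast
qed

lemma mult_monomial_in_cylinder:
  fixes f :: "('v, 'k::field) mpoly"
  assumes "f \<in> monomial_module Z UNIV" "Poly_Mapping.keys u \<subseteq> V" "Z \<subseteq> V"
  shows "f * Poly_Mapping.single u 1 \<in> monomial_module V (cylinder (u, Z))"
  unfolding monomial_module_def
proof (intro CollectI ballI)
  fix t assume "t \<in> Poly_Mapping.keys (f * Poly_Mapping.single u 1)"
  then obtain r where r: "t = u + r" "r \<in> Poly_Mapping.keys f"
    using keys_mult[of f "Poly_Mapping.single u 1"] by (auto simp: add.commute)
  then have "Poly_Mapping.keys r \<subseteq> Z" using assms(1) by (auto simp: monomial_module_def)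
  then have "t \<in> cylinder (u, Z)" using r(1) by (auto simp: cylinder_def)
  then show "Poly_Mapping.keys t \<subseteq> V \<and> t \<in> cylinder (u, Z)" using keys_cylinder assms(2,3) by blast
qed

lemma monomial_mult_eq_0:
  fixes f :: "('v, 'k::field) mpoly"
  assumes "f * Poly_Mapping.single u 1 = 0"
  shows "f = 0"
proof (rule poly_mapping_eqI)
  show "Poly_Mapping.lookup f m = Poly_Mapping.lookup 0 m" for m
    using lookup_monomial_mult[of u f m] assms by (simp add: mult.commute)
qed

lemma monomial_module_disjoint:
  "f \<in> monomial_module V T \<Longrightarrow> f \<in> monomial_module V T' \<Longrightarrow> T \<inter> T' = {} \<Longrightarrow> f = 0"
proof -
  assume "f \<in> monomial_module V T" "f \<in> monomial_module V T'" "T \<inter> T' = {}"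
  then have "Poly_Mapping.keys f = {}" unfolding monomial_module_def by blast
  then show "f = 0" by simp
qed

lemma carrier_update_self: "N\<lparr>carrier := carrier N\<rparr> = N"
  by simp

context monomial_quotient
begin

abbreviation M_on :: "('v, 'k) mpoly set \<Rightarrow> (('v, 'k) mpoly, ('v, 'k) mpoly set) module" where
  "M_on P \<equiv> M\<lparr>carrier := coset L ` P\<rparr>"

lemma M_on_W: "M_on W = M"
  unfolding carrier_M[symmetric] by (rule carrier_update_self)

lemma abelian_group_M_on:
  assumes "submod A P"
  shows "abelian_group (M_on P)"
proof (rule abelian_groupI)
  note P = submodD[OF assms]
  show "\<exists>y\<in>carrier (M_on P). y \<oplus>\<^bsub>M_on P\<^esub> x = \<zero>\<^bsub>M_on P\<^esub>" if x: "x \<in> carrier (M_on P)" for x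
  proof -
    obtain w where w: "w \<in> P" "x = coset L w" using x by auto
    show ?thesis
      by (rule bexI[of _ "coset L (- w)"]) (use P(4) w in \<open>auto simp: add_M zero_M\<close>)
  qed
qed (use submodD[OF assms] in \<open>auto simp: add_M zero_M ac_simps\<close>)

lemma finsum_M_on:
  assumes "submod A P" "finite I" "\<And>p. p \<in> I \<Longrightarrow> g p \<in> P"
  shows "finsum (M_on P) (\<lambda>p. coset L (g p)) I = coset L (\<Sum>p\<in>I. g p)"
proof -
  interpret abelian_group "M_on P" by (rule abelian_group_M_on[OF assms(1)])
  show ?thesis
    using assms(2,3)
  proof (induction I rule: finite_induct)
    case empty
    show ?case by (simp add: zero_M)
  next
    case (insert p I)
    have "finsum (M_on P) (\<lambda>p. coset L (g p)) (insert p I) =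
        coset L (g p) \<oplus>\<^bsub>M_on P\<^esub> finsum (M_on P) (\<lambda>p. coset L (g p)) I"
      by (rule finsum_insert) (use insert in auto)
    then show ?case using insert by (simp add: add_M)
  qed
qed

lemma module_M_on:
  assumes "submod (monomial_module Z UNIV) P" "Z \<subseteq> V"
  shows "module (mpoly_ring Z) (M_on P)"
proof -
  have ZS: "monomial_module Z UNIV \<subseteq> S" using assms(2) by (auto simp: monomial_module_def)
  have sm: "r \<odot>\<^bsub>M\<^esub> coset L w = coset L (r * w)" if "r \<in> monomial_module Z UNIV" for r w
    using ZS that by (intro smult_M) blast
  have SZ: "submod (monomial_module Z UNIV) (monomial_module Z UNIV :: ('v, 'k) mpoly set)"
    "(1 :: ('v, 'k) mpoly) \<in> monomial_module Z UNIV"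
    by (rule submod_carrier, rule one_in_monomial_module)
  show ?thesis
  proof (rule moduleI)
    show "cring (mpoly_ring Z :: ('v, 'k) mpoly ring)" by (rule cring_mpoly_ring)
    show "abelian_group (M_on P)" by (rule abelian_group_M_on[OF assms(1)])
  qed (use submodD[OF assms(1)] submodD[OF SZ(1)] SZ(2) in
      \<open>auto simp: carrier_mpoly_ring sm add_M algebra_simps\<close>)
qed

lemma cyclic_space_eq:
  assumes "Z \<subseteq> V"
  shows "cyclic_space M (coset L w) Z = coset L ` (\<lambda>f. f * w) ` monomial_module Z UNIV"
proof -
  have "f \<odot>\<^bsub>M\<^esub> coset L w = coset L (f * w)" if "f \<in> monomial_module Z UNIV" for f
    using that assms by (intro smult_M) (auto simp: monomial_module_def)
  then show ?thesis unfolding cyclic_space_def carrier_mpoly_ring image_image by (rule image_cong[OF refl])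
qed

lemma cyclic_space_monomial:
  assumes "Z \<subseteq> V" "Poly_Mapping.keys u \<subseteq> V"
  shows "cyclic_space M (coset L (Poly_Mapping.single u 1)) Z = coset L ` monomial_module V (cylinder (u, Z))"
proof -
  have "(\<lambda>f. f * Poly_Mapping.single u 1) ` monomial_module Z UNIV =
      (monomial_module V (cylinder (u, Z)) :: ('v, 'k) mpoly set)"
    using monomial_module_cylinder[of _ V u Z] mult_monomial_in_cylinder[of _ Z u V] assms by blast
  then show ?thesis unfolding cyclic_space_eq[OF assms(1)] by simp
qed

text \<open>The multiples of the monomial of \<open>u\<close> by polynomials in \<open>Z\<close>
  have exponents in the cylinder, which misses \<open>U\<close>. So none but 0 lies in
  \<open>L\<close>, and the coset of the monomial is a basis.\<close>

lemma free_module_cyclic_space: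
  assumes Z: "Z \<subseteq> V" "Poly_Mapping.keys u \<subseteq> V" and disj: "cylinder (u, Z) \<inter> U = {}"
  shows "free_module (mpoly_ring Z) (M\<lparr>carrier := cyclic_space M (coset L (Poly_Mapping.single u 1)) Z\<rparr>)"
proof -
  define m where "m = (Poly_Mapping.single u 1 :: ('v, 'k) mpoly)"
  define P where "P = (\<lambda>f. f * m) ` (monomial_module Z UNIV :: ('v, 'k) mpoly set)"
  have SZ: "submod (monomial_module Z UNIV) (monomial_module Z UNIV :: ('v, 'k) mpoly set)"
    by (rule submod_carrier)
  have P: "submod (monomial_module Z UNIV) P"
    unfolding P_def by (rule submod_multiples[OF submod_carrier])
  have eq: "M\<lparr>carrier := cyclic_space M (coset L m) Z\<rparr> = M_on P"
    unfolding cyclic_space_eq[OF Z(1)] P_def ..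
  have sm: "f \<odot>\<^bsub>M_on P\<^esub> coset L m = coset L (f * m)" if "f \<in> monomial_module Z UNIV" for f
    using that Z(1) smult_M[of f m] by (auto simp: monomial_module_def)
  have inj: "f = g" if "f \<in> monomial_module Z UNIV" "g \<in> monomial_module Z UNIV"
    "coset L (f * m) = coset L (g * m)" for f g
  proof -
    have "(f - g) * m \<in> L" using that(3) unfolding coset_eq_iff[OF L] by (simp add: left_diff_distrib)
    moreover have "(f - g) * m \<in> monomial_module V (cylinder (u, Z))"
      unfolding m_def by (rule mult_monomial_in_cylinder[OF submodD(2)[OF SZ that(1,2)] Z(2,1)])
    ultimately have "(f - g) * m = 0" using disj monomial_module_disjoint by blast
    then show ?thesis using monomial_mult_eq_0[of "f - g" u] by (simp add: m_def)
  qed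
  have mP: "m \<in> P" unfolding P_def by (rule image_eqI[of _ _ 1]) (simp_all add: one_in_monomial_module)
  interpret abelian_group "M_on P" by (rule abelian_group_M_on[OF P])
  have lincomb: "(\<Oplus>\<^bsub>M_on P\<^esub>b\<in>{b. c b \<noteq> 0}. c b \<odot>\<^bsub>M_on P\<^esub> b) = coset L (c (coset L m) * m)"
    if c: "{b. c b \<noteq> 0} \<subseteq> {coset L m}" "c (coset L m) \<in> monomial_module Z UNIV" for c
  proof (cases "c (coset L m) = 0")
    case True
    then have "{b. c b \<noteq> 0} = {}" using c(1) by auto
    then show ?thesis unfolding True by (simp add: zero_M)
  next
    case False
    then have *: "{b. c b \<noteq> 0} = {coset L m}" using c(1) by auto
    have "c (coset L m) * m \<in> P" using c(2) by (auto simp: P_def)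
    then have "(\<Oplus>\<^bsub>M_on P\<^esub>b\<in>insert (coset L m) {}. c b \<odot>\<^bsub>M_on P\<^esub> b) =
        (c (coset L m) \<odot>\<^bsub>M_on P\<^esub> coset L m) \<oplus>\<^bsub>M_on P\<^esub> (\<Oplus>\<^bsub>M_on P\<^esub>b\<in>{}. c b \<odot>\<^bsub>M_on P\<^esub> b)"
      by (intro finsum_insert) (use sm[OF c(2)] in auto)
    then show ?thesis unfolding * sm[OF c(2)] by (simp add: add_M zero_M)
  qed
  have "module_basis (mpoly_ring Z) (M_on P) {coset L m}"
    unfolding module_basis_def
  proof (intro conjI ballI)
    show "{coset L m} \<subseteq> carrier (M_on P)" using mP by simp
    fix x assume "x \<in> carrier (M_on P)"
    then obtain f where f: "f \<in> monomial_module Z UNIV" "x = coset L (f * m)" by (auto simp: P_def)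
    let ?Q = "\<lambda>c. c \<in> UNIV \<rightarrow> carrier (mpoly_ring Z) \<and> finite {b. c b \<noteq> \<zero>\<^bsub>mpoly_ring Z\<^esub>} \<and>
      {b. c b \<noteq> \<zero>\<^bsub>mpoly_ring Z\<^esub>} \<subseteq> {coset L m} \<and>
      x = (\<Oplus>\<^bsub>M_on P\<^esub>b\<in>{b. c b \<noteq> \<zero>\<^bsub>mpoly_ring Z\<^esub>}. c b \<odot>\<^bsub>M_on P\<^esub> b)"
    show "\<exists>!c. ?Q c"
    proof (rule ex1I)
      let ?c = "\<lambda>b. if b = coset L m then f else 0"
      have supp: "{b. ?c b \<noteq> 0} \<subseteq> {coset L m}" by auto
      have "finite {b. ?c b \<noteq> 0}" by (rule finite_subset[OF supp]) simp
      moreover have "(\<Oplus>\<^bsub>M_on P\<^esub>b\<in>{b. ?c b \<noteq> 0}. ?c b \<odot>\<^bsub>M_on P\<^esub> b) = coset L (?c (coset L m) * m)"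
        by (rule lincomb[OF supp]) (use f in simp)
      ultimately show "?Q ?c" using supp f by (simp add: carrier_mpoly_ring)
      fix c assume c: "?Q c"
      then have supp: "{b. c b \<noteq> 0} \<subseteq> {coset L m}" and mem: "c (coset L m) \<in> monomial_module Z UNIV"
        by (auto simp: carrier_mpoly_ring)
      have "coset L (f * m) = coset L (c (coset L m) * m)"
        using c lincomb[OF supp mem] f(2) by simp
      from inj[OF f(1) mem this] have "f = c (coset L m)" .
      then show "c = ?c" using supp by (auto simp: fun_eq_iff)
    qed
  qed
  then show ?thesis
    unfolding free_module_def m_def[symmetric] eq using module_M_on[OF P Z(1)] by blast
qed

text \<open>Every monomial of \<open>W\<close> outside \<open>L\<close> lies in exactly one
  \<open>C p\<close>, which forces the component of \<open>w\<close> at \<open>p\<close> to be the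
  part of \<open>w\<close> supported on \<open>C p\<close>.\<close>

lemma unique_decomposition:
  assumes D: "finite D" "disjoint_family_on C D" "(\<Union>p\<in>D. C p) = {t \<in> T - U. Poly_Mapping.keys t \<subseteq> V}"
    and x: "x \<in> carrier M"
  shows "\<exists>!s. s \<in> (\<Pi>\<^sub>E p\<in>D. coset L ` monomial_module V (C p)) \<and> x = finsum M s D"
proof -
  obtain w where w: "w \<in> W" "x = coset L w" using x by (auto simp: carrier_M)
  have CT: "C p \<subseteq> T" and CU: "C p \<inter> U = {}" if "p \<in> D" for p using D(3) that by blast+
  have CW: "monomial_module V (C p) \<subseteq> W" if "p \<in> D" for p by (rule monomial_module_subset[OF CT[OF that]])
  have sums: "finsum M (\<lambda>p. coset L (g p)) D = coset L (\<Sum>p\<in>D. g p)"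
    if "\<And>p. p \<in> D \<Longrightarrow> g p \<in> monomial_module V (C p)" for g
    using finsum_M_on[OF W D(1), of g] that CW unfolding M_on_W by blast
  have congr: "finsum M s D = finsum M s' D"
    if "\<And>p. p \<in> D \<Longrightarrow> s p = s' p" "\<And>p. p \<in> D \<Longrightarrow> s' p \<in> coset L ` monomial_module V (C p)" for s s'
  proof -
    interpret abelian_group M using abelian_group_M_on[OF W] unfolding M_on_W .
    have "s' p \<in> carrier M" if "p \<in> D" for p
      unfolding carrier_M using \<open>\<And>p. p \<in> D \<Longrightarrow> s' p \<in> coset L ` monomial_module V (C p)\<close>[OF that] CW[OF that] by blast
    then show ?thesis by (intro finsum_cong') (use that(1) in auto)
  qed
  have other: "Poly_Mapping.lookup (g q) t = 0"
    if "\<And>p. p \<in> D \<Longrightarrow> g p \<in> monomial_module V (C p)" "p \<in> D" "q \<in> D" "q \<noteq> p" "t \<in> C p" for g p q t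
  proof -
    have "t \<notin> C q" using D(2) that(2-5) unfolding disjoint_family_on_def by blast
    then show ?thesis using that(1)[OF that(3)] by (auto simp: monomial_module_def in_keys_iff)
  qed
  have coeff: "Poly_Mapping.lookup (\<Sum>p\<in>D. g p) t = Poly_Mapping.lookup (g p) t"
    if "\<And>p. p \<in> D \<Longrightarrow> g p \<in> monomial_module V (C p)" "p \<in> D" "t \<in> C p" for g p t
  proof -
    have "(\<Sum>q\<in>D. Poly_Mapping.lookup (g q) t) = (\<Sum>q\<in>{p}. Poly_Mapping.lookup (g q) t)"
      by (rule sum.mono_neutral_right[OF D(1)]) (use that other[of g p _ t] in auto)
    then show ?thesis by (simp add: lookup_sum)
  qed
  let ?g = "\<lambda>p. restr (C p) w"
  have g: "?g p \<in> monomial_module V (C p)" for p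
    using restr_in_monomial_module[OF w(1), of "C p"] by (auto simp: monomial_module_def)
  let ?s = "restrict (\<lambda>p. coset L (?g p)) D"
  show ?thesis
  proof (rule ex1I[of _ ?s])
    have "w - (\<Sum>p\<in>D. ?g p) \<in> L"
      unfolding monomial_module_def
    proof (intro CollectI ballI)
      fix t assume t: "t \<in> Poly_Mapping.keys (w - (\<Sum>p\<in>D. ?g p))"
      have "(\<Sum>p\<in>D. ?g p) \<in> W" using g CW by (intro submod_sum[OF W]) blast
      then have "w - (\<Sum>p\<in>D. ?g p) \<in> W" by (rule monomial_module_diff[OF w(1)])
      then have tW: "Poly_Mapping.keys t \<subseteq> V" "t \<in> T" using t unfolding monomial_module_def by blast+
      have "t \<in> U"
      proof (rule ccontr)
        assume "t \<notin> U"
        then have "t \<in> (\<Union>p\<in>D. C p)" unfolding D(3) using tW by simp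
        then obtain p where p: "p \<in> D" "t \<in> C p" by blast
        have "Poly_Mapping.lookup (\<Sum>p\<in>D. ?g p) t = Poly_Mapping.lookup w t"
          using coeff[of ?g p t] g p by (simp add: lookup_restr)
        then show False using t by (simp add: in_keys_iff lookup_minus)
      qed
      then show "Poly_Mapping.keys t \<subseteq> V \<and> t \<in> U" using tW by blast
    qed
    then have "x = coset L (\<Sum>p\<in>D. ?g p)" using w(2) coset_eq_iff[OF L] by blast
    also have "\<dots> = finsum M (\<lambda>p. coset L (?g p)) D" by (rule sums[OF g, symmetric])
    also have "\<dots> = finsum M ?s D" by (rule congr) (use g in auto)
    finally show "?s \<in> (\<Pi>\<^sub>E p\<in>D. coset L ` monomial_module V (C p)) \<and> x = finsum M ?s D"
      using g by auto
  next
    fix s assume s: "s \<in> (\<Pi>\<^sub>E p\<in>D. coset L ` monomial_module V (C p)) \<and> x = finsum M s D"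
    then have "\<exists>h\<in>monomial_module V (C p). s p = coset L h" if "p \<in> D" for p
      using that by (auto simp: PiE_iff)
    then obtain h where h: "\<And>p. p \<in> D \<Longrightarrow> h p \<in> monomial_module V (C p)" "\<And>p. p \<in> D \<Longrightarrow> s p = coset L (h p)"
      by metis
    have "finsum M s D = finsum M (\<lambda>p. coset L (h p)) D" by (rule congr) (use h in auto)
    then have "coset L w = coset L (\<Sum>p\<in>D. h p)" using s sums[of h] h(1) w(2) by simp
    then have wh: "w - (\<Sum>p\<in>D. h p) \<in> L" using coset_eq_iff[OF L] by blast
    have "h p = ?g p" if p: "p \<in> D" for p
    proof (rule poly_mapping_eqI)
      fix t
      show "Poly_Mapping.lookup (h p) t = Poly_Mapping.lookup (?g p) t"
      proof (cases "t \<in> C p")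
        case True
        then have "t \<notin> U" using CU[OF p] by blast
        then have "Poly_Mapping.lookup (w - (\<Sum>p\<in>D. h p)) t = 0"
          using wh by (auto simp: monomial_module_def in_keys_iff)
        then show ?thesis using coeff[of h p t] h(1) p True by (simp add: lookup_restr lookup_minus)
      next
        case False
        then have "Poly_Mapping.lookup (h p) t = 0"
          using h(1)[OF p] by (auto simp: monomial_module_def in_keys_iff)
        then show ?thesis using False by (simp add: lookup_restr)
      qed
    qed
    then have "s p = ?s p" if "p \<in> D" for p using h(2) that by simp
    moreover have "s p = ?s p" if "p \<notin> D" for p using s that by (auto simp: PiE_iff extensional_def)
    ultimately show "s = ?s" by blast
  qed
qed

lemma sdepth_ge:
  assumes "decomposable p V {t \<in> T - U. Poly_Mapping.keys t \<subseteq> V}" "\<not> W \<subseteq> L"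
  shows "enat p \<le> sdepth V M (ideal_quot_grading V W L)"
proof -
  let ?lev = "{t \<in> T - U. Poly_Mapping.keys t \<subseteq> V}"
  obtain D where D: "finite D" "(\<Union>c\<in>D. cylinder c) = ?lev" "disjoint_family_on cylinder D"
    and D0: "\<forall>(u, Z)\<in>D. Poly_Mapping.keys u \<subseteq> V \<and> Z \<subseteq> V \<and> p \<le> card Z"
    using assms(1) unfolding decomposable_def by blast
  have Dp: "Poly_Mapping.keys u \<subseteq> V \<and> Z \<subseteq> V \<and> p \<le> card Z" if "(u, Z) \<in> D" for u Z
    using D0 that by blast
  have u_cyl: "u \<in> cylinder (u, Z)" for u :: "'v \<Rightarrow>\<^sub>0 nat" and Z
    unfolding cylinder_def by (intro CollectI exI[of _ 0]) simp
  have u_lev: "u \<in> ?lev" if "(u, Z) \<in> D" for u Z using D(2) u_cyl[of u Z] that by blast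
  define h where "h = (\<lambda>(u, Z :: 'v set). (coset L (Poly_Mapping.single u 1), Z))"
  have inj: "inj_on h D"
  proof (rule inj_onI)
    fix a b assume ab: "a \<in> D" "b \<in> D" "h a = h b"
    obtain u Z u' Z' where uz: "a = (u, Z)" "b = (u', Z')" by (metis surj_pair)
    have "Poly_Mapping.single u 1 - Poly_Mapping.single u' 1 \<in> L"
      using ab(3) coset_eq_iff[OF L] unfolding uz h_def by simp
    then have "u \<notin> Poly_Mapping.keys (Poly_Mapping.single u 1 - Poly_Mapping.single u' (1::'k))"
      using u_lev[of u Z] ab(1) uz unfolding monomial_module_def by blast
    then have "u = u'" by (auto simp: in_keys_iff lookup_minus lookup_single when_def split: if_splits)
    then show "a = b" using ab(3) uz by (simp add: h_def)
  qed
  \<comment> \<open>Stanley spaces are indexed by cosets, not by exponents. Since \<open>h\<close>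
    is injective on \<open>D\<close>, the cylinder can be recovered from the coset and
    \<open>Z\<close>.\<close>
  define C where "C p = cylinder (inv_into D h p)" for p
  have C: "C (h c) = cylinder c" if "c \<in> D" for c using inj that by (simp add: C_def)
  have cyc: "cyclic_space M (fst (h c)) (snd (h c)) = coset L ` monomial_module V (C (h c))" if "c \<in> D" for c
  proof -
    obtain u Z where c: "c = (u, Z)" by (cases c)
    then show ?thesis using cyclic_space_monomial[of Z u] Dp[of u Z] C[OF that] that by (simp add: h_def)
  qed
  have "stanley_decomposition V M (ideal_quot_grading V W L) (h ` D)"
    unfolding stanley_decomposition_def
  proof (intro conjI ballI)
    show "finite (h ` D)" using D(1) by simp
    fix q assume "q \<in> h ` D"
    then obtain u Z where c: "(u, Z) \<in> D" "q = h (u, Z)" by auto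
    note uZ = Dp[OF c(1)] u_lev[OF c(1)]
    have "coset L (Poly_Mapping.single u 1) \<in> ideal_quot_grading V W L (\<lambda>v. int (Poly_Mapping.lookup u v))"
      unfolding ideal_quot_grading_def
    proof (rule image_eqI)
      show "coset L (Poly_Mapping.single u 1) = L +>\<^bsub>mpoly_ring V\<^esub> Poly_Mapping.single u 1"
        by (rule a_r_coset_eq[symmetric]) simp
      show "Poly_Mapping.single u 1 \<in> W \<inter> multidegree_part (\<lambda>v. int (Poly_Mapping.lookup u v))"
        using uZ single_in_monomial_module[of u V T 1] by (auto simp: multidegree_part_def)
    qed
    moreover have "cylinder (u, Z) \<inter> U = {}" using D(2) c(1) by blast
    then have "free_module (mpoly_ring Z) (M\<lparr>carrier := cyclic_space M (coset L (Poly_Mapping.single u 1)) Z\<rparr>)"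
      using uZ by (intro free_module_cyclic_space) auto
    ultimately show "stanley_space V M (ideal_quot_grading V W L) q"
      using uZ unfolding stanley_space_def c(2) h_def by auto
  next
    fix x assume x: "x \<in> carrier M"
    have "\<exists>!s. s \<in> (\<Pi>\<^sub>E q\<in>h ` D. coset L ` monomial_module V (C q)) \<and> x = finsum M s (h ` D)"
    proof (rule unique_decomposition[OF _ _ _ x])
      show "finite (h ` D)" using D(1) by simp
      show "disjoint_family_on C (h ` D)"
        using D(3) C unfolding disjoint_family_on_def by (metis (no_types, lifting) imageE)
      show "(\<Union>q\<in>h ` D. C q) = ?lev" using D(2) C by simp
    qed
    moreover have "(\<Pi>\<^sub>E (u, Z)\<in>h ` D. cyclic_space M u Z) = (\<Pi>\<^sub>E q\<in>h ` D. coset L ` monomial_module V (C q))"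
      by (rule PiE_cong) (use cyc in \<open>auto simp: case_prod_unfold\<close>)
    ultimately show "\<exists>!s. s \<in> (\<Pi>\<^sub>E (u, Z)\<in>h ` D. cyclic_space M u Z) \<and> x = finsum M s (h ` D)" by simp
  qed
  then have "enat (sdepth_of_decomposition (h ` D)) \<le> sdepth V M (ideal_quot_grading V W L)"
    unfolding sdepth_def carrier_M_trivial_iff using assms(2) by (auto intro!: Sup_upper)
  moreover have "p \<le> sdepth_of_decomposition (h ` D)"
    unfolding sdepth_of_decomposition_def
  proof (rule Min.boundedI)
    \<comment> \<open>\<open>Min\<close> is unspecified on the empty set; an empty decomposition
      would mean that the quotient is zero.\<close>
    show "(\<lambda>(u, Z). card Z) ` h ` D \<noteq> {}"
    proof
      assume "(\<lambda>(u, Z). card Z) ` h ` D = {}"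
      then have "?lev = {}" using D(2) by auto
      then have "W \<subseteq> L" by (auto simp: monomial_module_def)
      then show False using assms(2) by blast
    qed
    show "p \<le> m" if "m \<in> (\<lambda>(u, Z). card Z) ` h ` D" for m
      using that Dp by (auto simp: h_def)
  qed (use D(1) in simp)
  ultimately show ?thesis by (meson enat_ord_simps(1) order_trans)
qed

end

theorem corollary2p6:
  fixes n :: nat and E :: "nat set set"
    and S :: "(nat, 'k::field) mpoly ring" and I :: "(nat, 'k) mpoly set"
  assumes "simple_graph {1..n} E"
  defines "S \<equiv> mpoly_ring {1..n}" and "I \<equiv> edge_ideal {1..n} E"
  shows "\<exists>k\<^sub>0. \<forall>k\<ge>k\<^sub>0.
    depth (irrelevant_ideal {1..n}) (ideal_quot S (ideal_power S I k) (ideal_power S I (k + 1)))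
    \<le> sdepth {1..n} (ideal_quot S (ideal_power S I k) (ideal_power S I (k + 1)))
        (ideal_quot_grading {1..n} (ideal_power S I k) (ideal_power S I (k + 1)))"
proof -
  let ?V = "{1..n}"
  obtain p where p: "good p ?V E" using simple_graph_good[OF assms(1)] by blast
  then obtain K where K: "\<And>k. E \<noteq> {} \<Longrightarrow> k \<ge> K \<Longrightarrow> \<exists>cs u. length cs = p \<and> witness ?V E k cs u"
    unfolding good_def by blast
  have power: "ideal_power S I k = monomial_module ?V (edge_power E k)" for k
    unfolding S_def I_def by (rule edge_ideal_power_eq[OF assms(1)])
  show ?thesis
  \<comment> \<open>\<open>K\<close> says nothing about a graph without edges; there
    \<open>k \<ge> 1\<close> makes the quotient zero, and the Stanley depth is infinite by
    convention.\<close>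
  proof (intro exI[of _ "max 1 K"] allI impI)
    fix k assume k: "max 1 K \<le> k"
    interpret Q: monomial_quotient ?V "edge_power E k" "edge_power E (k + 1)" "TYPE('k)"
      by unfold_locales (simp_all add: upset_edge_power edge_power_Suc_subset)
    show "depth (irrelevant_ideal ?V) (ideal_quot S (ideal_power S I k) (ideal_power S I (k + 1)))
      \<le> sdepth ?V (ideal_quot S (ideal_power S I k) (ideal_power S I (k + 1)))
        (ideal_quot_grading ?V (ideal_power S I k) (ideal_power S I (k + 1)))"
    proof (cases "Q.W \<subseteq> Q.L")
      case True
      then show ?thesis
        unfolding power unfolding S_def sdepth_def Q.carrier_M_trivial_iff by simp
    next
      case False
      have "E \<noteq> {}"
      proof
        assume "E = {}"
        then have "edge_power E k = {}" using k by (auto simp: edge_power_empty)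
        then show False using False by (auto simp: monomial_module_def)
      qed
      then obtain cs u where w: "length cs = p" "witness ?V E k cs u" using K k by force
      have "depth (irrelevant_ideal ?V) Q.M \<le> enat p"
      proof (rule Q.depth_le[OF _ False])
        fix rs :: "(nat, 'k) mpoly list"
        assume rs: "set rs \<subseteq> irrelevant_ideal ?V" "regular_mod Q.W Q.L rs"
        have "length rs \<le> length cs"
          by (rule witness_regular_mod_length_le[OF w(2)])
            (use rs irrelevant_ideal_sum[of ?V] in auto)
        then show "length rs \<le> p" using w(1) by simp
      qed
      also have "enat p \<le> sdepth ?V Q.M (ideal_quot_grading ?V Q.W Q.L)"
        by (rule Q.sdepth_ge[OF _ False]) (use p in \<open>simp add: good_def edge_level_def\<close>)
      finally show ?thesis unfolding power unfolding S_def .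
    qed
  qed
qed

end
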